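(* Let $T>0$ and let $V$ be a probability vector field satisfying: (H1) there is $C>0$ such that for all $\mu\in\mathcal P_c(\mathbb R^d)$, $\sup_{(x,v)\in\operatorname{supp}V[\mu]}|v|\le C\bigl(1+\sup_{x\in\operatorname{supp}\mu}|x|\bigr)$; (H2) the map $V:\mathcal P_c(\mathbb R^d)\to\mathcal P_c(T\mathbb R^d)$ is continuous. Let $\mu_0\in\mathcal P_c(\mathbb R^d)$. Then the mean velocity scheme $\hat{\boldsymbol\mu}^N=\{\hat\mu^N_t\}_{t\in[0,T]}$ with initial datum $\mu_0$ converges, up to a subsequence, to a solution of $\dot\mu_t=V[\mu_t]$ on $(0,T)$, $\mu_{t=0}=\mu_0$.
   Context: Notation: $\mathcal P(X)$ (resp. $\mathcal P_c(X)$) is the set of Borel probability measures on $X$ (resp. with compact support); $\mathcal P_c(X)$ carries the 1-Wasserstein distance $W^X$; $T\mathbb R^d=\mathbb R^d\times\mathbb R^d$ with elements $(x,v)$; $\pi_1(x,v)=x$; $\sharp$ is push-forward. Convergence of the scheme means convergence of the curves uniformly in $t\in[0,T]$ in $W^{\mathbb R^d}$. A probability vector field (PVF) is a map $V$ from probability measures on $\mathbb R^d$ to probability measures on $T\mathbb R^d$ with $\pi_1\sharp V[\mu]=\mu$; $V[\mu]=\mu\otimes\nu_x[\mu]$ denotes its disintegration w.r.t. $\pi_1$, i.e. $\int g\,dV[\mu]=\int\int g(x,v)\,d\nu_x[\mu](v)\,d\mu(x)$. Solution of $\dot\mu_t=V[\mu_t]$, $\mu_{t=0}=\mu_0$: a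 map $t\mapsto\mu_t\in\mathcal P(\mathbb R^d)$ with $\mu_{t=0}=\mu_0$ such that for every $f\in C_c^\infty(\mathbb R^d)$, $\int_{T\mathbb R^d}\nabla f(x)\cdot v\,dV[\mu_t](x,v)$ is defined for a.e. $t$ and in $L^1([0,T])$, $t\mapsto\int f\,d\mu_t$ is absolutely continuous, and $\frac{d}{dt}\int f\,d\mu_t=\int_{T\mathbb R^d}\nabla f(x)\cdot v\,dV[\mu_t](x,v)$ for a.e. $t$. Mean velocity scheme: for $N\ge1$ let $\Delta t=T/N$, $t_j=j\Delta t$. Set $\hat\mu^N_0=\mu_0$ and, recursively for $j=0,\dots,N-1$, let $\bar v_{t_j}(x)=\int_{\mathbb R^d}v\,d\nu_x[\hat\mu^N_{t_j}](v)$ (defined for $\hat\mu^N_{t_j}$-a.e. $x$) and let $\hat\mu^N_{t_{j+1}}$ be the push-forward of $\hat\mu^N_{t_j}$ by $x\mapsto x+\Delta t\,\bar v_{t_j}(x)$. For $t\in(t_j,t_{j+1}]$, $\hat\mu^N_t$ is the push-forward of $\hat\mu^N_{t_j}$ by $x\mapsto x+(t-t_j)\bar v_{t_j}(x)$. *)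

theory Defs
  imports "HOL-Probability.Probability"
begin

text \<open>
  The space \<open>\<real>\<^sup>d\<close> is an arbitrary Euclidean space \<open>'a\<close>, and \<open>T\<real>\<^sup>d\<close> is \<open>'a \<times> 'a\<close> with its Euclidean
  product metric.
\<close>

abbreviation probs :: "'a::topological_space measure set" where
  "probs \<equiv> space (prob_algebra borel)"

definition msupport :: "'a::topological_space measure \<Rightarrow> 'a set" where
  "msupport \<mu> = {x. \<forall>U. open U \<longrightarrow> x \<in> U \<longrightarrow> emeasure \<mu> U > 0}"

definition probs_c :: "'a::topological_space measure set" where
  "probs_c = {\<mu> \<in> probs. compact (msupport \<mu>)}"

definition transport_plans ::
  "'a::topological_space measure \<Rightarrow> 'a measure \<Rightarrow> ('a \<times> 'a) measure set" where
  "transport_plans \<mu> \<nu> = {\<tau> \<in> probs. distr \<tau> borel fst = \<mu> \<and> distr \<tau> borel snd = \<nu>}"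

definition wasserstein :: "'a::euclidean_space measure \<Rightarrow> 'a measure \<Rightarrow> ennreal" where
  "wasserstein \<mu> \<nu> = (INF \<tau>\<in>transport_plans \<mu> \<nu>. \<integral>\<^sup>+ (x, y). ennreal (dist x y) \<partial>\<tau>)"

definition wasserstein_continuous ::
  "('a::euclidean_space measure \<Rightarrow> 'b::euclidean_space measure) \<Rightarrow> bool" where
  "wasserstein_continuous F \<longleftrightarrow>
     (\<forall>\<mu>\<in>probs_c. F \<mu> \<in> probs_c) \<and>
     (\<forall>\<mu>\<in>probs_c. \<forall>\<epsilon>>0::real. \<exists>\<delta>>0::real. \<forall>\<nu>\<in>probs_c.
        wasserstein \<mu> \<nu> < ennreal \<delta> \<longrightarrow> wasserstein (F \<mu>) (F \<nu>) < ennreal \<epsilon>)"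

definition uniformly_converges ::
  "real \<Rightarrow> (nat \<Rightarrow> real \<Rightarrow> 'a::euclidean_space measure) \<Rightarrow> (real \<Rightarrow> 'a measure) \<Rightarrow> bool" where
  "uniformly_converges T m \<mu> \<longleftrightarrow>
     (\<forall>t\<in>{0..T}. \<mu> t \<in> probs_c) \<and>
     ((\<lambda>k. SUP t\<in>{0..T}. wasserstein (m k t) (\<mu> t)) \<longlonglongrightarrow> 0)"

definition prob_vector_field ::
  "('a::euclidean_space measure \<Rightarrow> ('a \<times> 'a) measure) \<Rightarrow> bool" where
  "prob_vector_field V \<longleftrightarrow> (\<forall>\<mu>\<in>probs. V \<mu> \<in> probs \<and> distr (V \<mu>) borel fst = \<mu>)"

definition is_disintegration ::
  "('a::euclidean_space \<times> 'a) measure \<Rightarrow> 'a measure \<Rightarrow> ('a \<Rightarrow> 'a measure) \<Rightarrow> bool" where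
  "is_disintegration M \<mu> \<nu> \<longleftrightarrow>
     \<nu> \<in> borel \<rightarrow>\<^sub>M prob_algebra borel \<and>
     (\<forall>g\<in>borel_measurable borel.
        (\<integral>\<^sup>+ p. g p \<partial>M) = (\<integral>\<^sup>+ x. (\<integral>\<^sup>+ v. g (x, v) \<partial>\<nu> x) \<partial>\<mu>))"

text \<open>
  A disintegration of a probability measure on \<open>'a \<times> 'a\<close> exists and is unique up to a null set of
  \<open>\<mu>\<close>; the choice of a version does not affect the push-forwards below.
\<close>
definition disintegration ::
  "('a::euclidean_space measure \<Rightarrow> ('a \<times> 'a) measure) \<Rightarrow> 'a measure \<Rightarrow> 'a \<Rightarrow> 'a measure" where
  "disintegration V \<mu> = (SOME \<nu>. is_disintegration (V \<mu>) \<mu> \<nu>)"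

definition mean_velocity ::
  "('a::euclidean_space measure \<Rightarrow> ('a \<times> 'a) measure) \<Rightarrow> 'a measure \<Rightarrow> 'a \<Rightarrow> 'a" where
  "mean_velocity V \<mu> x = (\<integral>v. v \<partial>disintegration V \<mu> x)"

definition mean_velocity_push ::
  "('a::euclidean_space measure \<Rightarrow> ('a \<times> 'a) measure) \<Rightarrow> real \<Rightarrow> 'a measure \<Rightarrow> 'a measure" where
  "mean_velocity_push V s \<mu> = distr \<mu> borel (\<lambda>x. x + s *\<^sub>R mean_velocity V \<mu> x)"

primrec scheme_node ::
  "('a::euclidean_space measure \<Rightarrow> ('a \<times> 'a) measure) \<Rightarrow> real \<Rightarrow> 'a measure \<Rightarrow> nat \<Rightarrow> 'a measure" where
  "scheme_node V \<Delta>t \<mu>0 0 = \<mu>0"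
| "scheme_node V \<Delta>t \<mu>0 (Suc j) = mean_velocity_push V \<Delta>t (scheme_node V \<Delta>t \<mu>0 j)"

text \<open>
  For \<open>t > 0\<close>, the index \<open>j\<close> below is the one with \<open>j \<cdot> \<Delta>t < t \<le> (j + 1) \<cdot> \<Delta>t\<close>.
\<close>
definition mean_velocity_scheme ::
  "('a::euclidean_space measure \<Rightarrow> ('a \<times> 'a) measure) \<Rightarrow> real \<Rightarrow> 'a measure \<Rightarrow> nat \<Rightarrow> real \<Rightarrow> 'a measure"
where
  "mean_velocity_scheme V T \<mu>0 N t =
     (if t \<le> 0 then \<mu>0
      else let \<Delta>t = T / real N; j = nat (\<lceil>t / \<Delta>t\<rceil> - 1)
           in mean_velocity_push V (t - real j * \<Delta>t) (scheme_node V \<Delta>t \<mu>0 j))"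

primrec k_times_cont_diff :: "nat \<Rightarrow> ('a::euclidean_space \<Rightarrow> real) \<Rightarrow> bool" where
  "k_times_cont_diff 0 f \<longleftrightarrow> continuous_on UNIV f"
| "k_times_cont_diff (Suc k) f \<longleftrightarrow>
     (\<forall>x. f differentiable (at x)) \<and>
     (\<forall>b\<in>Basis. k_times_cont_diff k (\<lambda>x. frechet_derivative f (at x) b))"

definition test_functions :: "('a::euclidean_space \<Rightarrow> real) set" where
  "test_functions = {f. (\<forall>k. k_times_cont_diff k f) \<and> compact (closure {x. f x \<noteq> 0})}"

definition gradient :: "('a::euclidean_space \<Rightarrow> real) \<Rightarrow> 'a \<Rightarrow> 'a" where
  "gradient f x = (THE D. GDERIV f x :> D)"

definition absolutely_continuous_on :: "real set \<Rightarrow> (real \<Rightarrow> real) \<Rightarrow> bool" where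
  "absolutely_continuous_on S h \<longleftrightarrow>
     (\<forall>\<epsilon>>0. \<exists>\<delta>>0. \<forall>I. finite I \<longrightarrow>
        (\<forall>(a, b)\<in>I. a \<le> b \<and> {a..b} \<subseteq> S) \<longrightarrow>
        disjoint_family_on (\<lambda>(a, b). {a<..<b}) I \<longrightarrow>
        (\<Sum>(a, b)\<in>I. b - a) < \<delta> \<longrightarrow> (\<Sum>(a, b)\<in>I. \<bar>h b - h a\<bar>) < \<epsilon>)"

definition is_solution ::
  "('a::euclidean_space measure \<Rightarrow> ('a \<times> 'a) measure) \<Rightarrow> real \<Rightarrow> 'a measure \<Rightarrow>
    (real \<Rightarrow> 'a measure) \<Rightarrow> bool" where
  "is_solution V T \<mu>0 \<mu> \<longleftrightarrow>
     (\<forall>t\<in>{0..T}. \<mu> t \<in> probs) \<and> \<mu> 0 = \<mu>0 \<and>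
     (\<forall>f\<in>test_functions.
        (AE t in lebesgue. t \<in> {0..T} \<longrightarrow>
           integrable (V (\<mu> t)) (\<lambda>(x, v). gradient f x \<bullet> v)) \<and>
        (\<lambda>t. \<integral>(x, v). gradient f x \<bullet> v \<partial>V (\<mu> t)) absolutely_integrable_on {0..T} \<and>
        absolutely_continuous_on {0..T} (\<lambda>t. \<integral>x. f x \<partial>\<mu> t) \<and>
        (AE t in lebesgue. t \<in> {0..T} \<longrightarrow>
           ((\<lambda>s. \<integral>x. f x \<partial>\<mu> s) has_real_derivative
              (\<integral>(x, v). gradient f x \<bullet> v \<partial>V (\<mu> t))) (at t)))"

end

(*
  Along the scheme every particle starts at a point distributed according to the initial datum and
  follows a piecewise affine path; by (H1) these paths are uniformly bounded and uniformly
  Lipschitz. The laws of the paths are therefore compact: along a subsequence the random paths can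
  be realised on one probability space so that they converge almost surely, and the laws of the
  values at time t of the paths and of the limit path are then close in the Wasserstein distance,
  uniformly in t. On one cell of the scheme the integral of a test function changes, up to an error
  that is small relative to the time step, by the weak velocity of V at the node, since the mean
  velocity and V have the same pairing with a gradient field. By (H2) that weak velocity is close
  to the one of V at the limit, so the differential equation holds at every interior time.
*)
theory Submission
  imports Defs
begin

text \<open>The mean velocity is the barycentre of a disintegration: it is only measurable in
  \<open>x\<close>, and (H2) yields no continuity of it in the measure. The limit therefore cannot
  be taken in the equation of single particles. Only averages pass to the limit: the pairing of
  \<open>V\<close> with a gradient is stable in the Wasserstein distance as long as velocities stay
  bounded. A discrete Gronwall argument provides such a bound, independent of \<open>N\<close>.

  (H2) is continuity at each measure without uniformity, so the scheme is compared with the limit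
  near one fixed time. There the averaged test function minus its expected linear part is Lipschitz
  with a small constant on every cell, and Lipschitz constants, unlike errors, do not add up over
  the cells.

  Coding a path by one real number means that selection and almost sure realisation are applied to
  laws on the line only. The common probability space then turns the Wasserstein distance into
  something computable: the expected distance of two paths bounds it from above and is Lipschitz in
  time uniformly in \<open>N\<close>, which upgrades convergence at each time to uniform
  convergence.\<close>

section \<open>Supports and almost sure bounds\<close>

lemma probs_iff: "\<mu> \<in> probs \<longleftrightarrow> prob_space \<mu> \<and> sets \<mu> = sets borel"
  by (auto simp: space_prob_algebra)

lemma closed_msupport: "closed (msupport \<mu>)"
proof -
  have "- msupport \<mu> = \<Union>{U. open U \<and> emeasure \<mu> U = 0}"
    by (auto simp: msupport_def)
  also have "open \<dots>"
    by (rule open_Union) auto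
  finally show ?thesis
    by (simp add: closed_def)
qed

text \<open>The complement of the support is a union of possibly uncountably many open null sets; by
  the Lindelof property countably many of them already cover it.\<close>

lemma AE_msupport:
  fixes \<mu> :: "'a::second_countable_topology measure"
  assumes "sets \<mu> = sets borel"
  shows "AE x in \<mu>. x \<in> msupport \<mu>"
proof -
  let ?F = "{U. open U \<and> emeasure \<mu> U = 0}"
  have eq: "- msupport \<mu> = \<Union>?F"
    by (auto simp: msupport_def)
  obtain F' where F': "F' \<subseteq> ?F" "countable F'" "\<Union>F' = \<Union>?F"
    by (rule Lindelof[of ?F]) auto
  have "(\<Union>U\<in>F'. U) \<in> null_sets \<mu>"
    using F' assms by (intro null_sets_UN') (auto intro!: null_setsI)
  then have "- msupport \<mu> \<in> null_sets \<mu>"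
    using eq F' by simp
  then show ?thesis
    by (rule AE_I') auto
qed

lemma msupport_subset:
  assumes "closed S" "sets \<mu> = sets borel" "AE x in \<mu>. x \<in> S"
  shows "msupport \<mu> \<subseteq> S"
proof
  fix x assume x: "x \<in> msupport \<mu>"
  have sp: "space \<mu> = UNIV"
    using sets_eq_imp_space_eq[OF assms(2)] by simp
  have "{x \<in> space \<mu>. \<not> x \<in> S} = - S"
    using sp by auto
  then have "emeasure \<mu> (- S) = 0"
    using AE_iff_measurable[of "- S" \<mu> "\<lambda>x. x \<in> S"] assms by auto
  then show "x \<in> S"
    using x assms(1) unfolding msupport_def by (auto simp: closed_def)
qed

text \<open>Compactness of the support is traded for an almost sure norm bound, a form that passes
  easily through push-forwards and couplings.\<close>

lemma probs_c_iff:
  fixes \<mu> :: "'a::euclidean_space measure"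
  shows "\<mu> \<in> probs_c \<longleftrightarrow> \<mu> \<in> probs \<and> (\<exists>R. AE x in \<mu>. norm x \<le> R)"
proof (intro iffI conjI)
  assume \<mu>: "\<mu> \<in> probs_c"
  then show "\<mu> \<in> probs" by (simp add: probs_c_def)
  obtain R where "\<forall>x\<in>msupport \<mu>. norm x \<le> R"
    using \<mu> by (auto simp: probs_c_def bounded_iff dest!: compact_imp_bounded)
  moreover have "AE x in \<mu>. x \<in> msupport \<mu>"
    using \<mu> by (intro AE_msupport) (auto simp: probs_c_def probs_iff)
  ultimately show "\<exists>R. AE x in \<mu>. norm x \<le> R"
    by (intro exI[of _ R]) (auto elim: eventually_mono)
next
  assume \<mu>: "\<mu> \<in> probs \<and> (\<exists>R. AE x in \<mu>. norm x \<le> R)"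
  then obtain R where "AE x in \<mu>. x \<in> cball 0 R"
    by auto
  then have "msupport \<mu> \<subseteq> cball 0 R"
    using \<mu> by (intro msupport_subset) (auto simp: probs_iff)
  then have "bounded (msupport \<mu>)"
    using bounded_cball bounded_subset by blast
  then show "\<mu> \<in> probs_c"
    using \<mu> closed_msupport[of \<mu>] by (auto simp: probs_c_def compact_eq_bounded_closed)
qed

text \<open>Translates (H1), a comparison of suprema over supports in \<open>ennreal\<close>, into
  almost sure bounds by real numbers.\<close>

lemma AE_norm_velocity_le:
  fixes M :: "('a::euclidean_space \<times> 'a) measure"
  assumes M: "M \<in> probs" and \<mu>: "\<mu> \<in> probs" and "C \<ge> 0" "R \<ge> 0"
    and growth: "(SUP (x, v)\<in>msupport M. ennreal (norm v)) \<le>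
        ennreal C * (1 + (SUP x\<in>msupport \<mu>. ennreal (norm x)))"
    and R: "AE x in \<mu>. norm x \<le> R"
  shows "AE p in M. norm (snd p) \<le> C * (1 + R)"
proof -
  have "msupport \<mu> \<subseteq> cball 0 R"
    using R \<mu> by (intro msupport_subset) (auto simp: probs_iff)
  then have "(SUP x\<in>msupport \<mu>. ennreal (norm x)) \<le> ennreal R"
    by (intro SUP_least ennreal_leI) auto
  then have "1 + (SUP x\<in>msupport \<mu>. ennreal (norm x)) \<le> 1 + ennreal R"
    by (rule add_left_mono)
  also have "\<dots> = ennreal (1 + R)"
    using \<open>R \<ge> 0\<close> by simp
  finally have "ennreal C * (1 + (SUP x\<in>msupport \<mu>. ennreal (norm x))) \<le> ennreal C * ennreal (1 + R)"
    by (rule mult_left_mono) simp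
  with growth have *: "(SUP (x, v)\<in>msupport M. ennreal (norm v)) \<le> ennreal (C * (1 + R))"
    using \<open>C \<ge> 0\<close> \<open>R \<ge> 0\<close> by (simp add: ennreal_mult)
  have "norm (snd p) \<le> C * (1 + R)" if "p \<in> msupport M" for p
  proof -
    have "ennreal (norm (snd p)) \<le> (SUP (x, v)\<in>msupport M. ennreal (norm v))"
      using that by (intro SUP_upper2[of p]) (auto simp: case_prod_beta)
    with * have "ennreal (norm (snd p)) \<le> ennreal (C * (1 + R))"
      by (rule order_trans[rotated])
    then show ?thesis
      using \<open>C \<ge> 0\<close> \<open>R \<ge> 0\<close> by simp
  qed
  moreover have "AE p in M. p \<in> msupport M"
    using M by (intro AE_msupport) (auto simp: probs_iff)
  ultimately show ?thesis
    by (auto elim: eventually_mono)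
qed

subsection \<open>Coding a sequence of reals by one real\<close>

text \<open>
  Schoenberg's device: \<open>zigzag\<close> is \<open>2\<close>-periodic, \<open>0\<close> on \<open>[0, 1/3]\<close> and \<open>1\<close> on \<open>[2/3, 1]\<close>. It
  therefore reads off the \<open>n\<close>-th ternary digit (divided by two) of a point of the Cantor set
  after a multiplication by \<open>3 ^ n\<close>, and it does so continuously.
\<close>
definition zigzag :: "real \<Rightarrow> real" where
  "zigzag t = max 0 (min 1 (1/2 - cos (pi * t)))"

lemma zigzag_bounds: "0 \<le> zigzag t" "zigzag t \<le> 1"
  by (auto simp: zigzag_def)

lemma continuous_on_zigzag [continuous_intros]:
  fixes f :: "real \<Rightarrow> real"
  shows "continuous_on S f \<Longrightarrow> continuous_on S (\<lambda>x. zigzag (f x))"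
  unfolding zigzag_def by (intro continuous_intros)

lemma zigzag_plus_even: "zigzag (2 * of_int k + t) = zigzag t"
proof -
  have "cos (pi * (2 * of_int k + t)) = cos (pi * t + of_int k * (2 * pi))"
    by (simp add: algebra_simps)
  also have "\<dots> = cos (pi * t)"
    using cos.plus_of_int[of "pi * t" k] by (simp add: algebra_simps)
  finally show ?thesis
    by (simp add: zigzag_def)
qed

lemma zigzag_eq_0: "zigzag t = 0" if "0 \<le> t" "t \<le> 1/3"
proof -
  have "cos (pi/3) \<le> cos (pi * t)"
    using that by (intro cos_monotone_0_pi_le) (auto simp: field_simps mult_nonneg_nonneg)
  then show ?thesis
    by (simp add: zigzag_def cos_60)
qed

lemma zigzag_eq_1: "zigzag t = 1" if "2/3 \<le> t" "t \<le> 1"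
proof -
  have "cos (pi * t) \<le> cos (2 * pi / 3)"
    using that by (intro cos_monotone_0_pi_le) (auto simp: field_simps)
  then show ?thesis
    by (simp add: zigzag_def cos_120)
qed

definition binary_digit :: "nat \<Rightarrow> real \<Rightarrow> real" where
  "binary_digit n x = of_int (\<lfloor>2 ^ Suc n * x\<rfloor> mod 2)"

lemma binary_digit_cases: "binary_digit n x = 0 \<or> binary_digit n x = 1"
  unfolding binary_digit_def by (metis mod2_eq_if of_int_0 of_int_1)

lemma measurable_binary_digit [measurable]: "binary_digit n \<in> borel_measurable borel"
  unfolding binary_digit_def by measurable

text \<open>The partial sums are \<open>\<lfloor>2 ^ n * x\<rfloor> / 2 ^ n\<close>, which lies
  within \<open>2 ^ -n\<close> of \<open>x\<close>. The condition \<open>x < 1\<close> makes the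
  integer part vanish at the start of the induction.\<close>

lemma binary_digits_sums:
  assumes "0 \<le> x" "x < 1"
  shows "(\<lambda>n. binary_digit n x / 2 ^ Suc n) sums x"
proof -
  have partial: "(\<Sum>m<n. binary_digit m x / 2 ^ Suc m) = of_int \<lfloor>2 ^ n * x\<rfloor> / 2 ^ n" for n
  proof (induction n)
    case 0
    have "\<lfloor>x\<rfloor> = 0" using assms by linarith
    then show ?case by simp
  next
    case (Suc n)
    have "\<lfloor>2 ^ Suc n * x\<rfloor> div 2 = \<lfloor>2 ^ n * x\<rfloor>"
      using floor_divide_real_eq_div[of 2 "2 ^ Suc n * x"] by simp
    then have "\<lfloor>2 ^ Suc n * x\<rfloor> = 2 * \<lfloor>2 ^ n * x\<rfloor> + \<lfloor>2 ^ Suc n * x\<rfloor> mod 2"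
      by presburger
    then have "of_int \<lfloor>2 ^ Suc n * x\<rfloor> = 2 * of_int \<lfloor>2 ^ n * x\<rfloor> + binary_digit n x"
      unfolding binary_digit_def by (metis of_int_add of_int_mult of_int_numeral)
    with Suc show ?case
      by (simp add: field_simps)
  qed
  have "(\<lambda>n. of_int \<lfloor>2 ^ n * x\<rfloor> / 2 ^ n) \<longlonglongrightarrow> x"
  proof (rule tendsto_sandwich)
    have "(\<lambda>n. x - (1/2)^n) \<longlonglongrightarrow> x - 0"
      by (intro tendsto_intros LIMSEQ_realpow_zero) auto
    then show "(\<lambda>n. x - (1/2)^n) \<longlonglongrightarrow> x"
      by simp
    show "\<forall>\<^sub>F n in sequentially. x - (1/2)^n \<le> of_int \<lfloor>2 ^ n * x\<rfloor> / 2 ^ n"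
    proof (intro always_eventually allI)
      fix n
      have "(2 ^ n * x - 1) / 2 ^ n \<le> of_int \<lfloor>2 ^ n * x\<rfloor> / 2 ^ n"
        by (rule divide_right_mono) (linarith, simp)
      then show "x - (1/2)^n \<le> of_int \<lfloor>2 ^ n * x\<rfloor> / 2 ^ n"
        by (simp add: diff_divide_distrib power_divide)
    qed
    show "\<forall>\<^sub>F n in sequentially. of_int \<lfloor>2 ^ n * x\<rfloor> / 2 ^ n \<le> x"
      by (intro always_eventually allI) (simp add: field_simps)
  qed auto
  then show ?thesis
    unfolding sums_def partial .
qed

text \<open>All ternary digits are 0 or 2, so after multiplication by \<open>3 ^ n\<close> the
  earlier digits form an even integer, which periodicity removes. What remains is
  \<open>2 * a n / 3 + t / 3\<close> with \<open>t\<close> in [0, 1], a point of the plateau that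
  belongs to \<open>a n\<close>.\<close>

lemma zigzag_cantor:
  assumes a: "\<And>k. a k = 0 \<or> a k = (1::real)"
  shows "zigzag (3 ^ n * (\<Sum>k. 2 * a k / 3 ^ Suc k)) = a n"
proof -
  let ?c = "\<lambda>k. 2 * a k / 3 ^ Suc k"
  have a01: "0 \<le> a k" "a k \<le> 1" for k
    using a[of k] by auto
  have geo: "(\<lambda>k. 2 / 3 ^ Suc k) sums (1::real)"
    using sums_mult[OF geometric_sums[of "1/3::real"], of "2/3"] by (simp add: power_divide)
  have sm: "summable ?c"
    by (rule summable_comparison_test'[OF sums_summable[OF geo], of 0])
       (use a01 in \<open>auto simp: field_simps\<close>)
  define t where "t = (\<Sum>k. 2 * a (k + Suc n) / 3 ^ Suc k)"
  have smt: "summable (\<lambda>k. 2 * a (k + Suc n) / 3 ^ Suc k)"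
    by (rule summable_comparison_test'[OF sums_summable[OF geo], of 0])
       (use a01 in \<open>auto simp: field_simps\<close>)
  have t0: "0 \<le> t"
    unfolding t_def by (intro suminf_nonneg smt) (use a01 in auto)
  have t1: "t \<le> 1"
    unfolding t_def sums_unique[OF geo]
    by (intro suminf_le smt sums_summable[OF geo]) (use a01 in \<open>auto simp: field_simps\<close>)
  have split: "(\<Sum>k. ?c k) = (\<Sum>k. ?c (k + Suc n)) + (\<Sum>k<Suc n. ?c k)"
    by (rule suminf_split_initial_segment[OF sm])
  have "(\<Sum>k. ?c (k + Suc n)) = (\<Sum>k. (1 / 3 ^ Suc n) * (2 * a (k + Suc n) / 3 ^ Suc k))"
    by (simp add: power_add field_simps)
  also have "\<dots> = (1 / 3 ^ Suc n) * t"
    unfolding t_def by (rule suminf_mult[OF smt])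
  finally have tail: "3 ^ n * (\<Sum>k. ?c (k + Suc n)) = t / 3"
    by (simp add: field_simps)
  obtain m :: int where m: "3 ^ n * (\<Sum>k<n. ?c k) = 2 * of_int m"
  proof -
    have "\<exists>m::int. 3 ^ n * (\<Sum>k<n. ?c k) = 2 * of_int m"
    proof (induction n)
      case 0
      then show ?case by (auto intro: exI[of _ 0])
    next
      case (Suc n)
      then obtain m :: int where m: "3 ^ n * (\<Sum>k<n. ?c k) = 2 * of_int m" by auto
      have "3 ^ Suc n * (\<Sum>k<Suc n. ?c k) = 3 * (3 ^ n * (\<Sum>k<n. ?c k)) + 2 * a n"
        by (simp add: field_simps)
      also have "\<dots> = 2 * (3 * of_int m + a n)"
        using m by simp
      also have "\<exists>m'::int. \<dots> = 2 * of_int m'"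
        using a[of n] by (auto intro: exI[of _ "3 * m"] exI[of _ "3 * m + 1"])
      finally show ?case .
    qed
    then show ?thesis using that by auto
  qed
  have "3 ^ n * (\<Sum>k. ?c k) = 2 * of_int m + (2 * a n / 3 + t / 3)"
    unfolding split distrib_left tail using m by (simp add: distrib_left)
  then have "zigzag (3 ^ n * (\<Sum>k. ?c k)) = zigzag (2 * a n / 3 + t / 3)"
    by (simp only: zigzag_plus_even)
  also have "\<dots> = a n"
    using a[of n] t0 t1 by (auto intro!: zigzag_eq_0 zigzag_eq_1)
  finally show ?thesis .
qed

text \<open>The binary digits of all the \<open>x i\<close>, interleaved by the pairing function,
  become ternary digits 0 or 2. Encoding is merely measurable, but each \<open>decode_seq i\<close>
  is continuous on the whole line: convergence of codes forces convergence of the decoded numbers,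
  which is the direction that the compactness argument uses.\<close>

definition encode_seq :: "(nat \<Rightarrow> real) \<Rightarrow> real" where
  "encode_seq x = (\<Sum>k. 2 * (case prod_decode k of (i, m) \<Rightarrow> binary_digit m (x i)) / 3 ^ Suc k)"

definition decode_seq :: "nat \<Rightarrow> real \<Rightarrow> real" where
  "decode_seq i r = (\<Sum>m. zigzag (3 ^ prod_encode (i, m) * r) / 2 ^ Suc m)"

lemma decode_encode_seq:
  assumes "0 \<le> x i" "x i < 1"
  shows "decode_seq i (encode_seq x) = x i"
proof -
  have "zigzag (3 ^ prod_encode (i, m) * encode_seq x) = binary_digit m (x i)" for m
    using zigzag_cantor[of "\<lambda>k. case prod_decode k of (i, m) \<Rightarrow> binary_digit m (x i)" "prod_encode (i, m)"]
      binary_digit_cases by (auto simp: encode_seq_def split: prod.split)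
  then show ?thesis
    using sums_unique[OF binary_digits_sums[OF assms]] by (simp add: decode_seq_def)
qed

lemma half_powers_sums: "(\<lambda>m. 1 / 2 ^ Suc m) sums (1::real)"
  using power_half_series by (simp add: power_divide)

lemma continuous_decode_seq: "continuous_on UNIV (decode_seq i)"
proof -
  have "uniform_limit UNIV (\<lambda>n r. \<Sum>m<n. zigzag (3 ^ prod_encode (i, m) * r) / 2 ^ Suc m)
      (\<lambda>r. \<Sum>m. zigzag (3 ^ prod_encode (i, m) * r) / 2 ^ Suc m) sequentially"
    by (rule Weierstrass_m_test[of _ _ "\<lambda>m. 1 / 2 ^ Suc m"])
       (use half_powers_sums zigzag_bounds in \<open>auto simp: sums_iff field_simps\<close>)
  then have "continuous_on UNIV (\<lambda>r. \<Sum>m. zigzag (3 ^ prod_encode (i, m) * r) / 2 ^ Suc m)"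
    by (rule uniform_limit_theorem[rotated])
       (auto intro!: always_eventually continuous_intros)
  then show ?thesis
    unfolding decode_seq_def .
qed

lemma measurable_decode_seq [measurable]: "decode_seq i \<in> borel_measurable borel"
  by (rule borel_measurable_continuous_onI[OF continuous_decode_seq])

lemma measurable_encode_seq:
  assumes [measurable]: "\<And>i. x i \<in> borel_measurable M"
  shows "(\<lambda>\<omega>. encode_seq (\<lambda>i. x i \<omega>)) \<in> borel_measurable M"
  unfolding encode_seq_def case_prod_beta by measurable

lemma encode_seq_bounds: "0 \<le> encode_seq x" "encode_seq x \<le> 1"
proof -
  define c where "c = (\<lambda>k. 2 * (case prod_decode k of (i, m) \<Rightarrow> binary_digit m (x i)) / 3 ^ Suc k)"
  have geo: "(\<lambda>k. 2 / 3 ^ Suc k) sums (1::real)"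
    using sums_mult[OF geometric_sums[of "1/3::real"], of "2/3"] by (simp add: power_divide)
  have c: "0 \<le> c k" "c k \<le> 2 / 3 ^ Suc k" for k
    using binary_digit_cases[of "snd (prod_decode k)" "x (fst (prod_decode k))"]
    by (auto simp: c_def case_prod_beta)
  have "summable c"
    by (rule summable_comparison_test'[OF sums_summable[OF geo], of 0]) (use c in auto)
  then have "0 \<le> suminf c" "suminf c \<le> 1"
    using c suminf_le[OF c(2) _ sums_summable[OF geo]] sums_unique[OF geo] by (auto intro: suminf_nonneg)
  then show "0 \<le> encode_seq x" "encode_seq x \<le> 1"
    by (auto simp: encode_seq_def c_def)
qed

subsection \<open>Wasserstein distance and couplings\<close>

text \<open>The joint law of \<open>X\<close> and \<open>Y\<close> is one of the transport plans
  over which the infimum is taken.\<close>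

lemma wasserstein_distr_le:
  fixes X Y :: "'b \<Rightarrow> 'a::euclidean_space"
  assumes M: "prob_space M" and [measurable]: "X \<in> borel_measurable M" "Y \<in> borel_measurable M"
  shows "wasserstein (distr M borel X) (distr M borel Y) \<le> (\<integral>\<^sup>+ \<omega>. ennreal (dist (X \<omega>) (Y \<omega>)) \<partial>M)"
proof -
  interpret prob_space M by fact
  let ?\<tau> = "distr M (borel :: ('a \<times> 'a) measure) (\<lambda>\<omega>. (X \<omega>, Y \<omega>))"
  have [measurable]: "(\<lambda>\<omega>. (X \<omega>, Y \<omega>)) \<in> M \<rightarrow>\<^sub>M (borel :: ('a \<times> 'a) measure)"
    unfolding borel_prod[symmetric] by measurable
  have [measurable]: "fst \<in> (borel :: ('a \<times> 'a) measure) \<rightarrow>\<^sub>M borel" "snd \<in> (borel :: ('a \<times> 'a) measure) \<rightarrow>\<^sub>M borel"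
    unfolding borel_prod[symmetric] by measurable
  have "?\<tau> \<in> transport_plans (distr M borel X) (distr M borel Y)"
    by (auto simp: transport_plans_def probs_iff distr_distr o_def intro!: prob_space_distr)
  then have "wasserstein (distr M borel X) (distr M borel Y) \<le> (\<integral>\<^sup>+ (x, y). ennreal (dist x y) \<partial>?\<tau>)"
    unfolding wasserstein_def by (rule INF_lower)
  also have "\<dots> = (\<integral>\<^sup>+ \<omega>. ennreal (dist (X \<omega>) (Y \<omega>)) \<partial>M)"
    by (subst nn_integral_distr) (auto simp: case_prod_beta)
  finally show ?thesis .
qed

text \<open>The easy half of Kantorovich duality. The strict inequality supplies a plan of cost
  below \<open>\<delta>\<close> without knowing that the infimum is attained. Bounds on a set
  \<open>S\<close> of full measure are asked for because the intended integrand, a gradient paired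
  with a velocity, is bounded and Lipschitz only while velocities stay bounded.\<close>

lemma integral_diff_le_wasserstein:
  fixes M M' :: "'b::euclidean_space measure" and g :: "'b \<Rightarrow> real"
  assumes M: "M \<in> probs" and M': "M' \<in> probs" and W: "wasserstein M M' < ennreal \<delta>"
    and [measurable]: "g \<in> borel_measurable borel"
    and bdd: "\<And>p. p \<in> S \<Longrightarrow> \<bar>g p\<bar> \<le> B"
    and lip: "\<And>p q. p \<in> S \<Longrightarrow> q \<in> S \<Longrightarrow> \<bar>g p - g q\<bar> \<le> L * dist p q" and "L \<ge> 0"
    and S: "AE p in M. p \<in> S" "AE p in M'. p \<in> S" 
  shows "\<bar>(\<integral>p. g p \<partial>M) - (\<integral>p. g p \<partial>M')\<bar> \<le> L * \<delta>"
proof -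
  have sets[measurable_cong]: "sets M = sets borel" "sets M' = sets borel"
    using M M' by (auto simp: probs_iff)
  obtain \<tau> where \<tau>: "\<tau> \<in> transport_plans M M'" "(\<integral>\<^sup>+ (x, y). ennreal (dist x y) \<partial>\<tau>) < ennreal \<delta>"
    using W unfolding wasserstein_def INF_less_iff by auto
  then have [measurable_cong]: "sets \<tau> = sets borel" and ps: "prob_space \<tau>"
    and m: "distr \<tau> borel fst = M" "distr \<tau> borel snd = M'"
    by (auto simp: transport_plans_def probs_iff)
  interpret prob_space \<tau> by fact
  have [measurable]: "fst \<in> (borel :: ('b \<times> 'b) measure) \<rightarrow>\<^sub>M borel" "snd \<in> (borel :: ('b \<times> 'b) measure) \<rightarrow>\<^sub>M borel"
    unfolding borel_prod[symmetric] by measurable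
  have AE1: "AE p in \<tau>. fst p \<in> S" 
    using S(1) unfolding m(1)[symmetric] by (rule AE_distrD[rotated]) measurable
  have AE2: "AE p in \<tau>. snd p \<in> S"
    using S(2) unfolding m(2)[symmetric] by (rule AE_distrD[rotated]) measurable
  have B: "AE p in \<tau>. \<bar>g (fst p)\<bar> \<le> B" "AE p in \<tau>. \<bar>g (snd p)\<bar> \<le> B"
    using AE1 AE2 bdd by (auto elim: eventually_mono)
  have [simp]: "integrable \<tau> (\<lambda>p. g (fst p))" "integrable \<tau> (\<lambda>p. g (snd p))"
    using B by (auto intro!: integrable_const_bound[where B=B])
  have lipAE: "AE p in \<tau>. \<bar>g (fst p) - g (snd p)\<bar> \<le> L * dist (fst p) (snd p)"
    using AE1 AE2 by eventually_elim (rule lip)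
  have "(\<integral>p. g p \<partial>M) - (\<integral>p. g p \<partial>M') = (\<integral>p. g (fst p) - g (snd p) \<partial>\<tau>)"
    unfolding m[symmetric] by (simp add: integral_distr)
  then have "ennreal \<bar>(\<integral>p. g p \<partial>M) - (\<integral>p. g p \<partial>M')\<bar> \<le> (\<integral>\<^sup>+ p. ennreal \<bar>g (fst p) - g (snd p)\<bar> \<partial>\<tau>)"
    using integral_norm_bound_ennreal[of \<tau> "\<lambda>p. g (fst p) - g (snd p)"] by simp
  also have "\<dots> \<le> (\<integral>\<^sup>+ p. ennreal L * ennreal (dist (fst p) (snd p)) \<partial>\<tau>)"
    using lipAE \<open>L \<ge> 0\<close> by (intro nn_integral_mono_AE) (auto simp: ennreal_mult[symmetric] elim!: eventually_mono)
  also have "\<dots> = ennreal L * (\<integral>\<^sup>+ (x, y). ennreal (dist x y) \<partial>\<tau>)"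
    by (subst nn_integral_cmult) (auto simp: split_beta')
  also have "\<dots> \<le> ennreal L * ennreal \<delta>"
    using \<tau>(2) by (intro mult_left_mono) auto
  finally show ?thesis
    using \<open>L \<ge> 0\<close> \<tau>(2) by (cases "\<delta> \<ge> 0") (auto simp: ennreal_mult[symmetric] ennreal_neg)
qed

subsection \<open>Existence of disintegrations\<close>

text \<open>Testing on the set where \<open>g < f\<close> makes the integral of the difference there
  vanish; the finite integral of \<open>g\<close> is what permits subtraction in
  \<open>ennreal\<close>.\<close>

lemma AE_le_of_nn_integral_le:
  fixes f g :: "'b \<Rightarrow> ennreal"
  assumes [measurable]: "f \<in> borel_measurable M" "g \<in> borel_measurable M"
    and fin: "(\<integral>\<^sup>+x. g x \<partial>M) < \<infinity>"
    and le: "\<And>A. A \<in> sets M \<Longrightarrow> (\<integral>\<^sup>+x. f x * indicator A x \<partial>M) \<le> (\<integral>\<^sup>+x. g x * indicator A x \<partial>M)"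
  shows "AE x in M. f x \<le> g x"
proof -
  define A where "A = {x\<in>space M. g x < f x}"
  have [measurable]: "A \<in> sets M"
    unfolding A_def by measurable
  have fing: "(\<integral>\<^sup>+x. g x * indicator A x \<partial>M) \<noteq> \<infinity>"
  proof -
    have "(\<integral>\<^sup>+x. g x * indicator A x \<partial>M) \<le> (\<integral>\<^sup>+x. g x \<partial>M)"
      by (intro nn_integral_mono) (auto simp: indicator_def)
    then show ?thesis
      using fin by (auto simp: top_unique)
  qed
  have "(\<integral>\<^sup>+x. f x * indicator A x - g x * indicator A x \<partial>M) =
      (\<integral>\<^sup>+x. f x * indicator A x \<partial>M) - (\<integral>\<^sup>+x. g x * indicator A x \<partial>M)"
    using fing by (intro nn_integral_diff) (auto simp: A_def indicator_def)
  also have "\<dots> = 0"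
    using le[of A] fing by (simp add: diff_eq_0_iff_ennreal less_top top_unique order_le_less_trans)
  finally have "AE x in M. f x * indicator A x - g x * indicator A x = 0"
    by (subst (asm) nn_integral_0_iff_AE) auto
  then show ?thesis
    by (rule AE_mp)
       (auto simp: A_def indicator_def diff_eq_0_iff_ennreal not_less intro!: AE_I2 split: if_splits)
qed

text \<open>
  The conditional distribution functions at rational levels are Radon-Nikodym derivatives; their
  monotone right-continuous regularisation gives the kernel.
\<close>
lemma real_kernel_exists:
  fixes M :: "('b \<times> real) measure"
  assumes M: "prob_space M" and sets_M: "sets M = sets (N \<Otimes>\<^sub>M borel)"
    and unit: "AE p in M. 0 \<le> snd p \<and> snd p \<le> 1"
  obtains \<kappa> where "\<kappa> \<in> N \<rightarrow>\<^sub>M prob_algebra borel"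
    "\<And>A y. A \<in> sets N \<Longrightarrow>
      emeasure M (A \<times> {..y}) = (\<integral>\<^sup>+x. emeasure (\<kappa> x) {..y} * indicator A x \<partial>distr M N fst)"
proof -
  interpret M: prob_space M by fact
  note [measurable_cong] = sets_M
  define \<mu> where "\<mu> = distr M N fst"
  have sets_\<mu>[measurable_cong]: "sets \<mu> = sets N"
    by (simp add: \<mu>_def)
  interpret \<mu>: prob_space \<mu>
    unfolding \<mu>_def by (rule M.prob_space_distr) measurable
  \<comment> \<open>The part of \<open>M\<close> below level \<open>q\<close>, projected to the
    first coordinate. It is dominated by \<open>\<mu>\<close>, and its density is the conditional
    distribution function at level \<open>q\<close>.\<close>
  define D where "D q = distr (density M (indicator {p\<in>space M. snd p \<le> q})) N fst" for q :: real
  have sets_D: "sets (D q) = sets \<mu>" for q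
    by (simp add: D_def \<mu>_def)
  have emeasure_D: "emeasure (D q) A = emeasure M (A \<times> {..q})" if [measurable]: "A \<in> sets N" for A q
  proof -
    have "emeasure (D q) A = (\<integral>\<^sup>+p. indicator {p\<in>space M. snd p \<le> q} p * indicator (fst -` A \<inter> space M) p \<partial>M)"
      unfolding D_def by (subst emeasure_distr) (auto simp: emeasure_density)
    also have "\<dots> = (\<integral>\<^sup>+p. indicator (A \<times> {..q}) p \<partial>M)"
      by (intro nn_integral_cong) (auto simp: indicator_def)
    finally show ?thesis
      by simp
  qed
  have emeasure_\<mu>: "emeasure \<mu> A = emeasure M (A \<times> UNIV)" if [measurable]: "A \<in> sets N" for A
  proof -
    have "fst -` A \<inter> space M = A \<times> UNIV"
      using sets_eq_imp_space_eq[OF sets_M] sets.sets_into_space[OF that] by (auto simp: space_pair_measure)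
    then show ?thesis
      by (simp add: \<mu>_def emeasure_distr)
  qed
  have D_le: "emeasure (D q) A \<le> emeasure \<mu> A" if [measurable]: "A \<in> sets N" for A q
    unfolding emeasure_D[OF that] emeasure_\<mu>[OF that] by (intro emeasure_mono) auto
  have ac: "absolutely_continuous \<mu> (D q)" for q
    unfolding absolutely_continuous_def
  proof
    fix A assume A: "A \<in> null_sets \<mu>"
    then have "A \<in> sets N" using sets_\<mu> by auto
    then show "A \<in> null_sets (D q)"
      using A D_le[of A q] sets_D by (auto intro!: null_setsI)
  qed
  define f where "f q = RN_deriv \<mu> (D q)" for q
  have [measurable]: "f q \<in> borel_measurable N" for q
    using borel_measurable_RN_deriv[of \<mu> "D q"] sets_\<mu> by (simp add: f_def cong: measurable_cong_sets)
  have int_f: "(\<integral>\<^sup>+x. f q x * indicator A x \<partial>\<mu>) = emeasure M (A \<times> {..q})" if [measurable]: "A \<in> sets N" for A q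
  proof -
    have "(\<integral>\<^sup>+x. f q x * indicator A x \<partial>\<mu>) = emeasure (density \<mu> (f q)) A"
      by (subst emeasure_density) auto
    also have "density \<mu> (f q) = D q"
      unfolding f_def by (rule \<mu>.density_RN_deriv[OF ac sets_D])
    finally show ?thesis using emeasure_D by simp
  qed
  have fin_f: "(\<integral>\<^sup>+x. f q x \<partial>\<mu>) < \<infinity>" for q
  proof -
    have "(\<integral>\<^sup>+x. f q x \<partial>\<mu>) = (\<integral>\<^sup>+x. f q x * indicator (space N) x \<partial>\<mu>)"
      using sets_eq_imp_space_eq[OF sets_\<mu>] by (intro nn_integral_cong) auto
    also have "\<dots> = emeasure M (space N \<times> {..q})"
      by (rule int_f) auto
    finally show ?thesis
      by (simp add: M.emeasure_eq_measure)
  qed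
  have mono: "AE x in \<mu>. f q x \<le> f q' x" if "q \<le> q'" for q q'
    using that by (intro AE_le_of_nn_integral_le fin_f)
      (auto simp: int_f sets_\<mu> intro!: emeasure_mono)
  have le_1: "AE x in \<mu>. f q x \<le> 1" for q
    by (intro AE_le_of_nn_integral_le)
      (auto simp: int_f sets_\<mu> emeasure_\<mu> \<mu>.emeasure_space_1 intro!: emeasure_mono)
  \<comment> \<open>Since second coordinates lie in [0, 1], levels from 1 on and levels below 0
    already produce the values 1 and 0; the limits at infinity then need no separate
    argument.\<close>
  have ge_1: "AE x in \<mu>. 1 \<le> f q x" if "1 \<le> q" for q
  proof (intro AE_le_of_nn_integral_le fin_f)
    fix A assume "A \<in> sets \<mu>"
    then have A[measurable]: "A \<in> sets N" using sets_\<mu> by simp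
    have "emeasure M (A \<times> UNIV) \<le> emeasure M (A \<times> {..q})"
      by (intro emeasure_mono_AE, use unit in eventually_elim) (use that in auto)
    then show "(\<integral>\<^sup>+x. 1 * indicator A x \<partial>\<mu>) \<le> (\<integral>\<^sup>+x. f q x * indicator A x \<partial>\<mu>)"
      by (simp add: int_f emeasure_\<mu>)
  qed auto
  have eq_0: "AE x in \<mu>. f q x \<le> 0" if "q < 0" for q
  proof (intro AE_le_of_nn_integral_le)
    fix A assume "A \<in> sets \<mu>"
    then have A[measurable]: "A \<in> sets N" using sets_\<mu> by simp
    have "emeasure M (A \<times> {..q}) \<le> emeasure M {}"
      by (intro emeasure_mono_AE, use unit in eventually_elim) (use that in auto)
    then show "(\<integral>\<^sup>+x. f q x * indicator A x \<partial>\<mu>) \<le> (\<integral>\<^sup>+x. 0 * indicator A x \<partial>\<mu>)"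
      by (simp add: int_f)
  qed auto
  \<comment> \<open>Each condition holds off a null set depending on the levels; restricting to
    rational levels leaves countably many conditions, hence one common null set.\<close>
  define good where "good x \<longleftrightarrow>
    (\<forall>q q'::rat. q \<le> q' \<longrightarrow> f (of_rat q) x \<le> f (of_rat q') x) \<and> (\<forall>q::rat. f (of_rat q) x \<le> 1) \<and>
    (\<forall>q::rat. 1 \<le> q \<longrightarrow> 1 \<le> f (of_rat q) x) \<and> (\<forall>q::rat. q < 0 \<longrightarrow> f (of_rat q) x \<le> 0)" for x
  have [measurable]: "Measurable.pred N good"
    unfolding good_def by measurable
  have AE_good: "AE x in \<mu>. good x"
    unfolding good_def AE_conj_iff AE_all_countable
    using mono le_1 ge_1 eq_0 by (auto simp: of_rat_less_eq)
  \<comment> \<open>At bad points the distribution function of the unit mass at 0 is substituted, so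
    that every \<open>\<kappa> x\<close>, and not only almost every one, is a probability
    measure.\<close>
  define g where "g q x = (if good x then enn2real (f (of_rat q) x) else (if q \<ge> 0 then 1 else 0))"
    for q :: rat and x
  have [measurable]: "g q \<in> borel_measurable N" for q
    unfolding g_def by measurable
  have g_fin: "f (of_rat q) x < top" if "good x" for q x
    using that unfolding good_def by (meson ennreal_one_less_top order_le_less_trans)
  have g_mono: "g q x \<le> g q' x" if "q \<le> q'" for q q' x
    using that g_fin[of x q'] by (auto simp: g_def good_def intro!: enn2real_mono)
  have g_ge: "0 \<le> g q x" for q x
    by (auto simp: g_def)
  have g_le: "g q x \<le> 1" for q x
    by (auto simp: g_def good_def intro!: enn2real_leI)
  have g_1: "g q x = 1" if "1 \<le> q" for q x
  proof (cases "good x")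
    case True
    then have "f (of_rat q) x = 1"
      using that unfolding good_def by (meson antisym)
    then show ?thesis using True by (simp add: g_def)
  qed (use that in \<open>auto simp: g_def\<close>)
  have g_0: "g q x = 0" if "q < 0" for q x
  proof (cases "good x")
    case True
    then have "f (of_rat q) x = 0"
      using that unfolding good_def by (metis le_zero_eq)
    then show ?thesis using True by (simp add: g_def)
  qed (use that in \<open>auto simp: g_def\<close>)
  \<comment> \<open>The infimum over strictly larger rationals enforces right-continuity. The price
    is that \<open>F\<close> and \<open>f\<close> may differ at a given level, so the integral
    identity has to be recovered by a limit from above.\<close>
  define F where "F x y = (INF q\<in>{q::rat. y < of_rat q}. g q x)" for x and y :: real
  have ne: "{q::rat. y < of_rat q} \<noteq> {}" for y :: real
    using of_rat_dense[of y "y + 1"] by auto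
  have bdd: "bdd_below ((\<lambda>q. g q x) ` S)" for x S
    using g_ge by (intro bdd_belowI[of _ 0]) auto
  have F_le: "F x y \<le> g q x" if "y < of_rat q" for x y q
    unfolding F_def using that by (intro cINF_lower bdd) auto
  have F_ge: "c \<le> F x y" if "\<And>q. y < of_rat q \<Longrightarrow> c \<le> g q x" for x y c
    unfolding F_def using that ne by (intro cINF_greatest) auto
  have F_mono: "F x y \<le> F x y'" if "y \<le> y'" for x y y'
    by (rule F_ge) (use that in \<open>auto intro: F_le\<close>)
  have F_approx: "\<exists>q. y < of_rat q \<and> g q x < F x y + \<epsilon>" if "\<epsilon> > 0" for x y \<epsilon>
  proof -
    have "F x y < F x y + \<epsilon>" using that by simp
    then show ?thesis
      unfolding F_def by (subst (asm) cINF_less_iff[OF ne bdd]) auto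
  qed
  have F_rc: "continuous (at_right y) (F x)" for x y
  proof (subst continuous_at_right_real_increasing)
    show "\<forall>\<epsilon>>0. \<exists>\<delta>>0. F x (y + \<delta>) - F x y < \<epsilon>"
    proof (intro allI impI)
      fix \<epsilon> :: real assume "\<epsilon> > 0"
      then obtain q where q: "y < of_rat q" "g q x < F x y + \<epsilon>"
        using F_approx by blast
      have "F x (y + (of_rat q - y) / 2) \<le> g q x"
        using q by (intro F_le) (auto simp: field_simps)
      with q show "\<exists>\<delta>>0. F x (y + \<delta>) - F x y < \<epsilon>"
        by (intro exI[of _ "(of_rat q - y) / 2"]) auto
    qed
  qed (rule F_mono)
  have F_0: "F x y = 0" if "y < 0" for x y
  proof -
    obtain q where q: "y < of_rat q" "of_rat q < (0::real)"
      using of_rat_dense[OF \<open>y < 0\<close>] by auto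
    then have "F x y \<le> 0"
      using F_le[of y q x] g_0[of q x] by simp
    moreover have "0 \<le> F x y"
      by (rule F_ge) (rule g_ge)
    ultimately show ?thesis by simp
  qed
  have F_1: "F x y = 1" if "1 \<le> y" for x y
  proof -
    have *: "g q x = 1" if "y < of_rat q" for q
      using that \<open>1 \<le> y\<close> by (intro g_1) (metis le_less_trans less_imp_le of_rat_1 of_rat_less)
    have "{q::rat. y < of_rat q} \<noteq> {}" by (rule ne)
    then show ?thesis
      unfolding F_def by (simp add: * cong: INF_cong_simp)
  qed
  have bot: "(F x \<longlongrightarrow> 0) at_bot" for x
    by (rule tendsto_eventually) (auto simp: eventually_at_bot_linorder F_0 intro!: exI[of _ "-1"])
  have top: "(F x \<longlongrightarrow> 1) at_top" for x
    by (rule tendsto_eventually) (auto simp: eventually_at_top_linorder F_1 intro!: exI[of _ 1])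
  have [measurable]: "(\<lambda>x. F x y) \<in> borel_measurable N" for y
    unfolding F_def using bdd by (intro borel_measurable_cINF) auto
  define \<kappa> where "\<kappa> x = interval_measure (F x)" for x
  have rd: "real_distribution (\<kappa> x)" for x
    unfolding \<kappa>_def by (rule real_distribution_interval_measure[OF F_mono F_rc bot top])
  have Iic: "emeasure (\<kappa> x) {..y} = ennreal (F x y)" for x y
    unfolding \<kappa>_def by (rule emeasure_interval_measure_Iic[OF F_mono F_rc bot])
  show ?thesis
  proof
    show "\<kappa> \<in> N \<rightarrow>\<^sub>M prob_algebra borel"
    proof (rule measurable_prob_algebra_generated)
      show "sets (borel :: real measure) = sigma_sets UNIV (range atMost)"
        by (simp add: borel_eq_atMost)
      show "Int_stable (range (atMost :: real \<Rightarrow> _))"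
        by (auto simp: Int_stable_def)
      show "\<And>x. x \<in> space N \<Longrightarrow> prob_space (\<kappa> x)" "\<And>x. x \<in> space N \<Longrightarrow> sets (\<kappa> x) = sets borel"
        using rd by (auto simp: real_distribution_def real_distribution_axioms_def)
    qed (auto simp: Iic)
  next
    fix A y assume A[measurable]: "A \<in> sets N"
    \<comment> \<open>Rational levels decreasing to \<open>y\<close> within \<open>1 / Suc n\<close>
      carry the identity to \<open>y\<close>: dominated convergence acts on the kernel side,
      continuity from above on the side of \<open>M\<close>.\<close>
    have "\<exists>q. y < of_rat q \<and> of_rat q < y + 1 / Suc n" for n
      using of_rat_dense[of y "y + 1 / Suc n"] by simp
    then obtain q where q: "\<And>n. y < of_rat (q n)" "\<And>n. of_rat (q n) < y + 1 / Suc n"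
      by metis
    have g_tendsto: "(\<lambda>n. g (q n) x) \<longlonglongrightarrow> F x y" for x
    proof (rule LIMSEQ_I)
      fix \<epsilon> :: real assume "\<epsilon> > 0"
      then obtain q' where q': "y < of_rat q'" "g q' x < F x y + \<epsilon>"
        using F_approx by blast
      obtain n0 where n0: "1 / Suc n0 < of_rat q' - y"
        using q'(1) nat_approx_posE[of "of_rat q' - y"] by (auto simp: inverse_eq_divide)
      show "\<exists>n0. \<forall>n\<ge>n0. norm (g (q n) x - F x y) < \<epsilon>"
      proof (intro exI[of _ n0] allI impI)
        fix n assume "n0 \<le> n"
        then have "1 / real (Suc n) \<le> 1 / Suc n0"
          by (simp add: frac_le)
        then have "(of_rat (q n) :: real) < of_rat q'"
          using q(2)[of n] n0 by linarith
        then have "g (q n) x \<le> g q' x"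
          by (intro g_mono) (simp add: of_rat_less)
        then show "norm (g (q n) x - F x y) < \<epsilon>"
          using q' F_le[OF q(1)[of n], of x] by simp
      qed
    qed
    have int_g: "(\<integral>\<^sup>+x. ennreal (g (q n) x) * indicator A x \<partial>\<mu>) = emeasure M (A \<times> {..of_rat (q n)})" for n
    proof -
      have "(\<integral>\<^sup>+x. ennreal (g (q n) x) * indicator A x \<partial>\<mu>) = (\<integral>\<^sup>+x. f (of_rat (q n)) x * indicator A x \<partial>\<mu>)"
        using AE_good by (intro nn_integral_cong_AE) (auto elim!: eventually_mono simp: g_def g_fin)
      then show ?thesis by (simp add: int_f)
    qed
    have lim_g: "(\<lambda>n. \<integral>\<^sup>+x. ennreal (g (q n) x) * indicator A x \<partial>\<mu>) \<longlonglongrightarrow> (\<integral>\<^sup>+x. ennreal (F x y) * indicator A x \<partial>\<mu>)"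
    proof (rule nn_integral_dominated_convergence[where w="\<lambda>_. 1"])
      show "AE x in \<mu>. (\<lambda>n. ennreal (g (q n) x) * indicator A x) \<longlonglongrightarrow> ennreal (F x y) * indicator A x"
        by (intro AE_I2) (auto simp: indicator_def intro!: tendsto_ennrealI g_tendsto)
    qed (auto simp: \<mu>.emeasure_space_1 indicator_def g_le)
    have lim_M: "(\<lambda>n. emeasure M (A \<times> {..of_rat (q n)})) \<longlonglongrightarrow> emeasure M (A \<times> {..y})"
    proof (rule tendsto_sandwich)
      show "\<forall>\<^sub>F n in sequentially. emeasure M (A \<times> {..y}) \<le> emeasure M (A \<times> {..of_rat (q n)})"
        using q(1) by (intro always_eventually allI emeasure_mono) (auto intro: order_trans less_imp_le)
      show "\<forall>\<^sub>F n in sequentially. emeasure M (A \<times> {..of_rat (q n)}) \<le> emeasure M (A \<times> {..y + 1 / Suc n})"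
      proof (intro always_eventually allI emeasure_mono)
        fix n show "A \<times> {..of_rat (q n)} \<subseteq> A \<times> {..y + 1 / Suc n}"
          using less_imp_le[OF q(2)[of n]] by (auto simp del: of_nat_Suc)
      qed auto
      have "(\<lambda>n. emeasure M (A \<times> {..y + 1 / Suc n})) \<longlonglongrightarrow> emeasure M (\<Inter>n. A \<times> {..y + 1 / Suc n})"
      proof (rule Lim_emeasure_decseq)
        show "decseq (\<lambda>n. A \<times> {..y + 1 / Suc n})"
          by (rule antimonoI) (auto elim!: order_trans simp: frac_le)
      qed (auto simp: M.emeasure_eq_measure)
      also have "(\<Inter>n. A \<times> {..y + 1 / Suc n}) = A \<times> {..y}"
      proof (intro set_eqI iffI)
        fix p assume p: "p \<in> (\<Inter>n. A \<times> {..y + 1 / Suc n})"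
        have "snd p \<le> y"
        proof (rule field_le_epsilon)
          fix e :: real assume "e > 0"
          then obtain n where "1 / Suc n < e"
            using nat_approx_posE by (auto simp: inverse_eq_divide)
          moreover have "snd p \<le> y + 1 / Suc n"
            using p by (auto simp del: of_nat_Suc)
          ultimately show "snd p \<le> y + e" by linarith
        qed
        then show "p \<in> A \<times> {..y}"
          using p by (auto simp: mem_Times_iff)
      qed (auto elim: order_trans)
      finally show "(\<lambda>n. emeasure M (A \<times> {..y + 1 / Suc n})) \<longlonglongrightarrow> emeasure M (A \<times> {..y})" .
    qed auto
    show "emeasure M (A \<times> {..y}) = (\<integral>\<^sup>+x. emeasure (\<kappa> x) {..y} * indicator A x \<partial>distr M N fst)"
      using LIMSEQ_unique[OF lim_M lim_g[unfolded int_g]] unfolding Iic \<mu>_def .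
  qed
qed

text \<open>
  The sum over \<open>Basis\<close> inverts the coding of the coordinates, moved to \<open>[0, 1]\<close> by \<open>arctan\<close>.
\<close>
lemma measurable_embedding_real:
  obtains c :: "'a::euclidean_space \<Rightarrow> real" and d where
    "c \<in> borel_measurable borel" "d \<in> borel_measurable borel"
    "\<And>v. d (c v) = v" "\<And>v. 0 \<le> c v \<and> c v \<le> 1"
proof
  define c where "c v = encode_seq (\<lambda>i. 1/2 + arctan (v \<bullet> from_nat_into Basis i) / pi)" for v :: 'a
  define d :: "real \<Rightarrow> 'a"
    where "d r = (\<Sum>b\<in>Basis. tan (pi * (decode_seq (to_nat_on Basis b) r - 1/2)) *\<^sub>R b)" for r
  have [measurable]: "arctan \<in> borel_measurable borel"
    by (intro borel_measurable_continuous_onI continuous_at_imp_continuous_on ballI isCont_arctan)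
  show "c \<in> borel_measurable borel"
    unfolding c_def by (intro measurable_encode_seq) measurable
  show "d \<in> borel_measurable borel"
    unfolding d_def tan_def by measurable
  show "d (c v) = v" for v
  proof -
    have "decode_seq (to_nat_on Basis b) (c v) = 1/2 + arctan (v \<bullet> b) / pi" if "b \<in> Basis" for b
      unfolding c_def using that arctan_bounded[of "v \<bullet> b"] pi_gt_zero
      by (subst decode_encode_seq) (auto simp: field_simps countable_finite)
    then show ?thesis
      by (simp add: d_def tan_arctan euclidean_representation cong: sum.cong)
  qed
  show "0 \<le> c v \<and> c v \<le> 1" for v
    by (simp add: c_def encode_seq_bounds)
qed

text \<open>The second coordinate is sent into [0, 1] by the Borel injection \<open>c\<close>, the
  kernel is built on the real line, and the left inverse \<open>d\<close> pushes it back.\<close>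

lemma disintegration_exists:
  fixes M :: "('a::euclidean_space \<times> 'a) measure"
  assumes M: "M \<in> probs"
  shows "\<exists>\<nu>. is_disintegration M (distr M borel fst) \<nu>"
proof -
  have [measurable_cong]: "sets M = sets (borel \<Otimes>\<^sub>M borel)"
    using M unfolding probs_iff borel_prod by simp
  interpret prob_space M
    using M by (simp add: probs_iff)
  let ?\<mu> = "distr M borel fst"
  interpret \<mu>: prob_space ?\<mu>
    by (rule prob_space_distr) measurable
  obtain c :: "'a \<Rightarrow> real" and d where cd[measurable]: "c \<in> borel_measurable borel" "d \<in> borel_measurable borel"
    and dc: "\<And>v. d (c v) = v" and c: "\<And>v. 0 \<le> c v \<and> c v \<le> 1"
    using measurable_embedding_real by blast
  define M' where "M' = distr M (borel \<Otimes>\<^sub>M borel) (\<lambda>p. (fst p, c (snd p)))"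
  have ps': "prob_space M'"
    unfolding M'_def by (rule prob_space_distr) measurable
  interpret M': prob_space M' by fact
  have sets': "sets M' = sets (borel \<Otimes>\<^sub>M borel)"
    by (simp add: M'_def)
  have unit: "AE p in M'. 0 \<le> snd p \<and> snd p \<le> 1"
    unfolding M'_def using c by (subst AE_distr_iff) auto
  have \<mu>': "distr M' borel fst = ?\<mu>"
    unfolding M'_def by (subst distr_distr) (auto simp: o_def)
  obtain \<kappa> where \<kappa>[measurable]: "\<kappa> \<in> borel \<rightarrow>\<^sub>M prob_algebra borel"
    and em: "\<And>A y. A \<in> sets borel \<Longrightarrow>
      emeasure M' (A \<times> {..y}) = (\<integral>\<^sup>+x. emeasure (\<kappa> x) {..y} * indicator A x \<partial>?\<mu>)"
    using real_kernel_exists[OF ps' sets' unit] unfolding \<mu>' by blast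
  have \<kappa>'[measurable]: "\<kappa> \<in> borel \<rightarrow>\<^sub>M subprob_algebra borel"
    using \<kappa> by (rule measurable_prob_algebraD)
  have sets_\<kappa>[measurable_cong]: "sets (\<kappa> x) = sets borel" for x
    by (rule sets_kernel[OF \<kappa>']) simp
  define K where "K x = distr (\<kappa> x) (borel \<Otimes>\<^sub>M borel) (Pair x)" for x :: 'a
  have K[measurable]: "K \<in> borel \<rightarrow>\<^sub>M subprob_algebra (borel \<Otimes>\<^sub>M borel)"
    unfolding K_def by (rule measurable_distr2[OF _ \<kappa>']) measurable
  \<comment> \<open>The kernel is known only on the sets \<open>A \<times> {..y}\<close>; they are
    stable under intersection and generate the product sigma-algebra, so agreement there is
    enough.\<close>
  have eq: "M' = ?\<mu> \<bind> K"
  proof (rule measure_eqI_generator_eq)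
    let ?E = "{A \<times> {..y} | A y. A \<in> sets (borel :: 'a measure)} :: ('a \<times> real) set set"
    have E: "?E = {A \<times> B | A B. A \<in> sets borel \<and> B \<in> range atMost}"
      by auto
    have gen: "sets (borel \<Otimes>\<^sub>M borel :: ('a \<times> real) measure) = sigma_sets UNIV ?E"
      unfolding E
    proof (subst sets_pair_eq[where Ea="sets borel" and Eb="range atMost" and Ca="{UNIV}"
          and Cb="range (\<lambda>n. {..real n})"])
      show "sets (borel :: real measure) = sigma_sets (space borel) (range atMost)"
        by (simp add: borel_eq_atMost)
      show "sets (borel :: 'a measure) = sigma_sets (space borel) (sets borel)"
        using sets.sigma_sets_eq[of "borel :: 'a measure"] by simp
      show "\<Union>(range (\<lambda>n. {..real n})) = space borel"
        by (auto intro: real_arch_simple)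
    qed (auto simp: sets_measure_of)
    show "Int_stable ?E"
    proof (rule Int_stableI)
      fix X Y assume "X \<in> ?E" "Y \<in> ?E"
      then obtain A y A' y' where "X = A \<times> {..y}" "Y = A' \<times> {..y'}" "A \<in> sets borel" "A' \<in> sets borel"
        by blast
      then have "X \<inter> Y = (A \<inter> A') \<times> {..min y y'}" "A \<inter> A' \<in> sets borel"
        by auto
      then show "X \<inter> Y \<in> ?E"
        by blast
    qed
    show "?E \<subseteq> Pow UNIV" by simp
    show "sets M' = sigma_sets UNIV ?E"
      using sets' gen by simp
    show "sets (?\<mu> \<bind> K) = sigma_sets UNIV ?E"
      by (subst sets_bind[where N="borel \<Otimes>\<^sub>M borel"]) (auto simp: gen sets_kernel[OF K])
    show "range (\<lambda>n. UNIV \<times> {..real n}) \<subseteq> ?E"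
      by (auto intro: exI[of _ UNIV])
    show "(\<Union>n. UNIV \<times> {..real n}) = (UNIV :: ('a \<times> real) set)"
      by (auto intro: real_arch_simple)
    show "emeasure M' (UNIV \<times> {..real n}) \<noteq> \<infinity>" for n
      by simp
    fix X assume "X \<in> ?E"
    then obtain A y where X: "X = A \<times> {..y}" and [measurable]: "A \<in> sets borel"
      by auto
    have "emeasure (?\<mu> \<bind> K) X = (\<integral>\<^sup>+x. emeasure (K x) X \<partial>?\<mu>)"
      unfolding X by (rule emeasure_bind[where N="borel \<Otimes>\<^sub>M borel"]) auto
    also have "\<dots> = (\<integral>\<^sup>+x. emeasure (\<kappa> x) {..y} * indicator A x \<partial>?\<mu>)"
    proof (rule nn_integral_cong)
      fix x
      have "Pair x -` (A \<times> {..y}) \<inter> space (\<kappa> x) = (if x \<in> A then {..y} else {})"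
        using sets_eq_imp_space_eq[OF sets_\<kappa>[of x]] by auto
      then show "emeasure (K x) X = emeasure (\<kappa> x) {..y} * indicator A x"
        unfolding K_def X by (subst emeasure_distr) (auto simp: indicator_def)
    qed
    finally show "emeasure M' X = emeasure (?\<mu> \<bind> K) X"
      using em[of A y] by (simp add: X)
  qed
  define \<nu> where "\<nu> x = distr (\<kappa> x) borel d" for x
  have "is_disintegration M ?\<mu> \<nu>"
    unfolding is_disintegration_def
  proof (intro conjI ballI)
    show "\<nu> \<in> borel \<rightarrow>\<^sub>M prob_algebra borel"
      unfolding \<nu>_def by measurable
    fix g :: "'a \<times> 'a \<Rightarrow> ennreal" assume "g \<in> borel_measurable borel"
    then have [measurable]: "g \<in> borel_measurable (borel \<Otimes>\<^sub>M borel)"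
      unfolding borel_prod .
    have "(\<integral>\<^sup>+ p. g p \<partial>M) = (\<integral>\<^sup>+ p. g (fst p, d (snd p)) \<partial>M')"
      unfolding M'_def by (subst nn_integral_distr) (auto simp: dc)
    also have "\<dots> = (\<integral>\<^sup>+ x. (\<integral>\<^sup>+ p. g (fst p, d (snd p)) \<partial>K x) \<partial>?\<mu>)"
      unfolding eq by (rule nn_integral_bind[where B="borel \<Otimes>\<^sub>M borel"]) (auto cong: measurable_cong_sets)
    also have "\<dots> = (\<integral>\<^sup>+ x. (\<integral>\<^sup>+ v. g (x, v) \<partial>\<nu> x) \<partial>?\<mu>)"
      unfolding K_def \<nu>_def by (intro nn_integral_cong) (simp add: nn_integral_distr)
    finally show "(\<integral>\<^sup>+ p. g p \<partial>M) = (\<integral>\<^sup>+ x. (\<integral>\<^sup>+ v. g (x, v) \<partial>\<nu> x) \<partial>?\<mu>)" .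
  qed
  then show ?thesis by blast
qed

subsection \<open>The mean velocity\<close>

lemma
  fixes M :: "('a::euclidean_space \<times> 'a) measure" and \<nu> :: "'a \<Rightarrow> 'a measure"
  assumes M: "M \<in> probs" and dis: "is_disintegration M \<mu> \<nu>" and \<mu>: "\<mu> \<in> probs"
    and K: "AE p in M. norm (snd p) \<le> K"
  shows measurable_barycentre: "(\<lambda>x. \<integral>v. v \<partial>\<nu> x) \<in> borel_measurable borel"
    and AE_norm_barycentre_le: "AE x in \<mu>. norm (\<integral>v. v \<partial>\<nu> x) \<le> K"
    and integral_inner_barycentre: "\<And>h. h \<in> borel_measurable borel \<Longrightarrow> (\<And>x. norm (h x) \<le> B) \<Longrightarrow>
      (\<integral>x. h x \<bullet> (\<integral>v. v \<partial>\<nu> x) \<partial>\<mu>) = (\<integral>p. h (fst p) \<bullet> snd p \<partial>M)"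
proof -
  have \<nu>: "\<nu> \<in> borel \<rightarrow>\<^sub>M prob_algebra borel"
    and int: "\<And>g. g \<in> borel_measurable borel \<Longrightarrow> (\<integral>\<^sup>+ p. g p \<partial>M) = (\<integral>\<^sup>+ x. (\<integral>\<^sup>+ v. g (x, v) \<partial>\<nu> x) \<partial>\<mu>)"
    using dis by (auto simp: is_disintegration_def)
  have \<nu>'[measurable]: "\<nu> \<in> borel \<rightarrow>\<^sub>M subprob_algebra borel"
    using \<nu> by (rule measurable_prob_algebraD)
  have sets_\<nu>[measurable_cong]: "sets (\<nu> x) = sets borel" for x
    by (rule sets_kernel[OF \<nu>']) simp
  have ps: "prob_space (\<nu> x)" for x
    using measurable_space[OF \<nu>, of x] by (simp add: space_prob_algebra)
  have [measurable_cong]: "sets M = sets (borel \<Otimes>\<^sub>M borel)" "sets \<mu> = sets borel"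
    using M \<mu> unfolding probs_iff borel_prod by simp_all
  interpret M: prob_space M using M by (simp add: probs_iff)
  interpret \<mu>: prob_space \<mu> using \<mu> by (simp add: probs_iff)
  interpret \<nu>: prob_space "\<nu> x" for x by (rule ps)
  define m where "m x = (\<integral>v. v \<partial>\<nu> x)" for x
  have m[measurable]: "m \<in> borel_measurable borel"
    unfolding m_def by measurable
  then show "(\<lambda>x. \<integral>v. v \<partial>\<nu> x) \<in> borel_measurable borel"
    by (simp add: m_def[abs_def])
  \<comment> \<open>The exceptional set has mass 0 under \<open>M\<close>; disintegrating its
    indicator shows that almost every fibre gives it mass 0 as well.\<close>
  have "AE x in \<mu>. AE v in \<nu> x. norm v \<le> K"
  proof -
    let ?S = "{p :: 'a \<times> 'a. \<not> norm (snd p) \<le> K}"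
    have [measurable]: "?S \<in> sets (borel \<Otimes>\<^sub>M borel)"
    proof -
      have "{p \<in> space (borel \<Otimes>\<^sub>M borel). \<not> norm (snd p :: 'a) \<le> K} \<in> sets (borel \<Otimes>\<^sub>M borel)"
        by measurable
      then show ?thesis
        by (simp add: space_pair_measure)
    qed
    then have S: "indicator ?S \<in> borel_measurable (borel :: ('a \<times> 'a) measure)"
      by (intro borel_measurable_indicator) (simp only: borel_prod)
    have "(\<lambda>x. \<integral>\<^sup>+ v. indicator ?S (x, v) \<partial>\<nu> x) \<in> borel_measurable borel"
      by (rule nn_integral_measurable_subprob_algebra2[OF _ \<nu>']) simp
    then have meas: "(\<lambda>x. \<integral>\<^sup>+ v. indicator ?S (x, v) \<partial>\<nu> x) \<in> borel_measurable \<mu>"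
      by measurable
    have "(\<integral>\<^sup>+ p. indicator ?S p \<partial>M) = 0"
      using K by (subst nn_integral_0_iff_AE) (auto simp: indicator_def elim!: eventually_mono)
    then have "(\<integral>\<^sup>+ x. (\<integral>\<^sup>+ v. indicator ?S (x, v) \<partial>\<nu> x) \<partial>\<mu>) = 0"
      by (simp add: int[OF S])
    then have "AE x in \<mu>. (\<integral>\<^sup>+ v. indicator ?S (x, v) \<partial>\<nu> x) = 0"
      by (subst (asm) nn_integral_0_iff_AE[OF meas]) auto
    then show ?thesis
    proof eventually_elim
      case (elim x)
      then have "AE v in \<nu> x. indicator ?S (x, v) = (0::ennreal)"
        by (subst (asm) nn_integral_0_iff_AE) auto
      then show ?case
        by (auto elim!: eventually_mono simp: indicator_def split: if_splits)
    qed
  qed note AE2 = this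
  have m_le: "norm (m x) \<le> K" if "AE v in \<nu> x. norm v \<le> K" for x
  proof -
    have [simp]: "integrable (\<nu> x) (\<lambda>v. v)"
      using that by (intro \<nu>.integrable_const_bound[where B=K]) auto
    have "norm (m x) \<le> (\<integral>v. norm v \<partial>\<nu> x)"
      unfolding m_def by (rule integral_norm_bound)
    also have "\<dots> \<le> (\<integral>v. K \<partial>\<nu> x)"
      using that by (intro integral_mono_AE) auto
    finally show ?thesis
      by (simp add: \<nu>.prob_space)
  qed
  then show AE_m: "AE x in \<mu>. norm (\<integral>v. v \<partial>\<nu> x) \<le> K"
    using AE2 by (auto simp: m_def elim!: eventually_mono)
  fix h :: "'a \<Rightarrow> 'a" assume h[measurable]: "h \<in> borel_measurable borel" and B: "\<And>x. norm (h x) \<le> B"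
  have B0: "B \<ge> 0" using B[of 0] norm_ge_zero[of "h 0"] by linarith
  have bound: "\<bar>h x \<bullet> v\<bar> \<le> B * K" if "norm v \<le> K" for x v
    by (rule order_trans[OF Cauchy_Schwarz_ineq2]) (intro mult_mono B that B0 norm_ge_zero)
  have bM: "AE p in M. \<bar>h (fst p) \<bullet> snd p\<bar> \<le> B * K"
    using K by (auto elim!: eventually_mono intro: bound)
  have b\<mu>: "AE x in \<mu>. \<bar>h x \<bullet> m x\<bar> \<le> B * K"
    using AE2 by (auto elim!: eventually_mono intro: bound m_le)
  have iM[simp]: "integrable M (\<lambda>p. h (fst p) \<bullet> snd p)"
    using bM by (intro M.integrable_const_bound[where B="B * K"]) auto
  have i\<mu>[simp]: "integrable \<mu> (\<lambda>x. h x \<bullet> m x)"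
    using b\<mu> by (intro \<mu>.integrable_const_bound[where B="B * K"]) auto
  \<comment> \<open>A disintegration is tested against non-negative functions only. Adding
    \<open>B * K\<close> makes the pairing non-negative almost surely; all measures involved have
    mass 1, so the same constant is subtracted from both sides at the end.\<close>
  have "(\<lambda>p. ennreal (h (fst p) \<bullet> snd p + B * K)) \<in> borel_measurable (borel \<Otimes>\<^sub>M borel)"
    by measurable
  then have meas: "(\<lambda>p. ennreal (h (fst p) \<bullet> snd p + B * K)) \<in> borel_measurable borel"
    unfolding borel_prod .
  have "ennreal (\<integral>p. h (fst p) \<bullet> snd p + B * K \<partial>M) = (\<integral>\<^sup>+p. ennreal (h (fst p) \<bullet> snd p + B * K) \<partial>M)"
    using bM by (intro nn_integral_eq_integral[symmetric]) (auto elim!: eventually_mono)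
  also have "\<dots> = (\<integral>\<^sup>+x. (\<integral>\<^sup>+v. ennreal (h x \<bullet> v + B * K) \<partial>\<nu> x) \<partial>\<mu>)"
    by (simp add: int[OF meas])
  also have "\<dots> = (\<integral>\<^sup>+x. ennreal (h x \<bullet> m x + B * K) \<partial>\<mu>)"
  proof (rule nn_integral_cong_AE, use AE2 in eventually_elim)
    case (elim x)
    have [simp]: "integrable (\<nu> x) (\<lambda>v. v)"
      using elim by (intro \<nu>.integrable_const_bound[where B=K]) auto
    have "AE v in \<nu> x. 0 \<le> h x \<bullet> v + B * K"
      using elim
    proof eventually_elim
      case (elim v)
      then show ?case using bound[of v x] by linarith
    qed
    then have "(\<integral>\<^sup>+v. ennreal (h x \<bullet> v + B * K) \<partial>\<nu> x) = ennreal (\<integral>v. h x \<bullet> v + B * K \<partial>\<nu> x)"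
      by (intro nn_integral_eq_integral) auto
    then show ?case
      by (simp add: m_def \<nu>.prob_space)
  qed
  also have "\<dots> = ennreal (\<integral>x. h x \<bullet> m x + B * K \<partial>\<mu>)"
    using b\<mu> by (intro nn_integral_eq_integral) (auto elim!: eventually_mono)
  finally have "ennreal (\<integral>p. h (fst p) \<bullet> snd p + B * K \<partial>M) = ennreal (\<integral>x. h x \<bullet> m x + B * K \<partial>\<mu>)" .
  moreover have "0 \<le> (\<integral>p. h (fst p) \<bullet> snd p + B * K \<partial>M)" "0 \<le> (\<integral>x. h x \<bullet> m x + B * K \<partial>\<mu>)"
    using bM b\<mu> by (auto intro!: integral_nonneg_AE elim!: eventually_mono simp del: Bochner_Integration.integral_add)
  ultimately have "(\<integral>p. h (fst p) \<bullet> snd p + B * K \<partial>M) = (\<integral>x. h x \<bullet> m x + B * K \<partial>\<mu>)"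
    by simp
  then show "(\<integral>x. h x \<bullet> (\<integral>v. v \<partial>\<nu> x) \<partial>\<mu>) = (\<integral>p. h (fst p) \<bullet> snd p \<partial>M)"
    by (simp add: M.prob_space \<mu>.prob_space flip: m_def)
qed

subsection \<open>Test functions\<close>

lemma frechet_derivative_eq_0_outside:
  fixes u :: "'a::euclidean_space \<Rightarrow> real"
  assumes "closed K" "\<And>x. x \<notin> K \<Longrightarrow> u x = 0" "x \<notin> K"
  shows "frechet_derivative u (at x) h = 0"
proof -
  have "(u has_derivative (\<lambda>_. 0)) (at x)"
    by (rule has_derivative_transform_within_open[of "\<lambda>_. 0" _ _ _ "- K"]) (use assms in auto)
  then show ?thesis
    by (simp add: frechet_derivative_at[symmetric])
qed

lemma bounded_of_compact_support:
  fixes u :: "'a::euclidean_space \<Rightarrow> real"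
  assumes "compact K" "\<And>x. x \<notin> K \<Longrightarrow> u x = 0" "continuous_on UNIV u"
  shows "\<exists>B\<ge>0. \<forall>x. \<bar>u x\<bar> \<le> B"
proof -
  have "bounded (u ` K)"
    using assms by (intro compact_imp_bounded compact_continuous_image) (auto intro: continuous_on_subset)
  then obtain B where B: "\<And>x. x \<in> K \<Longrightarrow> \<bar>u x\<bar> \<le> B"
    by (auto simp: bounded_iff)
  have "\<bar>u x\<bar> \<le> \<bar>B\<bar>" for x
    using B[of x] assms(2)[of x] by (cases "x \<in> K") auto
  then show ?thesis
    by (intro exI[of _ "\<bar>B\<bar>"]) auto
qed

lemma frechet_derivative_euclidean:
  fixes u :: "'a::euclidean_space \<Rightarrow> real"
  assumes "u differentiable (at x)"
  shows "frechet_derivative u (at x) h = (\<Sum>b\<in>Basis. (h \<bullet> b) * frechet_derivative u (at x) b)"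
proof -
  have "linear (frechet_derivative u (at x))"
    by (rule linear_frechet_derivative[OF assms])
  then have "frechet_derivative u (at x) (\<Sum>b\<in>Basis. (h \<bullet> b) *\<^sub>R b) = (\<Sum>b\<in>Basis. (h \<bullet> b) * frechet_derivative u (at x) b)"
    by (simp add: linear_sum linear_cmul)
  then show ?thesis
    by (simp add: euclidean_representation)
qed

text \<open>Each partial derivative is continuous and vanishes off \<open>K\<close>, hence is
  bounded; the sum of these bounds controls the operator norm of the derivative, and the mean value
  inequality applies.\<close>

lemma lipschitz_of_compact_support:
  fixes u :: "'a::euclidean_space \<Rightarrow> real"
  assumes K: "compact K" "\<And>x. x \<notin> K \<Longrightarrow> u x = 0"
    and diff: "\<And>x. u differentiable (at x)"
    and cont: "\<And>b. b \<in> Basis \<Longrightarrow> continuous_on UNIV (\<lambda>x. frechet_derivative u (at x) b)"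
  shows "\<exists>L\<ge>0. \<forall>x y. \<bar>u x - u y\<bar> \<le> L * norm (x - y)"
proof -
  have "\<forall>b\<in>Basis. \<exists>B\<ge>0. \<forall>x. \<bar>frechet_derivative u (at x) b\<bar> \<le> B"
    by (intro ballI bounded_of_compact_support[OF K(1) _ cont]
        frechet_derivative_eq_0_outside[OF compact_imp_closed[OF K(1)] K(2)])
  from bchoice[OF this] obtain B where B: "\<And>b. b \<in> Basis \<Longrightarrow> B b \<ge> 0"
      "\<And>b x. b \<in> Basis \<Longrightarrow> \<bar>frechet_derivative u (at x) b\<bar> \<le> B b"
    by blast
  define L where "L = (\<Sum>b\<in>Basis. B b)"
  have L: "L \<ge> 0"
    unfolding L_def by (intro sum_nonneg B)
  have on: "onorm (frechet_derivative u (at x)) \<le> L" for x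
  proof (rule onorm_bound[OF L])
    fix h
    have "\<bar>\<Sum>b\<in>Basis. (h \<bullet> b) * frechet_derivative u (at x) b\<bar> \<le> (\<Sum>b\<in>Basis. norm h * B b)"
      by (intro order_trans[OF sum_abs] sum_mono) (auto simp: abs_mult intro!: mult_mono B Basis_le_norm)
    then show "norm (frechet_derivative u (at x) h) \<le> L * norm h"
      by (simp add: frechet_derivative_euclidean[OF diff, of x h] L_def sum_distrib_left mult.commute)
  qed
  have "norm (u x - u y) \<le> L * norm (x - y)" for x y
    by (rule differentiable_bound[of UNIV u "\<lambda>x. frechet_derivative u (at x)"])
       (use on diff in \<open>auto simp: frechet_derivative_works\<close>)
  then show ?thesis
    using L by (intro exI[of _ L]) auto
qed

lemma GDERIV_gradient:
  fixes f :: "'a::euclidean_space \<Rightarrow> real"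
  assumes "f differentiable (at x)"
  shows "GDERIV f x :> gradient f x"
    and "gradient f x = (\<Sum>b\<in>Basis. frechet_derivative f (at x) b *\<^sub>R b)"
proof -
  let ?D = "\<Sum>b\<in>Basis. frechet_derivative f (at x) b *\<^sub>R b"
  have "frechet_derivative f (at x) = (\<lambda>h. h \<bullet> ?D)"
    by (rule ext, subst frechet_derivative_euclidean[OF assms]) (simp add: inner_sum_right mult.commute)
  then have D: "GDERIV f x :> ?D"
    using assms by (simp add: gderiv_def frechet_derivative_works)
  moreover have "D = ?D" if "GDERIV f x :> D" for D
  proof -
    have "(\<lambda>h. h \<bullet> D) = (\<lambda>h. h \<bullet> ?D)"
      using that D unfolding gderiv_def by (rule has_derivative_unique)
    then have "\<forall>h. h \<bullet> D = h \<bullet> ?D"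
      by - (intro allI, erule fun_cong)
    then show ?thesis
      by (simp only: vector_eq_ldot)
  qed
  ultimately show "gradient f x = ?D"
    unfolding gradient_def by (rule the_equality)
  with D show "GDERIV f x :> gradient f x"
    by simp
qed

text \<open>Collects the quantitative facts about test functions used later. The Lipschitz constant
  of the gradient comes from the second partial derivatives, through
  \<open>lipschitz_of_compact_support\<close> applied to the first ones.\<close>

lemma test_function_regularity:
  fixes f :: "'a::euclidean_space \<Rightarrow> real"
  assumes "f \<in> test_functions"
  obtains B L where "\<And>x. (f has_derivative (\<lambda>h. gradient f x \<bullet> h)) (at x)"
    "B \<ge> 0" "L \<ge> 0" "\<And>x. \<bar>f x\<bar> \<le> B" "\<And>x. norm (gradient f x) \<le> B"
    "\<And>x y. norm (gradient f x - gradient f y) \<le> L * norm (x - y)"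
proof -
  define K where "K = closure {x. f x \<noteq> 0}"
  have K: "compact K" "closed K"
    using assms by (auto simp: K_def test_functions_def)
  have f0: "f x = 0" if "x \<notin> K" for x
    using that closure_subset[of "{x. f x \<noteq> 0}"] by (auto simp: K_def)
  define df where "df b x = frechet_derivative f (at x) b" for b x
  have "k_times_cont_diff (Suc (Suc 0)) f"
    using assms by (auto simp: test_functions_def)
  then have diff: "\<And>x. f differentiable (at x)"
    and diff2: "\<And>b x. b \<in> Basis \<Longrightarrow> df b differentiable (at x)"
    and cont2: "\<And>b b'. b \<in> Basis \<Longrightarrow> b' \<in> Basis \<Longrightarrow>
      continuous_on UNIV (\<lambda>x. frechet_derivative (df b) (at x) b')"
    by (auto simp: df_def[abs_def])
  have df0: "df b x = 0" if "x \<notin> K" for b x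
    unfolding df_def using K(2) f0 that by (rule frechet_derivative_eq_0_outside)
  have cont: "continuous_on UNIV f" "\<And>b. b \<in> Basis \<Longrightarrow> continuous_on UNIV (df b)"
    using diff diff2 by (auto intro!: continuous_at_imp_continuous_on differentiable_imp_continuous_within)
  obtain B0 where B0: "B0 \<ge> 0" "\<And>x. \<bar>f x\<bar> \<le> B0"
    using bounded_of_compact_support[OF K(1) f0 cont(1)] by blast
  have "\<forall>b\<in>Basis. \<exists>B\<ge>0. \<forall>x. \<bar>df b x\<bar> \<le> B"
    by (intro ballI bounded_of_compact_support[OF K(1) df0 cont(2)])
  from bchoice[OF this] obtain B where B: "\<And>b. b \<in> Basis \<Longrightarrow> B b \<ge> 0" "\<And>b x. b \<in> Basis \<Longrightarrow> \<bar>df b x\<bar> \<le> B b"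
    by blast
  have "\<forall>b\<in>Basis. \<exists>L\<ge>0. \<forall>x y. \<bar>df b x - df b y\<bar> \<le> L * norm (x - y)"
    by (intro ballI lipschitz_of_compact_support[OF K(1) df0 diff2 cont2])
  from bchoice[OF this] obtain L where L: "\<And>b. b \<in> Basis \<Longrightarrow> L b \<ge> 0"
      "\<And>b x y. b \<in> Basis \<Longrightarrow> \<bar>df b x - df b y\<bar> \<le> L b * norm (x - y)"
    by blast
  have grad: "gradient f x \<bullet> b = df b x" if "b \<in> Basis" for x b
    unfolding GDERIV_gradient(2)[OF diff] df_def using that by simp
  show ?thesis
  proof
    show "(f has_derivative (\<lambda>h. gradient f x \<bullet> h)) (at x)" for x
      using GDERIV_gradient(1)[OF diff, of x] by (simp add: gderiv_def inner_commute)
    show "B0 + sum B Basis \<ge> 0" "sum L Basis \<ge> 0"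
      using B0 B L by (auto intro!: add_nonneg_nonneg sum_nonneg)
    show "\<bar>f x\<bar> \<le> B0 + sum B Basis" for x
      using B0(2)[of x] sum_nonneg[of Basis B] B by fastforce
    show "norm (gradient f x) \<le> B0 + sum B Basis" for x
    proof -
      have "norm (gradient f x) \<le> (\<Sum>b\<in>Basis. \<bar>gradient f x \<bullet> b\<bar>)"
        by (rule norm_le_l1)
      also have "\<dots> \<le> sum B Basis"
        by (intro sum_mono) (simp add: grad B)
      finally show ?thesis using B0(1) by simp
    qed
    show "norm (gradient f x - gradient f y) \<le> sum L Basis * norm (x - y)" for x y
    proof -
      have "norm (gradient f x - gradient f y) \<le> (\<Sum>b\<in>Basis. \<bar>(gradient f x - gradient f y) \<bullet> b\<bar>)"
        by (rule norm_le_l1)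
      also have "\<dots> \<le> (\<Sum>b\<in>Basis. L b * norm (x - y))"
        by (intro sum_mono) (simp add: grad L inner_diff_left)
      finally show ?thesis by (simp add: sum_distrib_right)
    qed
  qed
qed

subsection \<open>Compactness of random Lipschitz paths\<close>

text \<open>Extension of a Lipschitz path from the sampled times \<open>q i\<close> to any time
  \<open>t\<close>. The distance to the sampled values determines the extension, so this estimate is
  the only property of the limit that is passed on.\<close>

lemma dist_lim_dense_le:
  fixes p :: "nat \<Rightarrow> 'a::complete_space" and q :: "nat \<Rightarrow> real"
  assumes lip: "\<And>i j. dist (p i) (p j) \<le> K * \<bar>q i - q j\<bar>" and K: "K \<ge> 0"
    and t: "(\<lambda>n. q (idx n)) \<longlonglongrightarrow> t"
  shows "dist (lim (\<lambda>n. p (idx n))) (p i) \<le> K * \<bar>t - q i\<bar>"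
proof -
  have "Cauchy (\<lambda>n. p (idx n))"
  proof (rule metric_CauchyI)
    fix e :: real assume "e > 0"
    then have "e / (K + 1) > 0" using K by simp
    moreover have "Cauchy (\<lambda>n. q (idx n))"
      using t by (rule LIMSEQ_imp_Cauchy)
    ultimately obtain N where N: "\<And>m n. m \<ge> N \<Longrightarrow> n \<ge> N \<Longrightarrow> \<bar>q (idx m) - q (idx n)\<bar> < e / (K + 1)"
      by (metis metric_CauchyD dist_real_def)
    show "\<exists>N. \<forall>m\<ge>N. \<forall>n\<ge>N. dist (p (idx m)) (p (idx n)) < e"
    proof (intro exI[of _ N] allI impI)
      fix m n assume mn: "N \<le> m" "N \<le> n"
      have "dist (p (idx m)) (p (idx n)) \<le> K * \<bar>q (idx m) - q (idx n)\<bar>"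
        by (rule lip)
      also have "\<dots> \<le> K * (e / (K + 1))"
        using N[OF mn] K by (intro mult_left_mono) auto
      also have "\<dots> < e"
        using K \<open>e > 0\<close> by (simp add: field_simps)
      finally show "dist (p (idx m)) (p (idx n)) < e" .
    qed
  qed
  then have lim: "(\<lambda>n. p (idx n)) \<longlonglongrightarrow> lim (\<lambda>n. p (idx n))"
    using Cauchy_convergent convergent_LIMSEQ_iff by blast
  show ?thesis
  proof (rule LIMSEQ_le)
    show "(\<lambda>n. dist (p (idx n)) (p i)) \<longlonglongrightarrow> dist (lim (\<lambda>n. p (idx n))) (p i)"
      by (intro tendsto_intros lim)
    show "(\<lambda>n. K * \<bar>q (idx n) - q i\<bar>) \<longlonglongrightarrow> K * \<bar>t - q i\<bar>"
      by (intro tendsto_intros t)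
  qed (auto intro: lip)
qed

lemma dist_le_of_dense:
  fixes q :: "nat \<Rightarrow> real" and u w :: "'a::metric_space"
  assumes dense: "\<And>t e. e > 0 \<Longrightarrow> \<exists>i. \<bar>q i - t\<bar> < e" and "K \<ge> 0"
    and le: "\<And>i. dist u w \<le> c + K * \<bar>t - q i\<bar>"
  shows "dist u w \<le> c"
proof (rule field_le_epsilon)
  fix e :: real assume "e > 0"
  then have "e / (K + 1) > 0" using \<open>K \<ge> 0\<close> by simp
  then obtain i where "\<bar>q i - t\<bar> < e / (K + 1)"
    using dense by blast
  then have "K * \<bar>t - q i\<bar> \<le> K * (e / (K + 1))"
    using \<open>K \<ge> 0\<close> by (intro mult_left_mono) auto
  also have "\<dots> \<le> e"
    using \<open>K \<ge> 0\<close> \<open>e > 0\<close> by (simp add: field_simps)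
  finally show "dist u w \<le> c + e"
    using le[of i] by linarith
qed

text \<open>
  A path is coded, through its values at rational times, by one real number, from which it can be
  recovered continuously. Helly's selection theorem and Skorohod's theorem on the real line then
  replace Prokhorov's theorem on the space of paths.
\<close>
lemma random_lipschitz_paths_compact:
  fixes X :: "nat \<Rightarrow> real \<Rightarrow> 'b \<Rightarrow> 'a::euclidean_space"
  assumes M: "prob_space M" and X[measurable]: "\<And>k t. X k t \<in> borel_measurable M"
    and bdd: "\<And>k t \<omega>. \<omega> \<in> space M \<Longrightarrow> norm (X k t \<omega>) \<le> R"
    and lip: "\<And>k s t \<omega>. \<omega> \<in> space M \<Longrightarrow> dist (X k s \<omega>) (X k t \<omega>) \<le> K * \<bar>s - t\<bar>"
    and K: "K \<ge> 0"
  obtains r and \<Omega> :: "real measure" and Z Z' where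
    "strict_mono (r :: nat \<Rightarrow> nat)" "prob_space \<Omega>"
    "\<And>k t. Z k t \<in> borel_measurable \<Omega>" "\<And>t. Z' t \<in> borel_measurable \<Omega>"
    "\<And>k t. distr \<Omega> borel (Z k t) = distr M borel (X (r k) t)"
    "AE \<omega> in \<Omega>. (\<forall>t. norm (Z' t \<omega>) \<le> R) \<and> (\<forall>s t. dist (Z' s \<omega>) (Z' t \<omega>) \<le> K * \<bar>s - t\<bar>) \<and>
      (\<forall>k t. norm (Z k t \<omega>) \<le> R) \<and> (\<forall>k s t. dist (Z k s \<omega>) (Z k t \<omega>) \<le> K * \<bar>s - t\<bar>) \<and>
      (\<forall>t. (\<lambda>k. Z k t \<omega>) \<longlonglongrightarrow> Z' t \<omega>)"
proof -
  interpret M: prob_space M by fact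
  obtain \<omega>0 where "\<omega>0 \<in> space M" using M.not_empty by blast
  then have R: "R \<ge> 0"
    using bdd[of \<omega>0 0 0] norm_ge_zero[of "X 0 0 \<omega>0"] by linarith
  define q where "q i = real_of_rat (from_nat i)" for i
  have dense: "\<exists>i. \<bar>q i - t\<bar> < e" if e: "e > 0" for t e :: real
  proof -
    obtain c where "t < of_rat c" "of_rat c < t + e"
      using of_rat_dense[of t "t + e"] e by auto
    then have "\<bar>q (to_nat c) - t\<bar> < e"
      by (simp add: q_def)
    then show ?thesis by blast
  qed
  \<comment> \<open>Coordinates bounded by \<open>R\<close> are moved into [0, 1). Dividing by
    \<open>2 * (R + 1)\<close> keeps them strictly below 1, as decoding demands, and covers
    \<open>R = 0\<close>.\<close>
  define x where "x k n \<omega> = (case prod_decode n of (i, j) \<Rightarrow>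
    1/2 + (X k (q i) \<omega> \<bullet> from_nat_into Basis j) / (2 * (R + 1)))" for k n \<omega>
  define Y where "Y k \<omega> = encode_seq (\<lambda>n. x k n \<omega>)" for k \<omega>
  define val :: "nat \<Rightarrow> real \<Rightarrow> 'a" where "val i y = (\<Sum>b\<in>Basis.
    (2 * (R + 1) * (decode_seq (prod_encode (i, to_nat_on Basis b)) y - 1/2)) *\<^sub>R b)" for i y
  have [measurable]: "x k n \<in> borel_measurable M" for k n
    unfolding x_def case_prod_beta by measurable
  have Y[measurable]: "Y k \<in> borel_measurable M" for k
    unfolding Y_def[abs_def] by (intro measurable_encode_seq) measurable
  have cont: "continuous_on UNIV (val i)" for i
    unfolding val_def by (intro continuous_intros continuous_on_subset[OF continuous_decode_seq]) auto
  have [measurable]: "val i \<in> borel_measurable borel" for i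
    by (rule borel_measurable_continuous_onI[OF cont])
  have val_Y: "val i (Y k \<omega>) = X k (q i) \<omega>" if \<omega>: "\<omega> \<in> space M" for i k \<omega>
  proof -
    have "decode_seq (prod_encode (i, to_nat_on Basis b)) (Y k \<omega>) = 1/2 + (X k (q i) \<omega> \<bullet> b) / (2 * (R + 1))"
      if b: "b \<in> Basis" for b
    proof -
      have "\<bar>X k (q i) \<omega> \<bullet> b\<bar> \<le> R"
        using Basis_le_norm[OF b, of "X k (q i) \<omega>"] bdd[OF \<omega>, of k "q i"] by linarith
      then have "0 \<le> x k (prod_encode (i, to_nat_on Basis b)) \<omega>" "x k (prod_encode (i, to_nat_on Basis b)) \<omega> < 1"
        using R b by (auto simp: x_def field_simps countable_finite)
      then show ?thesis
        unfolding Y_def using b by (subst decode_encode_seq) (auto simp: x_def countable_finite)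
    qed
    then show ?thesis
      using R by (simp add: val_def euclidean_representation cong: sum.cong)
  qed
  \<comment> \<open>Codes of genuine paths: the decoded samples satisfy the norm and Lipschitz
    bounds. Continuity of decoding makes \<open>S\<close> closed, so limits of codes again represent
    Lipschitz paths.\<close>
  define S where "S = (\<Inter>i. {y. norm (val i y) \<le> R}) \<inter>
    (\<Inter>i j. {y. dist (val i y) (val j y) \<le> K * \<bar>q i - q j\<bar>})"
  have S: "closed S"
    unfolding S_def by (intro closed_Int closed_INT ballI closed_Collect_le continuous_intros cont)
  have [measurable]: "S \<in> sets borel"
    using S by simp
  have Y_S: "Y k \<omega> \<in> S" if "\<omega> \<in> space M" for k \<omega>
    using that by (auto simp: S_def val_Y bdd lip)
  define idx where "idx t n = (SOME i. \<bar>q i - t\<bar> < 1 / Suc n)" for t :: real and n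
  have idx: "\<bar>q (idx t n) - t\<bar> < 1 / Suc n" for t n
    unfolding idx_def by (rule someI_ex) (rule dense, simp)
  have q_idx: "(\<lambda>n. q (idx t n)) \<longlonglongrightarrow> t" for t
  proof (rule LIMSEQ_I)
    fix e :: real assume "e > 0"
    then obtain n0 where n0: "1 / Suc n0 < e"
      using nat_approx_posE by (auto simp: inverse_eq_divide)
    have "norm (q (idx t n) - t) < e" if "n \<ge> n0" for n
    proof -
      have "1 / real (Suc n) \<le> 1 / Suc n0"
        using that by (simp add: frac_le)
      then show ?thesis
        using idx[of t n] n0 by simp
    qed
    then show "\<exists>n0. \<forall>n\<ge>n0. norm (q (idx t n) - t) < e"
      by blast
  qed
  \<comment> \<open>Outside \<open>S\<close> the sequence may diverge, but \<open>lim\<close> still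
    defines a measurable function; on \<open>S\<close> it is the Lipschitz extension of the
    samples.\<close>
  define ext where "ext t y = lim (\<lambda>n. val (idx t n) y)" for t y
  have [measurable]: "ext t \<in> borel_measurable borel" for t
    unfolding ext_def[abs_def] by (rule borel_measurable_lim_metric) measurable
  have ext: "dist (ext t y) (val i y) \<le> K * \<bar>t - q i\<bar>" if "y \<in> S" for t y i
    unfolding ext_def using that by (intro dist_lim_dense_le K q_idx) (auto simp: S_def)
  have ext_Y: "ext t (Y k \<omega>) = X k t \<omega>" if \<omega>: "\<omega> \<in> space M" for k t \<omega>
  proof -
    have "dist (ext t (Y k \<omega>)) (X k t \<omega>) \<le> 0"
    proof (rule dist_le_of_dense[OF dense, where K="2 * K" and t=t])
      fix i
      have "dist (ext t (Y k \<omega>)) (X k t \<omega>) \<le> dist (ext t (Y k \<omega>)) (val i (Y k \<omega>)) + dist (X k (q i) \<omega>) (X k t \<omega>)"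
        unfolding val_Y[OF \<omega>] by (rule dist_triangle)
      also have "\<dots> \<le> K * \<bar>t - q i\<bar> + K * \<bar>q i - t\<bar>"
        by (intro add_mono ext Y_S lip \<omega>)
      finally show "dist (ext t (Y k \<omega>)) (X k t \<omega>) \<le> 0 + 2 * K * \<bar>t - q i\<bar>"
        by (simp add: abs_minus_commute)
    qed (use K in auto)
    then show ?thesis by simp
  qed
  have ext_lip: "dist (ext s y) (ext t y) \<le> K * \<bar>s - t\<bar>" if y: "y \<in> S" for s t y
  proof (rule dist_le_of_dense[OF dense, where K="2 * K" and t=t])
    fix i
    have "dist (ext s y) (ext t y) \<le> dist (ext s y) (val i y) + dist (ext t y) (val i y)"
      by (rule dist_triangle2)
    also have "\<dots> \<le> K * \<bar>s - q i\<bar> + K * \<bar>t - q i\<bar>"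
      by (intro add_mono ext y)
    also have "K * \<bar>s - q i\<bar> \<le> K * (\<bar>s - t\<bar> + \<bar>t - q i\<bar>)"
      by (intro mult_left_mono K) auto
    finally show "dist (ext s y) (ext t y) \<le> K * \<bar>s - t\<bar> + 2 * K * \<bar>t - q i\<bar>"
      by (simp add: algebra_simps)
  qed (use K in auto)
  have ext_bdd: "norm (ext t y) \<le> R" if y: "y \<in> S" for t y
  proof -
    have "dist (ext t y) 0 \<le> R"
    proof (rule dist_le_of_dense[OF dense K])
      fix i
      have "dist (ext t y) 0 \<le> dist (ext t y) (val i y) + dist (val i y) 0"
        by (rule dist_triangle)
      moreover have "dist (val i y) 0 \<le> R"
        using y by (simp add: S_def)
      ultimately show "dist (ext t y) 0 \<le> R + K * \<bar>t - q i\<bar>"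
        using ext[OF y, of t i] by linarith
    qed
    then show ?thesis by simp
  qed
  \<comment> \<open>A sampled time close to \<open>t\<close> is chosen independently of
    \<open>k\<close>, thanks to the common Lipschitz constant; convergence at that time follows from
    continuity of \<open>val i\<close>, and the three errors are each below
    \<open>e / 3\<close>.\<close>
  have ext_conv: "(\<lambda>k. ext t (y k)) \<longlonglongrightarrow> ext t l"
    if y: "\<And>k. y k \<in> S" and l: "y \<longlonglongrightarrow> l" for y l t
  proof (rule metric_LIMSEQ_I)
    fix e :: real assume e: "e > 0"
    have lS: "l \<in> S"
      using S y l by (auto intro: closed_sequentially)
    have "e / (3 * (K + 1)) > 0" using e K by simp
    then obtain i where i: "\<bar>q i - t\<bar> < e / (3 * (K + 1))"
      using dense by blast
    then have "K * \<bar>t - q i\<bar> \<le> K * (e / (3 * (K + 1)))"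
      using K by (intro mult_left_mono) auto
    also have "\<dots> < e / 3"
      using e K by (simp add: field_simps)
    finally have i: "K * \<bar>t - q i\<bar> < e / 3" .
    have "isCont (val i) l"
      using cont by (simp add: continuous_on_eq_continuous_at)
    then have "(\<lambda>k. val i (y k)) \<longlonglongrightarrow> val i l"
      using l by (rule isCont_tendsto_compose)
    then obtain k0 where k0: "\<And>k. k \<ge> k0 \<Longrightarrow> dist (val i (y k)) (val i l) < e / 3"
      using metric_LIMSEQ_D[of _ _ "e / 3"] e by fastforce
    have "dist (ext t (y k)) (ext t l) < e" if "k \<ge> k0" for k
      using ext[OF y[of k], of t i] ext[OF lS, of t i] k0[OF that] i
        dist_triangle[of "ext t (y k)" "ext t l" "val i (y k)"]
        dist_triangle[of "val i (y k)" "ext t l" "val i l"] dist_commute[of "ext t l" "val i l"]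
      by linarith
    then show "\<exists>k0. \<forall>k\<ge>k0. dist (ext t (y k)) (ext t l) < e"
      by blast
  qed
  define \<mu> where "\<mu> k = distr M borel (Y k)" for k
  have rd: "real_distribution (\<mu> k)" for k
    unfolding \<mu>_def real_distribution_def real_distribution_axioms_def
    by (auto intro!: M.prob_space_distr)
  have Y01: "0 \<le> Y k \<omega>" "Y k \<omega> \<le> 1" for k \<omega>
    by (auto simp: Y_def encode_seq_bounds)
  \<comment> \<open>All codes lie in [0, 1]; the interval is open on the left, so it starts at -1 in
    order to contain 0.\<close>
  have "tight \<mu>"
    unfolding tight_def
  proof (intro conjI allI impI rd)
    fix e :: real assume e: "e > 0"
    have "measure (\<mu> k) {-1<..1} = 1" for k
    proof -
      have "-1 < Y k \<omega>" for \<omega>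
        using Y01(1)[of k \<omega>] by linarith
      then have "Y k -` {-1<..1} \<inter> space M = space M"
        using Y01(2)[of k] by auto
      then show ?thesis
        by (simp add: \<mu>_def measure_distr M.prob_space)
    qed
    then show "\<exists>a b. a < b \<and> (\<forall>k. 1 - e < measure (\<mu> k) {a<..b})"
      using e by (intro exI[of _ "-1"] exI[of _ 1]) auto
  qed
  then obtain r M' where r: "strict_mono (r :: nat \<Rightarrow> nat)" and M': "real_distribution M'"
    and wc: "weak_conv_m (\<mu> \<circ> id \<circ> r) M'"
    using tight_imp_convergent_subsubsequence[of \<mu> id] by (auto simp: strict_mono_id)
  have rd': "real_distribution ((\<mu> \<circ> id \<circ> r) n)" for n
    using rd by simp
  obtain \<Omega> :: "real measure" and W W' where \<Omega>: "prob_space \<Omega>"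
    and sk: "\<forall>k. W k \<in> borel_measurable \<Omega>" "\<forall>k. distr \<Omega> borel (W k) = (\<mu> \<circ> id \<circ> r) k"
    and W'_lb: "W' \<in> \<Omega> \<rightarrow>\<^sub>M lborel" and sk': "\<forall>\<omega>\<in>space \<Omega>. (\<lambda>k. W k \<omega>) \<longlonglongrightarrow> W' \<omega>"
    using Skorohod[OF rd' M' wc] by blast
  then have W[measurable]: "\<And>k. W k \<in> borel_measurable \<Omega>"
    and dW: "\<And>k. distr \<Omega> borel (W k) = \<mu> (r k)"
    and WW': "\<And>\<omega>. \<omega> \<in> space \<Omega> \<Longrightarrow> (\<lambda>k. W k \<omega>) \<longlonglongrightarrow> W' \<omega>"
    by auto
  interpret \<Omega>: prob_space \<Omega> by fact
  have W'[measurable]: "W' \<in> borel_measurable \<Omega>"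
    using W'_lb by simp
  \<comment> \<open>Skorohod's theorem keeps the laws and forgets the paths. Being the code of a
    path is an event of the law of \<open>Y (r k)\<close>, so it holds almost surely for
    \<open>W k\<close> too.\<close>
  have "AE \<omega> in \<Omega>. W k \<omega> \<in> S" for k
  proof -
    have "AE y in \<mu> (r k). y \<in> S"
      unfolding \<mu>_def by (subst AE_distr_iff) (auto simp: Y_S)
    then show ?thesis
      unfolding dW[symmetric] by (subst (asm) AE_distr_iff) auto
  qed
  then have AE_S: "AE \<omega> in \<Omega>. \<forall>k. W k \<omega> \<in> S"
    by (simp add: AE_all_countable)
  show ?thesis
  proof (rule that[of r \<Omega> "\<lambda>k t \<omega>. ext t (W k \<omega>)" "\<lambda>t \<omega>. ext t (W' \<omega>)"])
    show "distr \<Omega> borel (\<lambda>\<omega>. ext t (W k \<omega>)) = distr M borel (X (r k) t)" for k t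
    proof -
      have "distr \<Omega> borel (\<lambda>\<omega>. ext t (W k \<omega>)) = distr (distr \<Omega> borel (W k)) borel (ext t)"
        by (subst distr_distr) (auto simp: o_def)
      also have "\<dots> = distr M borel (\<lambda>\<omega>. ext t (Y (r k) \<omega>))"
        unfolding dW \<mu>_def by (subst distr_distr) (auto simp: o_def)
      also have "\<dots> = distr M borel (X (r k) t)"
        by (rule distr_cong) (auto simp: ext_Y)
      finally show ?thesis .
    qed
    show "AE \<omega> in \<Omega>. (\<forall>t. norm (ext t (W' \<omega>)) \<le> R) \<and>
        (\<forall>s t. dist (ext s (W' \<omega>)) (ext t (W' \<omega>)) \<le> K * \<bar>s - t\<bar>) \<and>
        (\<forall>k t. norm (ext t (W k \<omega>)) \<le> R) \<and>
        (\<forall>k s t. dist (ext s (W k \<omega>)) (ext t (W k \<omega>)) \<le> K * \<bar>s - t\<bar>) \<and>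
        (\<forall>t. (\<lambda>k. ext t (W k \<omega>)) \<longlonglongrightarrow> ext t (W' \<omega>))"
      using AE_S AE_space
    proof eventually_elim
      case (elim \<omega>)
      moreover have "W' \<omega> \<in> S"
        using S elim WW'[of \<omega>] by (auto intro: closed_sequentially[of S "\<lambda>k. W k \<omega>"])
      ultimately show ?case
        using WW'[of \<omega>] by (auto simp: ext_bdd ext_lip intro!: ext_conv)
    qed
  qed (use r \<Omega> in auto)
qed

subsection \<open>The scheme as the law of a flow\<close>

text \<open>The time that a path at time \<open>s\<close> has spent in the cell \<open>[j\<Delta>t, (j + 1)\<Delta>t]\<close>.\<close>
definition time_in_cell :: "real \<Rightarrow> nat \<Rightarrow> real \<Rightarrow> real" where
  "time_in_cell \<Delta>t j s = max 0 (min \<Delta>t (s - real j * \<Delta>t))"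

lemma sum_time_in_cell:
  assumes "\<Delta>t \<ge> 0"
  shows "(\<Sum>j<N. time_in_cell \<Delta>t j s) = max 0 (min (real N * \<Delta>t) s)"
proof (induction N)
  case (Suc N)
  define c where "c = real N * \<Delta>t"
  have "c \<ge> 0" using assms by (simp add: c_def)
  moreover have "real (Suc N) * \<Delta>t = c + \<Delta>t"
    by (simp add: c_def algebra_simps)
  ultimately show ?case
    using Suc assms by (auto simp: time_in_cell_def simp flip: c_def)
qed simp

lemma time_in_cell_mono: "s \<le> t \<Longrightarrow> time_in_cell \<Delta>t j s \<le> time_in_cell \<Delta>t j t"
  by (auto simp: time_in_cell_def)

lemma sum_abs_time_in_cell_diff_le:
  assumes "\<Delta>t \<ge> 0"
  shows "(\<Sum>j<N. \<bar>time_in_cell \<Delta>t j s - time_in_cell \<Delta>t j t\<bar>) \<le> \<bar>s - t\<bar>"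
proof (induction s t rule: linorder_wlog)
  case (le s t)
  have "(\<Sum>j<N. \<bar>time_in_cell \<Delta>t j s - time_in_cell \<Delta>t j t\<bar>) =
      (\<Sum>j<N. time_in_cell \<Delta>t j t - time_in_cell \<Delta>t j s)"
    using time_in_cell_mono[OF le] by (intro sum.cong) auto
  also have "\<dots> = max 0 (min (real N * \<Delta>t) t) - max 0 (min (real N * \<Delta>t) s)"
    using assms by (simp add: sum_subtractf sum_time_in_cell)
  also have "\<dots> \<le> \<bar>s - t\<bar>"
    using le by auto
  finally show ?case .
qed (simp add: abs_minus_commute)

locale mean_velocity_dynamics =
  fixes V :: "'a::euclidean_space measure \<Rightarrow> ('a \<times> 'a) measure"
    and T C R0 :: real and \<mu>0 :: "'a measure"
  assumes T: "T > 0" and C: "C > 0" and R0: "R0 \<ge> 0"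
    and V: "prob_vector_field V"
    and growth: "\<And>\<mu>. \<mu> \<in> probs_c \<Longrightarrow> (SUP (x, v)\<in>msupport (V \<mu>). ennreal (norm v)) \<le>
        ennreal C * (1 + (SUP x\<in>msupport \<mu>. ennreal (norm x)))"
    and continuous_V: "wasserstein_continuous V"
    and \<mu>0: "\<mu>0 \<in> probs"
    and \<mu>0_bdd: "AE x in \<mu>0. norm x \<le> R0"
begin

text \<open>A velocity bound for all nodes and all \<open>N\<close>. By (H1) one step multiplies 1
  plus the radius by at most \<open>1 + C * T / N\<close>, hence \<open>N\<close> steps by at most
  \<open>exp (C * T)\<close>; one more use of (H1) gives the factor \<open>C\<close>.\<close>

definition K :: real where
  "K = C * ((1 + R0) * exp (C * T))"

definition R :: real where
  "R = R0 + K * T"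

lemma K_nonneg: "K \<ge> 0"
  using C R0 by (simp add: K_def)

lemma R_nonneg: "R \<ge> 0"
  using K_nonneg R0 T by (simp add: R_def)

abbreviation node :: "nat \<Rightarrow> nat \<Rightarrow> 'a measure" where
  "node N j \<equiv> scheme_node V (T / real N) \<mu>0 j"

text \<open>
  The velocities and the initial point are truncated, which changes them on null sets only, so that
  all the paths below are Lipschitz.
\<close>
definition velocity :: "nat \<Rightarrow> nat \<Rightarrow> 'a \<Rightarrow> 'a" where
  "velocity N j x = (if norm (mean_velocity V (node N j) x) \<le> K then mean_velocity V (node N j) x else 0)"

primrec flow :: "nat \<Rightarrow> nat \<Rightarrow> 'a \<Rightarrow> 'a" where
  "flow N 0 x = (if norm x \<le> R0 then x else 0)"
| "flow N (Suc j) x = flow N j x + (T / real N) *\<^sub>R velocity N j (flow N j x)"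

text \<open>The sum over cells, in place of a case distinction on the current one, defines the path
  for every real time (constant outside [0, T]) and reduces its Lipschitz bound to an estimate of
  the weights.\<close>

definition path :: "nat \<Rightarrow> real \<Rightarrow> 'a \<Rightarrow> 'a" where
  "path N s x = flow N 0 x + (\<Sum>j<N. time_in_cell (T / real N) j s *\<^sub>R velocity N j (flow N j x))"

lemma norm_velocity_le: "norm (velocity N j x) \<le> K"
  using K_nonneg by (simp add: velocity_def)

lemma path_in_cell:
  assumes j: "j < N" and s: "real j * (T / N) \<le> s" "s \<le> real (Suc j) * (T / N)"
  shows "path N s x = flow N j x + (s - real j * (T / N)) *\<^sub>R velocity N j (flow N j x)"
proof -
  define \<Delta> where "\<Delta> = T / N"
  have \<Delta>: "\<Delta> > 0" using T j by (simp add: \<Delta>_def)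
  have flow: "flow N i x = flow N 0 x + (\<Sum>l<i. \<Delta> *\<^sub>R velocity N l (flow N l x))" for i
    by (induction i) (auto simp: \<Delta>_def)
  have past: "time_in_cell \<Delta> i s = \<Delta>" if "i < j" for i
  proof -
    have "real (Suc i) * \<Delta> \<le> real j * \<Delta>"
      using that \<Delta> by (intro mult_right_mono) auto
    then show ?thesis
      using s \<Delta> by (auto simp: time_in_cell_def \<Delta>_def[symmetric] algebra_simps)
  qed
  have future: "time_in_cell \<Delta> i s = 0" if "j < i" for i
  proof -
    have "real (Suc j) * \<Delta> \<le> real i * \<Delta>"
      using that \<Delta> by (intro mult_right_mono) auto
    then show ?thesis
      using s \<Delta> by (auto simp: time_in_cell_def \<Delta>_def[symmetric] algebra_simps)
  qed
  have now: "time_in_cell \<Delta> j s = s - real j * \<Delta>"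
    using s \<Delta> by (auto simp: time_in_cell_def \<Delta>_def[symmetric] algebra_simps)
  have "(\<Sum>i<N. time_in_cell \<Delta> i s *\<^sub>R velocity N i (flow N i x)) =
      (\<Sum>i<Suc j. time_in_cell \<Delta> i s *\<^sub>R velocity N i (flow N i x))"
    using j future by (intro sum.mono_neutral_right) auto
  also have "\<dots> = (\<Sum>i<j. \<Delta> *\<^sub>R velocity N i (flow N i x)) + (s - real j * \<Delta>) *\<^sub>R velocity N j (flow N j x)"
    by (simp add: past now)
  finally show ?thesis
    by (simp add: path_def flow[of j] flip: \<Delta>_def)
qed

lemma dist_path_le: "dist (path N s x) (path N t x) \<le> K * \<bar>s - t\<bar>"
proof -
  have "dist (path N s x) (path N t x) =
      norm (\<Sum>j<N. (time_in_cell (T / N) j s - time_in_cell (T / N) j t) *\<^sub>R velocity N j (flow N j x))"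
    by (simp add: path_def dist_norm scaleR_diff_left sum_subtractf)
  also have "\<dots> \<le> (\<Sum>j<N. \<bar>time_in_cell (T / N) j s - time_in_cell (T / N) j t\<bar> * K)"
    by (rule order_trans[OF norm_sum]) (auto intro!: sum_mono mult_left_mono norm_velocity_le)
  also have "\<dots> = K * (\<Sum>j<N. \<bar>time_in_cell (T / N) j s - time_in_cell (T / N) j t\<bar>)"
    by (simp add: sum_distrib_left mult.commute)
  also have "\<dots> \<le> K * \<bar>s - t\<bar>"
    using T by (intro mult_left_mono K_nonneg sum_abs_time_in_cell_diff_le) simp
  finally show ?thesis .
qed

lemma norm_path_le: "norm (path N s x) \<le> R"
proof -
  have w: "0 \<le> time_in_cell (T / N) j s" for j
    using T by (auto simp: time_in_cell_def)
  have "norm (path N s x) \<le> norm (flow N 0 x) +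
      norm (\<Sum>j<N. time_in_cell (T / real N) j s *\<^sub>R velocity N j (flow N j x))"
    unfolding path_def by (rule norm_triangle_ineq)
  also have "\<dots> \<le> R0 + (\<Sum>j<N. time_in_cell (T / N) j s * K)"
    using R0 w by (intro add_mono order_trans[OF norm_sum])
      (auto intro!: sum_mono mult_left_mono norm_velocity_le)
  also have "(\<Sum>j<N. time_in_cell (T / N) j s * K) = K * max 0 (min (real N * (T / N)) s)"
    using T by (simp add: sum_distrib_right[symmetric] sum_time_in_cell)
  also have "\<dots> \<le> K * T"
    using T by (intro mult_left_mono K_nonneg) (cases "N = 0", auto)
  finally show ?thesis
    by (simp add: R_def)
qed

context
  fixes \<mu> :: "'a measure" and r :: real
  assumes \<mu>: "\<mu> \<in> probs" and bdd: "AE x in \<mu>. norm x \<le> r" and r: "C * (1 + r) \<le> K" "r \<ge> 0"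
begin

lemma probs_c_of_bound: "\<mu> \<in> probs_c"
  using \<mu> bdd by (auto simp: probs_c_iff)

lemma V_probs: "V \<mu> \<in> probs"
  using V \<mu> by (simp add: prob_vector_field_def)

lemma AE_velocity_le: "AE p in V \<mu>. norm (snd p) \<le> C * (1 + r)"
  using V_probs \<mu> C r growth[OF probs_c_of_bound] bdd by (intro AE_norm_velocity_le) auto

lemma is_disintegration_disintegration: "is_disintegration (V \<mu>) \<mu> (disintegration V \<mu>)"
proof -
  have "\<exists>\<nu>. is_disintegration (V \<mu>) (distr (V \<mu>) borel fst) \<nu>"
    by (rule disintegration_exists[OF V_probs])
  also have "distr (V \<mu>) borel fst = \<mu>"
    using V \<mu> by (simp add: prob_vector_field_def)
  finally show ?thesis
    unfolding disintegration_def by (rule someI_ex)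
qed

lemma measurable_mean_velocity: "mean_velocity V \<mu> \<in> borel_measurable borel"
  using measurable_barycentre[OF V_probs is_disintegration_disintegration \<mu> AE_velocity_le]
  by (simp add: mean_velocity_def[abs_def])

lemma AE_mean_velocity_le: "AE x in \<mu>. norm (mean_velocity V \<mu> x) \<le> C * (1 + r)"
  using AE_norm_barycentre_le[OF V_probs is_disintegration_disintegration \<mu> AE_velocity_le]
  by (simp add: mean_velocity_def)

lemma integral_inner_mean_velocity:
  assumes "h \<in> borel_measurable borel" "\<And>x. norm (h x) \<le> B"
  shows "(\<integral>x. h x \<bullet> mean_velocity V \<mu> x \<partial>\<mu>) = (\<integral>p. h (fst p) \<bullet> snd p \<partial>V \<mu>)"
  using integral_inner_barycentre[OF V_probs is_disintegration_disintegration \<mu> AE_velocity_le assms]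
  by (simp add: mean_velocity_def)

text \<open>A push-forward sees the velocity only almost everywhere, so any measurable version, in
  particular the truncated one, may replace it; composing with \<open>D\<close> writes the result as
  a law over the initial datum.\<close>

lemma mean_velocity_push_eq:
  assumes v: "v \<in> borel_measurable borel" "AE x in \<mu>. mean_velocity V \<mu> x = v x"
    and D: "\<mu> = distr \<mu>0 borel D" "D \<in> borel_measurable borel"
  shows "mean_velocity_push V s \<mu> = distr \<mu>0 borel (\<lambda>x. D x + s *\<^sub>R v (D x))"
proof -
  note [measurable] = v(1) D(2) measurable_mean_velocity
  have [measurable_cong]: "sets \<mu> = sets borel" "sets \<mu>0 = sets borel"
    using \<mu> \<mu>0 by (auto simp: probs_iff)
  have "mean_velocity_push V s \<mu> = distr \<mu> borel (\<lambda>x. x + s *\<^sub>R v x)"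
    unfolding mean_velocity_push_def using v(2) by (intro distr_cong_AE) (auto elim!: eventually_mono)
  also have "\<dots> = distr \<mu>0 borel (\<lambda>x. D x + s *\<^sub>R v (D x))"
    by (subst D(1), subst distr_distr) (auto simp: o_def)
  finally show ?thesis .
qed

end

text \<open>Closed form of the recursion \<open>\<rho> + T / N * C * (1 + \<rho>)\<close> started at
  \<open>R0\<close>: the quantity \<open>1 + \<rho>\<close> grows geometrically.\<close>

definition radius :: "nat \<Rightarrow> nat \<Rightarrow> real" where
  "radius N j = (1 + R0) * (1 + T / N * C) ^ j - 1"

lemma radius_bounds:
  assumes "j \<le> N" "N \<ge> 1"
  shows "C * (1 + radius N j) \<le> K" "radius N j \<ge> 0"
proof -
  have "(1 + T / N * C) ^ j \<le> (1 + T / N * C) ^ N"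
    using T C assms by (intro power_increasing) auto
  also have "\<dots> \<le> exp (T / N * C) ^ N"
    using T C by (intro power_mono exp_ge_add_one_self) auto
  also have "\<dots> = exp (C * T)"
    using assms by (simp add: exp_of_nat_mult[symmetric] mult.commute)
  finally show "C * (1 + radius N j) \<le> K"
    using C R0 by (simp add: radius_def K_def mult_left_mono)
  have "1 * 1 \<le> (1 + R0) * (1 + T / N * C) ^ j"
    using T C R0 by (intro mult_mono one_le_power) auto
  then show "radius N j \<ge> 0"
    by (simp add: radius_def)
qed

text \<open>The three claims need one induction: the norm bound at a node yields a measurable mean
  velocity that is almost surely below \<open>K\<close>, hence equal to its truncation, and this
  identifies the law of the next node and bounds it.\<close>

lemma scheme_node_properties:
  assumes "j \<le> N" "N \<ge> 1"
  shows "flow N j \<in> borel_measurable borel \<and> node N j = distr \<mu>0 borel (flow N j) \<and>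
    (AE x in node N j. norm x \<le> radius N j)"
  using assms(1)
proof (induction j)
  case 0
  have [measurable_cong]: "sets \<mu>0 = sets borel"
    using \<mu>0 by (auto simp: probs_iff)
  have f[measurable]: "flow N 0 \<in> borel_measurable borel"
    unfolding flow.simps(1)[abs_def] by measurable
  have "distr \<mu>0 borel (flow N 0) = distr \<mu>0 borel (\<lambda>x. x)"
    using \<mu>0_bdd by (intro distr_cong_AE) (auto elim!: eventually_mono)
  also have "\<dots> = \<mu>0"
    using \<mu>0 by (intro distr_id2) (auto simp: probs_iff)
  finally have "distr \<mu>0 borel (flow N 0) = \<mu>0" .
  moreover have "radius N 0 = R0"
    by (simp add: radius_def)
  ultimately show ?case
    using \<mu>0_bdd f unfolding scheme_node.simps by metis
next
  case (Suc j)
  let ?\<mu> = "node N j"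
  have flow[measurable]: "flow N j \<in> borel_measurable borel" and node: "?\<mu> = distr \<mu>0 borel (flow N j)"
    and bdd: "AE x in ?\<mu>. norm x \<le> radius N j"
    using Suc by auto
  have [measurable_cong]: "sets \<mu>0 = sets borel" and "prob_space \<mu>0"
    using \<mu>0 by (auto simp: probs_iff)
  then have \<mu>: "?\<mu> \<in> probs"
    unfolding node by (auto simp: probs_iff intro!: prob_space.prob_space_distr)
  note r = radius_bounds[of j N] 
  have rj: "C * (1 + radius N j) \<le> K" "radius N j \<ge> 0"
    using r Suc assms by auto
  note mv[measurable] = measurable_mean_velocity[OF \<mu> bdd rj]
  have vel[measurable]: "velocity N j \<in> borel_measurable borel"
    unfolding velocity_def[abs_def] by measurable
  have flow': "flow N (Suc j) \<in> borel_measurable borel"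
    unfolding flow.simps(2)[abs_def] by measurable
  have AE_v: "AE x in ?\<mu>. norm (mean_velocity V ?\<mu> x) \<le> C * (1 + radius N j)"
    by (rule AE_mean_velocity_le[OF \<mu> bdd rj])
  then have AE_vel: "AE x in ?\<mu>. mean_velocity V ?\<mu> x = velocity N j x"
    using rj by (auto simp: velocity_def elim!: eventually_mono)
  have "node N (Suc j) = distr \<mu>0 borel (flow N (Suc j))"
    using mean_velocity_push_eq[OF \<mu> bdd rj vel AE_vel node flow]
    by (simp add: flow.simps(2)[abs_def])
  moreover have "AE x in node N (Suc j). norm x \<le> radius N (Suc j)"
  proof -
    have [measurable_cong]: "sets ?\<mu> = sets borel"
      using \<mu> by (simp add: probs_iff)
    have "AE x in ?\<mu>. norm (x + (T / N) *\<^sub>R mean_velocity V ?\<mu> x) \<le> radius N (Suc j)"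
      using AE_v bdd
    proof eventually_elim
      case (elim x)
      have "norm (x + (T / N) *\<^sub>R mean_velocity V ?\<mu> x) \<le> norm x + T / N * norm (mean_velocity V ?\<mu> x)"
        using T by (intro order_trans[OF norm_triangle_ineq]) auto
      also have "\<dots> \<le> radius N j + T / N * (C * (1 + radius N j))"
        using elim T by (intro add_mono mult_left_mono) auto
      also have "\<dots> = radius N (Suc j)"
        by (simp add: radius_def algebra_simps add_divide_distrib)
      finally show ?case .
    qed
    then show ?thesis
      unfolding scheme_node.simps mean_velocity_push_def by (subst AE_distr_iff) auto
  qed
  ultimately show ?case
    using flow' by blast
qed

context
  fixes N j :: nat
  assumes j: "j < N"
begin

lemma flow_measurable: "flow N j \<in> borel_measurable borel"
  and node_eq: "node N j = distr \<mu>0 borel (flow N j)"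
  and AE_node: "AE x in node N j. norm x \<le> radius N j"
  and radius_le: "C * (1 + radius N j) \<le> K" "radius N j \<ge> 0"
  using scheme_node_properties[of j N] radius_bounds[of j N] j by auto

lemma node_probs: "node N j \<in> probs"
  using \<mu>0 flow_measurable unfolding node_eq
  by (auto simp: probs_iff intro!: prob_space.prob_space_distr cong: measurable_cong_sets)

lemma node_probs_c: "node N j \<in> probs_c"
  by (rule probs_c_of_bound[OF node_probs AE_node radius_le])

lemma AE_V_node: "AE p in V (node N j). norm (snd p) \<le> K"
  using AE_velocity_le[OF node_probs AE_node radius_le] radius_le by (auto elim!: eventually_mono)

lemma velocity_measurable: "velocity N j \<in> borel_measurable borel"
  using measurable_mean_velocity[OF node_probs AE_node radius_le]
  unfolding velocity_def[abs_def] by measurable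

lemma AE_mean_velocity_eq: "AE x in node N j. mean_velocity V (node N j) x = velocity N j x"
  using AE_mean_velocity_le[OF node_probs AE_node radius_le] radius_le
  by (auto simp: velocity_def elim!: eventually_mono)

lemma node_eq_path: "node N j = distr \<mu>0 borel (path N (real j * (T / N)))"
proof -
  have "path N (real j * (T / N)) = flow N j"
    by (rule ext, subst path_in_cell[OF j]) (use T in \<open>auto intro!: divide_right_mono mult_right_mono\<close>)
  then show ?thesis
    by (simp add: node_eq)
qed

end

lemma path_measurable [measurable]: "path N s \<in> borel_measurable borel"
proof -
  have [measurable]: "flow N 0 \<in> borel_measurable borel"
    unfolding flow.simps(1)[abs_def] by measurable
  show ?thesis
    unfolding path_def[abs_def]
    by (intro borel_measurable_add borel_measurable_sum borel_measurable_scaleR)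
       (auto intro!: measurable_compose[OF flow_measurable velocity_measurable] simp del: flow.simps)
qed

lemma scheme_eq_distr_path:
  assumes N: "N \<ge> 1" and t: "0 \<le> t" "t \<le> T"
  shows "mean_velocity_scheme V T \<mu>0 N t = distr \<mu>0 borel (path N t)"
proof (cases "t = 0")
  case True
  have "node N 0 = distr \<mu>0 borel (path N 0)"
    using node_eq_path[of 0 N] N by simp
  then show ?thesis
    using True by (simp add: mean_velocity_scheme_def)
next
  case False
  define \<Delta> where "\<Delta> = T / N"
  define j where "j = nat (\<lceil>t / \<Delta>\<rceil> - 1)"
  have \<Delta>: "\<Delta> > 0" using T N by (simp add: \<Delta>_def)
  have "t / \<Delta> > 0" using t False \<Delta> by simp
  \<comment> \<open>Positivity of \<open>t\<close> ensures that \<open>nat\<close> cuts nothing off.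
    A node time is assigned to the cell on its left, and the closed cells of
    \<open>path_in_cell\<close> include it.\<close>
  then have "\<lceil>t / \<Delta>\<rceil> \<ge> 1" by linarith
  then have jr: "real j = of_int \<lceil>t / \<Delta>\<rceil> - 1"
    by (simp add: j_def)
  then have "real j < t / \<Delta>" "t / \<Delta> \<le> real (Suc j)"
    by linarith+
  then have cell: "real j * \<Delta> < t" "t \<le> real (Suc j) * \<Delta>"
    using \<Delta> by (auto simp: field_simps)
  have "real j * \<Delta> < real N * \<Delta>"
    using cell t N by (simp add: \<Delta>_def)
  then have j: "j < N"
    using \<Delta> by simp
  have "mean_velocity_scheme V T \<mu>0 N t = mean_velocity_push V (t - real j * \<Delta>) (node N j)"
    using t False by (simp add: mean_velocity_scheme_def Let_def \<Delta>_def j_def)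
  also have "\<dots> = distr \<mu>0 borel (\<lambda>x. flow N j x + (t - real j * \<Delta>) *\<^sub>R velocity N j (flow N j x))"
    by (rule mean_velocity_push_eq[OF node_probs AE_node radius_le velocity_measurable
          AE_mean_velocity_eq node_eq flow_measurable]) (rule j)+
  also have "\<dots> = distr \<mu>0 borel (path N t)"
    using cell by (simp add: path_in_cell[OF j, of t] \<Delta>_def cong: distr_cong)
  finally show ?thesis .
qed

end

subsection \<open>The weak form of the equation along the scheme\<close>

definition weak_velocity :: "('a::euclidean_space \<Rightarrow> real) \<Rightarrow> ('a \<times> 'a) measure \<Rightarrow> real" where
  "weak_velocity f M = (\<integral>(x, v). gradient f x \<bullet> v \<partial>M)"

locale bounded_gradient =
  fixes f :: "'a::euclidean_space \<Rightarrow> real" and B L :: real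
  assumes derivative: "\<And>x. (f has_derivative (\<lambda>h. gradient f x \<bullet> h)) (at x)"
    and B: "B \<ge> 0" and L: "L \<ge> 0"
    and f_le: "\<And>x. \<bar>f x\<bar> \<le> B" and gradient_le: "\<And>x. norm (gradient f x) \<le> B"
    and gradient_lipschitz: "\<And>x y. norm (gradient f x - gradient f y) \<le> L * norm (x - y)"
begin

lemma f_lipschitz: "\<bar>f x - f y\<bar> \<le> B * dist x y"
proof -
  have "norm (f x - f y) \<le> B * norm (x - y)"
  proof (rule differentiable_bound[of UNIV f "\<lambda>x h. gradient f x \<bullet> h"])
    show "onorm (\<lambda>h. gradient f z \<bullet> h) \<le> B" for z
      by (rule onorm_bound[OF B])
        (auto intro!: order_trans[OF Cauchy_Schwarz_ineq2] mult_right_mono gradient_le)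
  qed (use derivative in auto)
  then show ?thesis by (simp add: dist_norm)
qed

lemma f_measurable [measurable]: "f \<in> borel_measurable borel"
  by (intro borel_measurable_continuous_onI continuous_at_imp_continuous_on ballI
      has_derivative_continuous[OF derivative])

lemma gradient_measurable [measurable]: "gradient f \<in> borel_measurable borel"
proof (intro borel_measurable_continuous_onI)
  have "L-lipschitz_on UNIV (gradient f)"
    using L gradient_lipschitz by (auto simp: lipschitz_on_def dist_norm)
  then show "continuous_on UNIV (gradient f)"
    by (rule lipschitz_on_continuous_on)
qed

lemma pairing_measurable: "(\<lambda>(x, v). gradient f x \<bullet> v) \<in> borel_measurable borel"
proof -
  have "(\<lambda>(x, v). gradient f x \<bullet> v) \<in> borel_measurable (borel \<Otimes>\<^sub>M borel)"
    by measurable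
  then show ?thesis
    unfolding borel_prod .
qed

text \<open>On the ball of radius \<open>e\<close> about \<open>z\<close> the function minus its
  linear part at \<open>z\<close> has derivative at most \<open>L * e\<close>. Expanding at a third
  point \<open>z\<close> lets two times of a cell be compared with the gradient frozen at the
  node.\<close>

lemma taylor:
  assumes "norm (y - z) \<le> e" "norm (y' - z) \<le> e"
  shows "\<bar>f y - f y' - gradient f z \<bullet> (y - y')\<bar> \<le> L * e * norm (y - y')"
proof -
  have "norm ((f y - gradient f z \<bullet> y) - (f y' - gradient f z \<bullet> y')) \<le> L * e * norm (y - y')"
  proof (rule differentiable_bound[of "cball z e" _ "\<lambda>x h. gradient f x \<bullet> h - gradient f z \<bullet> h"])
    fix x assume x: "x \<in> cball z e"
    then have e: "e \<ge> 0"
      using zero_le_dist[of z x] by (simp del: zero_le_dist)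
    show "((\<lambda>x. f x - gradient f z \<bullet> x) has_derivative (\<lambda>h. gradient f x \<bullet> h - gradient f z \<bullet> h)) (at x within cball z e)"
      by (intro derivative_intros has_derivative_at_withinI[OF derivative])
    show "onorm (\<lambda>h. gradient f x \<bullet> h - gradient f z \<bullet> h) \<le> L * e"
    proof (rule onorm_bound)
      show "0 \<le> L * e" using L e by simp
      fix h
      have "\<bar>gradient f x \<bullet> h - gradient f z \<bullet> h\<bar> \<le> norm (gradient f x - gradient f z) * norm h"
        unfolding inner_diff_left[symmetric] by (rule Cauchy_Schwarz_ineq2)
      also have "\<dots> \<le> (L * norm (x - z)) * norm h"
        by (intro mult_right_mono gradient_lipschitz) simp
      also have "\<dots> \<le> (L * e) * norm h"
        using x L by (intro mult_right_mono mult_left_mono) (auto simp: dist_norm norm_minus_commute)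
      finally show "norm (gradient f x \<bullet> h - gradient f z \<bullet> h) \<le> L * e * norm h"
        by simp
    qed
  qed (use assms in \<open>auto simp: dist_norm norm_minus_commute\<close>)
  then show ?thesis
    by (simp add: inner_diff_right algebra_simps)
qed

lemma pairing_le: "norm (snd p) \<le> k \<Longrightarrow> \<bar>case p of (x, v) \<Rightarrow> gradient f x \<bullet> v\<bar> \<le> B * k"
  unfolding case_prod_beta
  by (rule order_trans[OF Cauchy_Schwarz_ineq2]) (intro mult_mono gradient_le B norm_ge_zero)

text \<open>The change of the gradient is multiplied by the velocity of \<open>p\<close>, bounded by
  \<open>k\<close>; the change of velocity is multiplied by a gradient, bounded by
  \<open>B\<close>.\<close>

lemma pairing_lipschitz:
  assumes "norm (snd p) \<le> k"
  shows "\<bar>(case p of (x, v) \<Rightarrow> gradient f x \<bullet> v) - (case q of (x, v) \<Rightarrow> gradient f x \<bullet> v)\<bar> \<le> (L * k + B) * dist p q"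
proof -
  obtain x v y w where pq: "p = (x, v)" "q = (y, w)" by fastforce
  have "\<bar>(gradient f x - gradient f y) \<bullet> v\<bar> \<le> (L * dist p q) * k"
  proof (rule order_trans[OF Cauchy_Schwarz_ineq2], rule mult_mono)
    have "norm (gradient f x - gradient f y) \<le> L * dist x y"
      using gradient_lipschitz[of x y] by (simp add: dist_norm)
    also have "\<dots> \<le> L * dist p q"
      using dist_fst_le[of p q] L by (intro mult_left_mono) (auto simp: pq)
    finally show "norm (gradient f x - gradient f y) \<le> L * dist p q" .
  qed (use assms L in \<open>auto simp: pq\<close>)
  moreover have "\<bar>gradient f y \<bullet> (v - w)\<bar> \<le> B * dist p q"
    using dist_snd_le[of p q] B
    by (intro order_trans[OF Cauchy_Schwarz_ineq2] mult_mono gradient_le) (auto simp: pq dist_norm)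
  moreover have "gradient f x \<bullet> v - gradient f y \<bullet> w = (gradient f x - gradient f y) \<bullet> v + gradient f y \<bullet> (v - w)"
    by (simp add: inner_diff_left inner_diff_right)
  ultimately show ?thesis
    by (simp add: pq algebra_simps)
qed

lemma weak_velocity_diff_le:
  assumes "M \<in> probs" "M' \<in> probs" "wasserstein M M' < ennreal \<delta>" "k \<ge> 0"
    and "AE p in M. norm (snd p) \<le> k" "AE p in M'. norm (snd p) \<le> k"
  shows "\<bar>weak_velocity f M - weak_velocity f M'\<bar> \<le> (L * k + B) * \<delta>"
  unfolding weak_velocity_def using assms B L
  by (intro integral_diff_le_wasserstein[where S="{p. norm (snd p) \<le> k}" and B="B * k"]
      pairing_measurable pairing_le pairing_lipschitz) auto

lemma integrable_pairing:
  assumes "M \<in> probs" "AE p in M. norm (snd p) \<le> k"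
  shows "integrable M (\<lambda>(x, v). gradient f x \<bullet> v)"
proof -
  interpret prob_space M using assms by (simp add: probs_iff)
  have [measurable_cong]: "sets M = sets borel" using assms by (simp add: probs_iff)
  show ?thesis
  proof (rule integrable_const_bound)
    show "AE p in M. norm (case p of (x, v) \<Rightarrow> gradient f x \<bullet> v) \<le> B * k"
      using assms(2) by eventually_elim (simp only: real_norm_def pairing_le)
  qed (use pairing_measurable in measurable)
qed

end

lemma test_function_bounded_gradient:
  assumes "f \<in> test_functions"
  obtains B L where "bounded_gradient f B L"
  using test_function_regularity[OF assms] unfolding bounded_gradient_def by metis

context mean_velocity_dynamics
begin

text \<open>Inside a cell each particle moves with its frozen velocity and stays within
  \<open>T / N * K\<close> of its position at the node, so Taylor expansion there costs a factor of
  order \<open>T / N\<close>. Averaging turns gradient times mean velocity into the pairing with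
  \<open>V\<close>. The error is proportional to \<open>\<bar>s - t\<bar>\<close>, which is what
  makes it a Lipschitz estimate.\<close>

lemma weak_increment_in_cell:
  assumes bg: "bounded_gradient f B L" and j: "j < N"
    and s: "s \<in> {real j * (T / N)..real (Suc j) * (T / N)}"
    and t: "t \<in> {real j * (T / N)..real (Suc j) * (T / N)}"
  shows "\<bar>(\<integral>x. f (path N s x) \<partial>\<mu>0) - (\<integral>x. f (path N t x) \<partial>\<mu>0) - (s - t) * weak_velocity f (V (node N j))\<bar>
    \<le> L * (T / N * K) * K * \<bar>s - t\<bar>"
proof -
  interpret bounded_gradient f B L by fact
  interpret prob_space \<mu>0 using \<mu>0 by (simp add: probs_iff)
  have [measurable_cong]: "sets \<mu>0 = sets borel" using \<mu>0 by (simp add: probs_iff)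
  note [measurable] = flow_measurable[OF j] velocity_measurable[OF j]
  define z where "z = flow N j"
  define u where "u x = velocity N j (flow N j x)" for x
  have [measurable]: "z \<in> borel_measurable borel" "u \<in> borel_measurable borel"
    unfolding z_def u_def[abs_def] by measurable
  have u: "norm (u x) \<le> K" for x
    by (simp add: u_def norm_velocity_le)
  have path: "path N s x = z x + (s - real j * (T / N)) *\<^sub>R u x"
    "path N t x = z x + (t - real j * (T / N)) *\<^sub>R u x" for x
    using path_in_cell[OF j] s t by (auto simp: z_def u_def)
  have near: "norm (a *\<^sub>R u x) \<le> T / N * K" if "0 \<le> a" "a \<le> T / N" for a x
  proof -
    have "\<bar>a\<bar> * norm (u x) \<le> T / N * K"
      using that T by (intro mult_mono u) auto
    then show ?thesis by simp
  qed
  have pointwise: "\<bar>f (path N s x) - f (path N t x) - (s - t) * (gradient f (z x) \<bullet> u x)\<bar>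
      \<le> L * (T / N * K) * K * \<bar>s - t\<bar>" for x
  proof -
    have diff: "path N s x - path N t x = (s - t) *\<^sub>R u x"
      by (simp add: path algebra_simps)
    have "\<bar>f (path N s x) - f (path N t x) - gradient f (z x) \<bullet> (path N s x - path N t x)\<bar>
        \<le> L * (T / N * K) * norm (path N s x - path N t x)"
    proof (rule taylor)
      have "real (Suc j) * (T / N) = real j * (T / N) + T / N"
        unfolding of_nat_Suc by (subst distrib_right) simp
      then have le: "s - real j * (T / N) \<le> T / N" "t - real j * (T / N) \<le> T / N"
        using s t by (simp_all only: atLeastAtMost_iff) linarith+
      show "norm (path N s x - z x) \<le> T / N * K"
        unfolding path(1) add_diff_cancel_left' by (rule near) (use s le in \<open>simp_all only: atLeastAtMost_iff diff_ge_0_iff_ge\<close>)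
      show "norm (path N t x - z x) \<le> T / N * K"
        unfolding path(2) add_diff_cancel_left' by (rule near) (use t le in \<open>simp_all only: atLeastAtMost_iff diff_ge_0_iff_ge\<close>)
    qed
    also have "\<dots> \<le> L * (T / N * K) * (K * \<bar>s - t\<bar>)"
      using dist_path_le[of N s x t] L T K_nonneg by (intro mult_left_mono) (auto simp: dist_norm)
    finally show ?thesis
      by (simp add: diff mult.assoc)
  qed
  have int_f: "integrable \<mu>0 (\<lambda>x. f (path N s x))" for s
    by (rule integrable_const_bound[where B=B]) (auto simp: f_le)
  have int_u: "integrable \<mu>0 (\<lambda>x. gradient f (z x) \<bullet> u x)"
  proof (rule integrable_const_bound[where B="B * K"])
    show "AE x in \<mu>0. norm (gradient f (z x) \<bullet> u x) \<le> B * K"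
      using pairing_le[of "(z x, u x)" K for x] u by simp
  qed measurable
  have "(\<integral>x. gradient f (z x) \<bullet> u x \<partial>\<mu>0) = (\<integral>x. gradient f x \<bullet> velocity N j x \<partial>node N j)"
    unfolding node_eq[OF j] z_def u_def by (subst integral_distr) auto
  also have "\<dots> = (\<integral>x. gradient f x \<bullet> mean_velocity V (node N j) x \<partial>node N j)"
  proof (rule integral_cong_AE)
    have [measurable_cong]: "sets (node N j) = sets borel"
      using node_probs[OF j] by (simp add: probs_iff)
    have [measurable]: "mean_velocity V (node N j) \<in> borel_measurable borel"
      by (rule measurable_mean_velocity[OF node_probs[OF j] AE_node[OF j] radius_le[OF j]])
    show "(\<lambda>x. gradient f x \<bullet> velocity N j x) \<in> borel_measurable (node N j)"
      "(\<lambda>x. gradient f x \<bullet> mean_velocity V (node N j) x) \<in> borel_measurable (node N j)"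
      by measurable
  qed (use AE_mean_velocity_eq[OF j] in \<open>auto elim!: eventually_mono\<close>)
  also have "\<dots> = weak_velocity f (V (node N j))"
    unfolding weak_velocity_def case_prod_beta
    by (rule integral_inner_mean_velocity[OF node_probs[OF j] AE_node[OF j] radius_le[OF j]
          gradient_measurable gradient_le])
  finally have weak: "weak_velocity f (V (node N j)) = (\<integral>x. gradient f (z x) \<bullet> u x \<partial>\<mu>0)" ..
  define g where "g x = f (path N s x) - f (path N t x) - (s - t) * (gradient f (z x) \<bullet> u x)" for x
  have int_g: "integrable \<mu>0 g"
    unfolding g_def[abs_def] by (intro Bochner_Integration.integrable_diff integrable_mult_right int_f int_u)
  have "(\<integral>x. g x \<partial>\<mu>0) =
      (\<integral>x. f (path N s x) \<partial>\<mu>0) - (\<integral>x. f (path N t x) \<partial>\<mu>0) - (s - t) * weak_velocity f (V (node N j))"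
    unfolding g_def weak
    by (subst Bochner_Integration.integral_diff[OF Bochner_Integration.integrable_diff[OF int_f int_f] integrable_mult_right[OF int_u]],
        subst Bochner_Integration.integral_diff[OF int_f int_f]) simp
  moreover have "\<bar>\<integral>x. g x \<partial>\<mu>0\<bar> \<le> (\<integral>x. \<bar>g x\<bar> \<partial>\<mu>0)"
    by (rule integral_abs_bound)
  moreover have "(\<integral>x. \<bar>g x\<bar> \<partial>\<mu>0) \<le> (\<integral>x. L * (T / N * K) * K * \<bar>s - t\<bar> \<partial>\<mu>0)"
    using pointwise unfolding g_def[symmetric] by (intro integral_mono integrable_abs[OF int_g]) auto
  ultimately show ?thesis
    by (simp only: lebesgue_integral_const prob_space scaleR_one mult_1)
qed

end

subsection \<open>Passage to the limit\<close>

text \<open>Fatou's lemma gives one inequality on open sets, outer regularity extends it to Borel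
  sets, and complements turn it into equality because both masses are 1. It serves to identify the
  initial value of the limit.\<close>

lemma distr_eq_of_AE_tendsto:
  fixes Z :: "nat \<Rightarrow> 'b \<Rightarrow> 'a::euclidean_space"
  assumes M: "prob_space M" and [measurable]: "\<And>k. Z k \<in> borel_measurable M" "Z' \<in> borel_measurable M"
    and law: "\<And>k. distr M borel (Z k) = \<nu>" and lim: "AE \<omega> in M. (\<lambda>k. Z k \<omega>) \<longlonglongrightarrow> Z' \<omega>"
  shows "distr M borel Z' = \<nu>"
proof -
  interpret M: prob_space M by fact
  have \<nu>: "prob_space \<nu>" "sets \<nu> = sets borel"
    using law[of 0] M.prob_space_distr[of "Z 0" borel] by auto
  interpret \<nu>: prob_space \<nu> by fact
  interpret Z': prob_space "distr M borel Z'"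
    by (rule M.prob_space_distr) measurable
  have open_le: "emeasure (distr M borel Z') U \<le> emeasure \<nu> U" if U: "open U" for U
  proof -
    have [measurable]: "U \<in> sets borel" using U by simp
    have "emeasure (distr M borel Z') U = (\<integral>\<^sup>+\<omega>. indicator U (Z' \<omega>) \<partial>M)"
      by (subst nn_integral_indicator[symmetric], simp, subst nn_integral_distr) auto
    also have "\<dots> \<le> (\<integral>\<^sup>+\<omega>. liminf (\<lambda>k. indicator U (Z k \<omega>)) \<partial>M)"
    proof (rule nn_integral_mono_AE, use lim in eventually_elim)
      case (elim \<omega>)
      show ?case
      proof (cases "Z' \<omega> \<in> U")
        case True
        then have "\<forall>\<^sub>F k in sequentially. Z k \<omega> \<in> U"
          using elim U by (simp add: topological_tendstoD)
        then show ?thesis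
          by (intro Liminf_bounded) (auto elim!: eventually_mono simp: indicator_def)
      qed simp
    qed
    also have "\<dots> \<le> liminf (\<lambda>k. \<integral>\<^sup>+\<omega>. indicator U (Z k \<omega>) \<partial>M)"
      by (rule nn_integral_liminf) measurable
    also have "(\<lambda>k. \<integral>\<^sup>+\<omega>. indicator U (Z k \<omega>) \<partial>M) = (\<lambda>k. emeasure \<nu> U)"
    proof
      fix k
      have "emeasure \<nu> U = (\<integral>\<^sup>+x. indicator U x \<partial>distr M borel (Z k))"
        unfolding law[symmetric, of k] by simp
      also have "\<dots> = (\<integral>\<^sup>+\<omega>. indicator U (Z k \<omega>) \<partial>M)"
        by (subst nn_integral_distr) auto
      finally show "(\<integral>\<^sup>+\<omega>. indicator U (Z k \<omega>) \<partial>M) = emeasure \<nu> U" ..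
    qed
    finally show ?thesis
      by (simp add: Liminf_const)
  qed
  have le: "emeasure (distr M borel Z') A \<le> emeasure \<nu> A" if "A \<in> sets borel" for A
    using that open_le \<nu> outer_regular[of \<nu> A] outer_regular[of "distr M borel Z'" A]
      \<nu>.emeasure_finite Z'.emeasure_finite
    by (auto intro!: INF_mono)
  show ?thesis
  proof (rule measure_eqI)
    fix A assume A: "A \<in> sets (distr M borel Z')"
    have "measure (distr M borel Z') A \<le> measure \<nu> A" "measure (distr M borel Z') (- A) \<le> measure \<nu> (- A)"
      using le[of A] le[of "- A"] A by (auto simp: Z'.emeasure_eq_measure \<nu>.emeasure_eq_measure)
    moreover have "measure (distr M borel Z') (- A) = 1 - measure (distr M borel Z') A"
      using Z'.prob_compl[of A] A by (simp add: Compl_eq_Diff_UNIV)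
    moreover have "measure \<nu> (- A) = 1 - measure \<nu> A"
      using \<nu>.prob_compl[of A] A \<nu> sets_eq_imp_space_eq[OF \<nu>(2)] by (simp add: Compl_eq_Diff_UNIV)
    ultimately show "emeasure (distr M borel Z') A = emeasure \<nu> A"
      by (simp add: Z'.emeasure_eq_measure \<nu>.emeasure_eq_measure)
  qed (use \<nu> in simp)
qed

text \<open>Smallness at the finitely many points of a grid of step \<open>h\<close> with
  \<open>\<Lambda> * h < \<delta> / 2\<close> spreads to the whole interval through the common
  Lipschitz constant.\<close>

lemma lipschitz_pointwise_imp_uniform:
  fixes e :: "nat \<Rightarrow> real \<Rightarrow> real"
  assumes lip: "\<And>k s t. \<bar>e k s - e k t\<bar> \<le> \<Lambda> * \<bar>s - t\<bar>" and "\<Lambda> \<ge> 0" "T > 0"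
    and lim: "\<And>t. (\<lambda>k. e k t) \<longlonglongrightarrow> 0" and "\<delta> > 0"
  shows "\<forall>\<^sub>F k in sequentially. \<forall>t\<in>{0..T}. \<bar>e k t\<bar> < \<delta>"
proof -
  obtain n where n: "1 / Suc n < \<delta> / (2 * (\<Lambda> + 1))"
    using nat_approx_posE[of "\<delta> / (2 * (\<Lambda> + 1))"] \<open>\<delta> > 0\<close> \<open>\<Lambda> \<ge> 0\<close> by (auto simp: inverse_eq_divide)
  define h where "h = 1 / Suc n"
  have h: "h > 0" "\<Lambda> * h < \<delta> / 2"
  proof -
    have "\<Lambda> * h \<le> (\<Lambda> + 1) * h" by (simp add: h_def field_simps)
    also have "\<dots> < (\<Lambda> + 1) * (\<delta> / (2 * (\<Lambda> + 1)))"
      unfolding h_def using n \<open>\<Lambda> \<ge> 0\<close> by (intro mult_strict_left_mono) auto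
    also have "\<dots> = \<delta> / 2" using \<open>\<Lambda> \<ge> 0\<close> by (simp add: field_simps)
    finally show "\<Lambda> * h < \<delta> / 2" .
  qed (simp add: h_def)
  define m where "m = nat \<lceil>T / h\<rceil>"
  have "\<forall>\<^sub>F k in sequentially. \<forall>i\<in>{..m}. \<bar>e k (real i * h)\<bar> < \<delta> / 2"
    using lim[THEN tendstoD, of "\<delta> / 2"] \<open>\<delta> > 0\<close> by (intro eventually_ball_finite) auto
  then show ?thesis
  proof eventually_elim
    case (elim k)
    show ?case
    proof
      fix t assume t: "t \<in> {0..T}"
      define i where "i = nat \<lfloor>t / h\<rfloor>"
      have q: "0 \<le> t / h" "t / h \<le> T / h"
        using t h by (auto simp: divide_right_mono)
      then have i: "real i = of_int \<lfloor>t / h\<rfloor>"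
        by (simp add: i_def)
      then have "real i \<le> t / h" "t / h \<le> real i + 1"
        by linarith+
      then have ih: "real i * h \<le> t" "t \<le> real i * h + h"
        using h by (auto simp: field_simps)
      have "i \<le> m"
        unfolding i_def m_def using q by (intro nat_mono) linarith
      then have "\<bar>e k (real i * h)\<bar> < \<delta> / 2"
        using elim by blast
      moreover have "\<bar>e k t - e k (real i * h)\<bar> \<le> \<Lambda> * h"
        using lip[of k t "real i * h"] ih \<open>\<Lambda> \<ge> 0\<close> mult_left_mono[of "\<bar>t - real i * h\<bar>" h \<Lambda>] by linarith
      ultimately show "\<bar>e k t\<bar> < \<delta>"
        using h by linarith
    qed
  qed
qed

lemma lipschitz_imp_absolutely_continuous_on:
  assumes lip: "\<And>s t. s \<in> S \<Longrightarrow> t \<in> S \<Longrightarrow> \<bar>h s - h t\<bar> \<le> \<Lambda> * \<bar>s - t\<bar>" and "\<Lambda> \<ge> 0"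
  shows "absolutely_continuous_on S h"
  unfolding absolutely_continuous_on_def
proof (intro allI impI)
  fix \<epsilon> :: real assume "\<epsilon> > 0"
  have "(\<Sum>(a, b)\<in>I. \<bar>h b - h a\<bar>) < \<epsilon>"
    if I: "\<forall>(a, b)\<in>I. a \<le> b \<and> {a..b} \<subseteq> S" "(\<Sum>(a, b)\<in>I. b - a) < \<epsilon> / (\<Lambda> + 1)" for I
  proof -
    have "(\<Sum>(a, b)\<in>I. \<bar>h b - h a\<bar>) \<le> (\<Sum>(a, b)\<in>I. \<Lambda> * (b - a))"
    proof (rule sum_mono, clarify)
      fix a b assume "(a, b) \<in> I"
      then have "a \<le> b" "{a..b} \<subseteq> S" using I by auto
      then show "\<bar>h b - h a\<bar> \<le> \<Lambda> * (b - a)"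
        using lip[of b a] by (auto simp: subset_eq)
    qed
    also have "\<dots> = \<Lambda> * (\<Sum>(a, b)\<in>I. b - a)"
      by (simp add: sum_distrib_left case_prod_beta)
    also have "\<dots> \<le> \<Lambda> * (\<epsilon> / (\<Lambda> + 1))"
      using I(2) \<open>\<Lambda> \<ge> 0\<close> by (intro mult_left_mono) auto
    also have "\<dots> < \<epsilon>"
      using \<open>\<Lambda> \<ge> 0\<close> \<open>\<epsilon> > 0\<close> by (simp add: field_simps)
    finally show ?thesis .
  qed
  then show "\<exists>\<delta>>0. \<forall>I. finite I \<longrightarrow> (\<forall>(a, b)\<in>I. a \<le> b \<and> {a..b} \<subseteq> S) \<longrightarrow>
      disjoint_family_on (\<lambda>(a, b). {a<..<b}) I \<longrightarrow> (\<Sum>(a, b)\<in>I. b - a) < \<delta> \<longrightarrow>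
      (\<Sum>(a, b)\<in>I. \<bar>h b - h a\<bar>) < \<epsilon>"
    using \<open>\<epsilon> > 0\<close> \<open>\<Lambda> \<ge> 0\<close> by (intro exI[of _ "\<epsilon> / (\<Lambda> + 1)"]) auto
qed

section \<open>The limit curve and uniform convergence\<close>

locale scheme_limit = mean_velocity_dynamics V T C R0 \<mu>0
  for V :: "'a::euclidean_space measure \<Rightarrow> ('a \<times> 'a) measure" and T C R0 \<mu>0 +
  fixes r :: "nat \<Rightarrow> nat" and \<Omega> :: "real measure" and Z and Z' :: "real \<Rightarrow> real \<Rightarrow> 'a"
  assumes r: "\<And>k. r k \<ge> 1" "strict_mono r"
    and prob_\<Omega>: "prob_space \<Omega>"
    and Z_measurable [measurable]: "\<And>k t. Z k t \<in> borel_measurable \<Omega>"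
    and Z'_measurable [measurable]: "\<And>t. Z' t \<in> borel_measurable \<Omega>"
    and Z_law: "\<And>k t. distr \<Omega> borel (Z k t) = distr \<mu>0 borel (path (r k) t)"
    and AE_paths: "AE \<omega> in \<Omega>. (\<forall>t. norm (Z' t \<omega>) \<le> R) \<and>
      (\<forall>s t. dist (Z' s \<omega>) (Z' t \<omega>) \<le> K * \<bar>s - t\<bar>) \<and>
      (\<forall>k t. norm (Z k t \<omega>) \<le> R) \<and> (\<forall>k s t. dist (Z k s \<omega>) (Z k t \<omega>) \<le> K * \<bar>s - t\<bar>) \<and>
      (\<forall>t. (\<lambda>k. Z k t \<omega>) \<longlonglongrightarrow> Z' t \<omega>)"
begin

interpretation \<Omega>: prob_space \<Omega>
  by (rule prob_\<Omega>)

definition \<mu> :: "real \<Rightarrow> 'a measure" where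
  "\<mu> t = distr \<Omega> borel (Z' t)"

text \<open>The cost of the coupling given by the common probability space. It dominates the
  Wasserstein distance, tends to 0 by dominated convergence, and inherits a Lipschitz bound in time
  from the paths.\<close>

definition e :: "nat \<Rightarrow> real \<Rightarrow> real" where
  "e k t = (\<integral>\<omega>. dist (Z k t \<omega>) (Z' t \<omega>) \<partial>\<Omega>)"

text \<open>\<open>K\<close> bounds the velocities at the nodes, while the limit curve is known to
  stay in the ball of radius \<open>R\<close>, for which (H1) gives \<open>C * (1 + R)\<close>.
  Comparing the two requires one common bound.\<close>

definition velocity_bound :: real where
  "velocity_bound = max K (C * (1 + R))"

lemma integrable_dist:
  fixes X Y :: "real \<Rightarrow> 'a"
  assumes [measurable]: "X \<in> borel_measurable \<Omega>" "Y \<in> borel_measurable \<Omega>"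
    and "AE \<omega> in \<Omega>. norm (X \<omega>) \<le> R" "AE \<omega> in \<Omega>. norm (Y \<omega>) \<le> R"
  shows "integrable \<Omega> (\<lambda>\<omega>. dist (X \<omega>) (Y \<omega>))"
proof (rule \<Omega>.integrable_const_bound[where B="2 * R"])
  show "AE \<omega> in \<Omega>. norm (dist (X \<omega>) (Y \<omega>)) \<le> 2 * R"
    using assms(3,4)
  proof eventually_elim
    case (elim \<omega>)
    then show ?case
      using norm_triangle_ineq4[of "X \<omega>" "Y \<omega>"] by (simp add: dist_norm)
  qed
qed measurable

lemma AE_norm_le: "AE \<omega> in \<Omega>. norm (Z k t \<omega>) \<le> R" "AE \<omega> in \<Omega>. norm (Z' t \<omega>) \<le> R"
  using AE_paths by (eventually_elim, blast)+

lemma wasserstein_le: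
  assumes [measurable]: "X \<in> borel_measurable \<Omega>" "Y \<in> borel_measurable \<Omega>"
    and "AE \<omega> in \<Omega>. norm (X \<omega>) \<le> R" "AE \<omega> in \<Omega>. norm (Y \<omega>) \<le> R"
    and "(\<integral>\<omega>. dist (X \<omega>) (Y \<omega>) \<partial>\<Omega>) \<le> c"
  shows "wasserstein (distr \<Omega> borel X) (distr \<Omega> borel (Y :: _ \<Rightarrow> 'a)) \<le> ennreal c"
proof -
  have "(\<integral>\<^sup>+\<omega>. ennreal (dist (X \<omega>) (Y \<omega>)) \<partial>\<Omega>) = ennreal (\<integral>\<omega>. dist (X \<omega>) (Y \<omega>) \<partial>\<Omega>)"
    using assms by (intro nn_integral_eq_integral integrable_dist) auto
  then show ?thesis
    using wasserstein_distr_le[OF prob_\<Omega> assms(1,2)] assms(5) by (metis ennreal_leI order_trans)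
qed

lemma e_tendsto_0: "(\<lambda>k. e k t) \<longlonglongrightarrow> 0"
proof -
  have "(\<lambda>k. e k t) \<longlonglongrightarrow> (\<integral>\<omega>. 0 \<partial>\<Omega>)"
    unfolding e_def
  proof (rule integral_dominated_convergence[where w="\<lambda>_. 2 * R"])
    show "AE \<omega> in \<Omega>. (\<lambda>k. dist (Z k t \<omega>) (Z' t \<omega>)) \<longlonglongrightarrow> 0"
      using AE_paths by eventually_elim (metis tendsto_dist_iff)
    show "AE \<omega> in \<Omega>. norm (dist (Z k t \<omega>) (Z' t \<omega>)) \<le> 2 * R" for k
      using AE_norm_le(1)[of k t] AE_norm_le(2)[of t]
    proof eventually_elim
      case (elim \<omega>)
      then show ?case
        using norm_triangle_ineq4[of "Z k t \<omega>" "Z' t \<omega>"] by (simp add: dist_norm)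
    qed
  qed auto
  then show ?thesis by simp
qed

lemma e_lipschitz: "\<bar>e k s - e k t\<bar> \<le> 2 * K * \<bar>s - t\<bar>"
proof -
  have le: "e k s \<le> e k t + 2 * K * \<bar>s - t\<bar>" for s t
  proof -
    have "e k s \<le> (\<integral>\<omega>. dist (Z k t \<omega>) (Z' t \<omega>) + 2 * K * \<bar>s - t\<bar> \<partial>\<Omega>)"
      unfolding e_def
    proof (rule integral_mono_AE)
      show "AE \<omega> in \<Omega>. dist (Z k s \<omega>) (Z' s \<omega>) \<le> dist (Z k t \<omega>) (Z' t \<omega>) + 2 * K * \<bar>s - t\<bar>"
        using AE_paths
      proof eventually_elim
        case (elim \<omega>)
        then have "dist (Z k s \<omega>) (Z k t \<omega>) \<le> K * \<bar>s - t\<bar>" "dist (Z' s \<omega>) (Z' t \<omega>) \<le> K * \<bar>s - t\<bar>"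
          by auto
        then show ?case
          using dist_triangle[of "Z k s \<omega>" "Z' s \<omega>" "Z k t \<omega>"] dist_triangle[of "Z k t \<omega>" "Z' s \<omega>" "Z' t \<omega>"]
          by (simp add: dist_commute)
      qed
    qed (auto intro!: integrable_dist Bochner_Integration.integrable_add AE_norm_le)
    also have "\<dots> = e k t + 2 * K * \<bar>s - t\<bar>"
      by (subst Bochner_Integration.integral_add)
         (auto intro!: integrable_dist AE_norm_le simp: e_def \<Omega>.prob_space)
    finally show ?thesis .
  qed
  show ?thesis
    using le[of s t] le[of t s] by (simp add: abs_le_iff abs_minus_commute)
qed

lemma wasserstein_path_le: "wasserstein (\<mu> t) (distr \<mu>0 borel (path (r k) s)) \<le> ennreal (e k t + K * \<bar>s - t\<bar>)"
proof -
  have "(\<integral>\<omega>. dist (Z' t \<omega>) (Z k s \<omega>) \<partial>\<Omega>) \<le> (\<integral>\<omega>. dist (Z k t \<omega>) (Z' t \<omega>) + K * \<bar>s - t\<bar> \<partial>\<Omega>)"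
  proof (rule integral_mono_AE)
    show "AE \<omega> in \<Omega>. dist (Z' t \<omega>) (Z k s \<omega>) \<le> dist (Z k t \<omega>) (Z' t \<omega>) + K * \<bar>s - t\<bar>"
      using AE_paths
    proof eventually_elim
      case (elim \<omega>)
      then have "dist (Z k s \<omega>) (Z k t \<omega>) \<le> K * \<bar>s - t\<bar>"
        by auto
      then show ?case
        using dist_triangle[of "Z' t \<omega>" "Z k s \<omega>" "Z k t \<omega>"] by (simp add: dist_commute)
    qed
  qed (auto intro!: integrable_dist Bochner_Integration.integrable_add AE_norm_le)
  also have "\<dots> = e k t + K * \<bar>s - t\<bar>"
    by (subst Bochner_Integration.integral_add)
       (auto intro!: integrable_dist AE_norm_le simp: e_def \<Omega>.prob_space)
  finally show ?thesis
    unfolding \<mu>_def Z_law[symmetric] by (intro wasserstein_le AE_norm_le) auto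
qed

lemma wasserstein_\<mu>_le: "wasserstein (\<mu> t) (\<mu> s) \<le> ennreal (K * \<bar>s - t\<bar>)"
proof -
  have "(\<integral>\<omega>. dist (Z' t \<omega>) (Z' s \<omega>) \<partial>\<Omega>) \<le> (\<integral>\<omega>. K * \<bar>s - t\<bar> \<partial>\<Omega>)"
  proof (rule integral_mono_AE)
    show "AE \<omega> in \<Omega>. dist (Z' t \<omega>) (Z' s \<omega>) \<le> K * \<bar>s - t\<bar>"
      using AE_paths by eventually_elim (metis abs_minus_commute)
  qed (auto intro!: integrable_dist AE_norm_le)
  then show ?thesis
    unfolding \<mu>_def by (intro wasserstein_le AE_norm_le) (auto simp: \<Omega>.prob_space)
qed

lemma wasserstein_scheme_le:
  assumes "0 \<le> t" "t \<le> T"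
  shows "wasserstein (mean_velocity_scheme V T \<mu>0 (r k) t) (\<mu> t) \<le> ennreal (e k t)"
  unfolding scheme_eq_distr_path[OF r(1) assms] Z_law[symmetric] \<mu>_def
  by (intro wasserstein_le AE_norm_le) (auto simp: e_def)

lemma \<mu>_probs: "\<mu> t \<in> probs"
  by (auto simp: \<mu>_def probs_iff intro!: \<Omega>.prob_space_distr)

lemma AE_\<mu>: "AE x in \<mu> t. norm x \<le> R"
  unfolding \<mu>_def using AE_norm_le(2) by (subst AE_distr_iff) auto

lemma \<mu>_probs_c: "\<mu> t \<in> probs_c"
  using \<mu>_probs AE_\<mu> by (auto simp: probs_c_iff)

lemma V_\<mu>: "V (\<mu> t) \<in> probs" "AE p in V (\<mu> t). norm (snd p) \<le> velocity_bound"
proof -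
  show V_probs: "V (\<mu> t) \<in> probs"
    using V \<mu>_probs by (simp add: prob_vector_field_def)
  have "AE p in V (\<mu> t). norm (snd p) \<le> C * (1 + R)"
    using AE_norm_velocity_le[OF V_probs \<mu>_probs _ R_nonneg growth[OF \<mu>_probs_c] AE_\<mu>] C by simp
  then show "AE p in V (\<mu> t). norm (snd p) \<le> velocity_bound"
    by (auto simp: velocity_bound_def elim!: eventually_mono)
qed

lemma \<mu>_initial: "\<mu> 0 = \<mu>0"
  unfolding \<mu>_def
proof (rule distr_eq_of_AE_tendsto[OF prob_\<Omega>])
  show "distr \<Omega> borel (Z k 0) = \<mu>0" for k
    using scheme_eq_distr_path[OF r(1), of 0 k] T by (simp add: Z_law mean_velocity_scheme_def)
  show "AE \<omega> in \<Omega>. (\<lambda>k. Z k 0 \<omega>) \<longlonglongrightarrow> Z' 0 \<omega>"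
    using AE_paths by eventually_elim blast
qed auto

lemma eventually_e_less: "\<delta> > 0 \<Longrightarrow> \<forall>\<^sub>F k in sequentially. \<forall>t\<in>{0..T}. \<bar>e k t\<bar> < \<delta>"
  using K_nonneg by (intro lipschitz_pointwise_imp_uniform[OF e_lipschitz _ T e_tendsto_0]) auto

lemma scheme_converges: "uniformly_converges T (\<lambda>k. mean_velocity_scheme V T \<mu>0 (r k)) \<mu>"
  unfolding uniformly_converges_def
proof (intro conjI ballI \<mu>_probs_c order_tendstoI)
  fix a :: ennreal assume "0 < a"
  \<comment> \<open>An intermediate value leaves room for the supremum: the bounds at single times
    give at most \<open>b\<close>, which is strictly below \<open>a\<close>.\<close>
  then obtain b where b: "0 < b" "b < a"
    using dense by blast
  then obtain \<delta> where \<delta>: "b = ennreal \<delta>" "\<delta> > 0"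
    by (cases b) auto
  show "\<forall>\<^sub>F k in sequentially. (SUP t\<in>{0..T}. wasserstein (mean_velocity_scheme V T \<mu>0 (r k) t) (\<mu> t)) < a"
    using eventually_e_less[OF \<delta>(2)]
  proof eventually_elim
    case (elim k)
    have "(SUP t\<in>{0..T}. wasserstein (mean_velocity_scheme V T \<mu>0 (r k) t) (\<mu> t)) \<le> b"
    proof (rule SUP_least)
      fix t assume t: "t \<in> {0..T}"
      then have "wasserstein (mean_velocity_scheme V T \<mu>0 (r k) t) (\<mu> t) \<le> ennreal (e k t)"
        by (intro wasserstein_scheme_le) auto
      also have "\<dots> \<le> b"
        using elim t unfolding \<delta>(1) by (intro ennreal_leI) (auto simp: abs_less_iff intro: less_imp_le)
      finally show "wasserstein (mean_velocity_scheme V T \<mu>0 (r k) t) (\<mu> t) \<le> b" .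
    qed
    then show ?case
      using b(2) by (rule order_le_less_trans)
  qed
qed auto

lemma cell_size_tendsto_0: "(\<lambda>k. T / real (r k)) \<longlonglongrightarrow> 0"
  using LIMSEQ_subseq_LIMSEQ[OF lim_const_over_n[of T] r(2)] by (simp add: o_def)

lemma cell_exists:
  assumes "N \<ge> 1" "0 \<le> s" "s \<le> T"
  shows "\<exists>j<N. s \<in> {real j * (T / N)..real (Suc j) * (T / N)}"
proof -
  define q where "q = s / (T / N)"
  have s: "s = q * (T / N)"
    using T assms by (simp add: q_def)
  have q: "0 \<le> q" "q \<le> N"
    using T assms by (auto simp: q_def field_simps)
  \<comment> \<open>At the final time the integer part of \<open>q\<close> is \<open>N\<close>, one
    past the last cell, so this case takes \<open>N - 1\<close>.\<close>
  obtain j where j: "j < N" "real j \<le> q" "q \<le> real (Suc j)"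
  proof (cases "q = N")
    case True
    then show ?thesis
      using that[of "N - 1"] assms by simp
  next
    case False
    have fl: "real (nat \<lfloor>q\<rfloor>) = of_int \<lfloor>q\<rfloor>"
      using q by simp
    then have "real (nat \<lfloor>q\<rfloor>) < N" "real (nat \<lfloor>q\<rfloor>) \<le> q" "q \<le> real (Suc (nat \<lfloor>q\<rfloor>))"
      using False q by linarith+
    then show ?thesis
      by (intro that[of "nat \<lfloor>q\<rfloor>"]) (simp_all only: of_nat_less_iff)
  qed
  then show ?thesis
    using T unfolding s by (intro exI[of _ j]) (auto intro!: mult_right_mono simp del: of_nat_Suc times_divide_eq_right)
qed

section \<open>The limit equation for one test function\<close>

context
  fixes f :: "'a \<Rightarrow> real" and B L :: real
  assumes bg: "bounded_gradient f B L"
begin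

interpretation bounded_gradient f B L
  by (rule bg)

abbreviation H :: "real \<Rightarrow> real" where
  "H t \<equiv> weak_velocity f (V (\<mu> t))"

text \<open>(H2) at \<open>\<mu> t\<close> makes \<open>V \<nu>\<close> close to
  \<open>V (\<mu> t)\<close>, and the pairing is Lipschitz under the common velocity bound. The
  resulting \<open>\<delta>\<close> depends on \<open>t\<close>, which keeps all later estimates
  local in time.\<close>

lemma weak_velocity_continuous_at:
  assumes "\<epsilon> > 0"
  obtains \<delta> where "\<delta> > 0" "\<And>\<nu>. \<nu> \<in> probs_c \<Longrightarrow> AE p in V \<nu>. norm (snd p) \<le> velocity_bound \<Longrightarrow>
    wasserstein (\<mu> t) \<nu> < ennreal \<delta> \<Longrightarrow> \<bar>H t - weak_velocity f (V \<nu>)\<bar> \<le> \<epsilon>"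
proof -
  \<comment> \<open>The summand 1 keeps \<open>\<Lambda>\<close> positive, so that dividing
    \<open>\<epsilon>\<close> by it is legitimate even for a constant pairing.\<close>
  define \<Lambda> where "\<Lambda> = L * velocity_bound + B + 1"
  have k: "velocity_bound \<ge> 0"
    using K_nonneg by (simp add: velocity_bound_def)
  then have \<Lambda>: "\<Lambda> > 0" "L * velocity_bound + B \<le> \<Lambda>"
    using L B by (auto simp: \<Lambda>_def intro!: add_nonneg_pos)
  then have "\<epsilon> / \<Lambda> > 0" using assms by simp
  then obtain \<delta> where \<delta>: "\<delta> > 0"
    "\<And>\<nu>. \<nu> \<in> probs_c \<Longrightarrow> wasserstein (\<mu> t) \<nu> < ennreal \<delta> \<Longrightarrow> wasserstein (V (\<mu> t)) (V \<nu>) < ennreal (\<epsilon> / \<Lambda>)"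
    using continuous_V \<mu>_probs_c[of t] unfolding wasserstein_continuous_def by blast
  have "\<bar>H t - weak_velocity f (V \<nu>)\<bar> \<le> \<epsilon>"
    if \<nu>: "\<nu> \<in> probs_c" "AE p in V \<nu>. norm (snd p) \<le> velocity_bound" "wasserstein (\<mu> t) \<nu> < ennreal \<delta>" for \<nu>
  proof -
    have "V \<nu> \<in> probs"
      using V \<nu>(1) by (auto simp: prob_vector_field_def probs_c_def)
    then have "\<bar>H t - weak_velocity f (V \<nu>)\<bar> \<le> (L * velocity_bound + B) * (\<epsilon> / \<Lambda>)"
      using V_\<mu> \<nu> \<delta>(2) k by (intro weak_velocity_diff_le) auto
    also have "\<dots> \<le> \<Lambda> * (\<epsilon> / \<Lambda>)"
      using \<Lambda> assms by (intro mult_right_mono) auto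
    finally show ?thesis using \<Lambda> by simp
  qed
  with \<delta>(1) show ?thesis
    by (rule that)
qed

lemma H_continuous: "isCont H t"
  unfolding isCont_def
proof (rule metric_LIM_I)
  fix \<epsilon> :: real assume "\<epsilon> > 0"
  then obtain \<delta> where \<delta>: "\<delta> > 0" "\<And>\<nu>. \<nu> \<in> probs_c \<Longrightarrow> AE p in V \<nu>. norm (snd p) \<le> velocity_bound \<Longrightarrow>
    wasserstein (\<mu> t) \<nu> < ennreal \<delta> \<Longrightarrow> \<bar>H t - weak_velocity f (V \<nu>)\<bar> \<le> \<epsilon> / 2"
    using weak_velocity_continuous_at[of "\<epsilon> / 2"] by (metis half_gt_zero)
  have "dist (H s) (H t) < \<epsilon>" if s: "dist s t < \<delta> / (K + 1)" for s
  proof -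
    have "K * \<bar>s - t\<bar> \<le> K * (\<delta> / (K + 1))"
      using s K_nonneg by (intro mult_left_mono) (auto simp: dist_real_def)
    also have "\<dots> < \<delta>"
      using K_nonneg \<delta>(1) by (simp add: field_simps)
    finally have "wasserstein (\<mu> t) (\<mu> s) < ennreal \<delta>"
      using K_nonneg by (intro order_le_less_trans[OF wasserstein_\<mu>_le] ennreal_lessI) (auto simp: \<delta>)
    then have "\<bar>H t - H s\<bar> \<le> \<epsilon> / 2"
      by (intro \<delta>(2) \<mu>_probs_c V_\<mu>)
    then show ?thesis
      using \<open>\<epsilon> > 0\<close> by (simp add: dist_real_def abs_minus_commute)
  qed
  then show "\<exists>s>0. \<forall>x. x \<noteq> t \<and> dist x t < s \<longrightarrow> dist (H x) (H t) < \<epsilon>"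
    using \<delta>(1) K_nonneg by (intro exI[of _ "\<delta> / (K + 1)"]) auto
qed

lemma weak_velocity_node:
  assumes "\<epsilon> > 0" "t \<in> {0..T}"
  obtains \<eta> where "\<eta> > 0" "\<forall>\<^sub>F k in sequentially. \<forall>j<r k. \<bar>real j * (T / r k) - t\<bar> < \<eta> \<longrightarrow>
    \<bar>H t - weak_velocity f (V (node (r k) j))\<bar> \<le> \<epsilon>"
proof -
  obtain \<delta> where \<delta>: "\<delta> > 0" "\<And>\<nu>. \<nu> \<in> probs_c \<Longrightarrow> AE p in V \<nu>. norm (snd p) \<le> velocity_bound \<Longrightarrow>
    wasserstein (\<mu> t) \<nu> < ennreal \<delta> \<Longrightarrow> \<bar>H t - weak_velocity f (V \<nu>)\<bar> \<le> \<epsilon>"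
    using weak_velocity_continuous_at[OF assms(1)] by blast
  \<comment> \<open>Half of \<open>\<delta>\<close> is left for the coupling cost at time
    \<open>t\<close>, half for the motion between \<open>t\<close> and the node;
    \<open>K + 1\<close> avoids a division by 0.\<close>
  define \<eta> where "\<eta> = \<delta> / (2 * (K + 1))"
  have \<eta>: "\<eta> > 0" "K * \<eta> < \<delta> / 2"
    using \<delta>(1) K_nonneg by (auto simp: \<eta>_def field_simps)
  have "\<forall>\<^sub>F k in sequentially. \<bar>e k t\<bar> < \<delta> / 2"
    using eventually_e_less[of "\<delta> / 2"] \<delta>(1) assms(2) by (auto elim!: eventually_mono)
  then have "\<forall>\<^sub>F k in sequentially. \<forall>j<r k. \<bar>real j * (T / r k) - t\<bar> < \<eta> \<longrightarrow>
    \<bar>H t - weak_velocity f (V (node (r k) j))\<bar> \<le> \<epsilon>"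
  proof eventually_elim
    case (elim k)
    show ?case
    proof (intro allI impI)
      fix j assume j: "j < r k" and near: "\<bar>real j * (T / r k) - t\<bar> < \<eta>"
      have "K * \<bar>real j * (T / r k) - t\<bar> \<le> K * \<eta>"
        using near K_nonneg by (intro mult_left_mono) auto
      then have "e k t + K * \<bar>real j * (T / r k) - t\<bar> < \<delta>"
        using elim \<eta>(2) by linarith
      then have "wasserstein (\<mu> t) (node (r k) j) < ennreal \<delta>"
        unfolding node_eq_path[OF j]
        by (intro order_le_less_trans[OF wasserstein_path_le] ennreal_lessI) (auto simp: \<delta>)
      moreover have "AE p in V (node (r k) j). norm (snd p) \<le> velocity_bound"
        using AE_V_node[OF j] by (auto simp: velocity_bound_def elim!: eventually_mono)
      ultimately show "\<bar>H t - weak_velocity f (V (node (r k) j))\<bar> \<le> \<epsilon>"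
        by (intro \<delta>(2) node_probs_c j)
    qed
  qed
  with \<eta>(1) show ?thesis
    by (rule that)
qed

abbreviation F :: "real \<Rightarrow> real" where
  "F t \<equiv> (\<integral>x. f x \<partial>\<mu> t)"

lemma F_eq: "F t = (\<integral>\<omega>. f (Z' t \<omega>) \<partial>\<Omega>)"
  unfolding \<mu>_def by (subst integral_distr) auto

lemma integrable_f: "X \<in> borel_measurable \<Omega> \<Longrightarrow> integrable \<Omega> (\<lambda>\<omega>. f (X \<omega>))"
  by (rule \<Omega>.integrable_const_bound[where B=B]) (auto simp: f_le)

lemma F_limit: "(\<lambda>k. \<integral>x. f (path (r k) t x) \<partial>\<mu>0) \<longlonglongrightarrow> F t"
proof -
  have [measurable_cong]: "sets \<mu>0 = sets borel" using \<mu>0 by (simp add: probs_iff)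
  have "(\<integral>x. f (path (r k) t x) \<partial>\<mu>0) = (\<integral>\<omega>. f (Z k t \<omega>) \<partial>\<Omega>)" for k
  proof -
    have "(\<integral>x. f (path (r k) t x) \<partial>\<mu>0) = (\<integral>x. f x \<partial>distr \<mu>0 borel (path (r k) t))"
      by (subst integral_distr) auto
    also have "\<dots> = (\<integral>\<omega>. f (Z k t \<omega>) \<partial>\<Omega>)"
      unfolding Z_law[symmetric] by (subst integral_distr) auto
    finally show ?thesis .
  qed
  moreover have "(\<lambda>k. \<integral>\<omega>. f (Z k t \<omega>) \<partial>\<Omega>) \<longlonglongrightarrow> (\<integral>\<omega>. f (Z' t \<omega>) \<partial>\<Omega>)"
  proof (rule integral_dominated_convergence[where w="\<lambda>_. B"])
    show "AE \<omega> in \<Omega>. (\<lambda>k. f (Z k t \<omega>)) \<longlonglongrightarrow> f (Z' t \<omega>)"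
      using AE_paths
    proof eventually_elim
      case (elim \<omega>)
      then have "(\<lambda>k. Z k t \<omega>) \<longlonglongrightarrow> Z' t \<omega>" by blast
      then show ?case
        by (rule isCont_tendsto_compose[OF has_derivative_continuous[OF derivative]])
    qed
  qed (auto simp: f_le)
  ultimately show ?thesis
    by (simp add: F_eq)
qed

lemma F_lipschitz: "\<bar>F s - F t\<bar> \<le> B * K * \<bar>s - t\<bar>"
proof -
  have "\<bar>F s - F t\<bar> = \<bar>\<integral>\<omega>. f (Z' s \<omega>) - f (Z' t \<omega>) \<partial>\<Omega>\<bar>"
    by (simp add: F_eq integrable_f)
  also have "\<dots> \<le> (\<integral>\<omega>. \<bar>f (Z' s \<omega>) - f (Z' t \<omega>)\<bar> \<partial>\<Omega>)"
    by (rule integral_abs_bound)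
  also have "\<dots> \<le> (\<integral>\<omega>. B * K * \<bar>s - t\<bar> \<partial>\<Omega>)"
  proof (rule integral_mono_AE)
    show "AE \<omega> in \<Omega>. \<bar>f (Z' s \<omega>) - f (Z' t \<omega>)\<bar> \<le> B * K * \<bar>s - t\<bar>"
      using AE_paths
    proof eventually_elim
      case (elim \<omega>)
      then have "B * dist (Z' s \<omega>) (Z' t \<omega>) \<le> B * (K * \<bar>s - t\<bar>)"
        using B by (intro mult_left_mono) auto
      then show ?case
        using f_lipschitz[of "Z' s \<omega>" "Z' t \<omega>"] by (simp add: mult.assoc)
    qed
  qed (auto intro!: integrable_abs Bochner_Integration.integrable_diff integrable_f)
  finally show ?thesis
    by (simp add: \<Omega>.prob_space)
qed

text \<open>For large \<open>k\<close> the function \<open>G k s - s * H t\<close> is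
  \<open>\<epsilon>\<close>-Lipschitz near \<open>t\<close>: half of \<open>\<epsilon>\<close> pays
  for the discretisation within a cell, half for the difference between the weak velocity at the
  node and \<open>H t\<close>. Letting \<open>k\<close> grow keeps the estimate.\<close>

lemma F_increment:
  assumes "\<epsilon> > 0" "t \<in> {0..T}"
  obtains \<eta> where "\<eta> > 0" "\<And>s. s \<in> {0..T} \<Longrightarrow> \<bar>s - t\<bar> < \<eta> \<Longrightarrow> \<bar>F s - F t - (s - t) * H t\<bar> \<le> \<epsilon> * \<bar>s - t\<bar>"
proof -
  obtain \<eta> where \<eta>: "\<eta> > 0" and node: "\<forall>\<^sub>F k in sequentially. \<forall>j<r k. \<bar>real j * (T / r k) - t\<bar> < \<eta> \<longrightarrow>
    \<bar>H t - weak_velocity f (V (node (r k) j))\<bar> \<le> \<epsilon> / 2"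
    using weak_velocity_node[of "\<epsilon> / 2" t] assms by auto
  define a where "a = max 0 (t - \<eta> / 2)"
  define b where "b = min T (t + \<eta> / 2)"
  have "(\<lambda>k. L * (T / r k * K) * K) \<longlonglongrightarrow> L * (0 * K) * K"
    by (intro tendsto_intros cell_size_tendsto_0)
  then have small: "\<forall>\<^sub>F k in sequentially. L * (T / r k * K) * K < \<epsilon> / 2"
    using \<open>\<epsilon> > 0\<close> by (intro order_tendstoD) auto
  \<comment> \<open>A cell meeting the window of half-width \<open>\<eta> / 2\<close> then has its
    left node within \<open>\<eta>\<close> of \<open>t\<close>, where
    \<open>weak_velocity_node\<close> applies.\<close>
  have size: "\<forall>\<^sub>F k in sequentially. T / r k < \<eta> / 2"
    using \<eta> by (intro order_tendstoD(2)[OF cell_size_tendsto_0]) auto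
  have increment: "\<bar>F s - F t - (s - t) * H t\<bar> \<le> \<epsilon> * \<bar>s - t\<bar>" if s: "s \<in> {a..b}" for s
  proof -
    have t: "t \<in> {a..b}" using assms \<eta> by (auto simp: a_def b_def)
    define G where "G k s = (\<integral>x. f (path (r k) s x) \<partial>\<mu>0)" for k s
    have "\<forall>\<^sub>F k in sequentially. \<bar>G k s - G k t - (s - t) * H t\<bar> \<le> \<epsilon> * \<bar>s - t\<bar>"
      using node small size
    proof eventually_elim
      case (elim k)
      define \<Delta> where "\<Delta> = T / r k"
      define U where "U j = {real j * \<Delta>..real (Suc j) * \<Delta>} \<inter> {a..b}" for j
      \<comment> \<open>On an interval covered by finitely many closed pieces a common Lipschitz
        constant glues, so the growing number of cells does no harm.\<close>
      have "\<epsilon>-lipschitz_on {a..b} (\<lambda>s. G k s - s * H t)"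
      proof (rule lipschitz_on_closed_Union[where I="{..<r k}" and U=U])
        show "{a..b} \<subseteq> (\<Union>j\<in>{..<r k}. U j)"
        proof
          fix s assume s: "s \<in> {a..b}"
          then have "0 \<le> s" "s \<le> T" by (auto simp: a_def b_def)
          then show "s \<in> (\<Union>j\<in>{..<r k}. U j)"
            using cell_exists[OF r(1)[of k], of s] s by (auto simp: U_def \<Delta>_def)
        qed
        fix j assume "j \<in> {..<r k}"
        then have j: "j < r k" by simp
        show "\<epsilon>-lipschitz_on (U j) (\<lambda>s. G k s - s * H t)"
        proof (rule lipschitz_onI)
          fix x y assume xy: "x \<in> U j" "y \<in> U j"
          let ?w = "weak_velocity f (V (node (r k) j))"
          have "real (Suc j) * \<Delta> = real j * \<Delta> + \<Delta>"
            by (simp add: algebra_simps)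
          then have "\<bar>real j * \<Delta> - t\<bar> < \<eta>"
            using xy(1) elim(3) unfolding U_def a_def b_def \<Delta>_def[symmetric] by (auto simp: abs_less_iff)
          then have w: "\<bar>H t - ?w\<bar> \<le> \<epsilon> / 2"
            using elim(1) j by (auto simp: \<Delta>_def)
          have "\<bar>G k x - G k y - (x - y) * ?w\<bar> \<le> L * (T / r k * K) * K * \<bar>x - y\<bar>"
            unfolding G_def using xy by (intro weak_increment_in_cell[OF bg j]) (auto simp: U_def \<Delta>_def)
          also have "\<dots> \<le> \<epsilon> / 2 * \<bar>x - y\<bar>"
            using elim(2) by (intro mult_right_mono) auto
          finally have "\<bar>G k x - G k y - (x - y) * ?w\<bar> \<le> \<epsilon> / 2 * \<bar>x - y\<bar>" .
          moreover have "\<bar>(x - y) * (?w - H t)\<bar> \<le> \<epsilon> / 2 * \<bar>x - y\<bar>"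
            using mult_right_mono[OF w, of "\<bar>x - y\<bar>"]
            by (simp only: abs_mult abs_minus_commute[of ?w] mult.commute abs_ge_zero)
          moreover have "(G k x - x * H t) - (G k y - y * H t) =
              (G k x - G k y - (x - y) * ?w) + (x - y) * (?w - H t)"
            by (simp add: algebra_simps)
          ultimately show "dist (G k x - x * H t) (G k y - y * H t) \<le> \<epsilon> * dist x y"
            unfolding dist_real_def by linarith
        qed (use \<open>\<epsilon> > 0\<close> in simp)
      qed (use \<open>\<epsilon> > 0\<close> in \<open>auto simp: U_def\<close>)
      then have "dist (G k s - s * H t) (G k t - t * H t) \<le> \<epsilon> * dist s t"
        using s t by (rule lipschitz_onD)
      moreover have "(G k s - s * H t) - (G k t - t * H t) = G k s - G k t - (s - t) * H t"
        by (simp add: algebra_simps)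
      ultimately show ?case
        by (simp add: dist_real_def)
    qed
    moreover have "(\<lambda>k. \<bar>G k s - G k t - (s - t) * H t\<bar>) \<longlonglongrightarrow> \<bar>F s - F t - (s - t) * H t\<bar>"
      unfolding G_def by (intro tendsto_intros F_limit)
    ultimately show ?thesis
      by (intro tendsto_upperbound) auto
  qed
  show ?thesis
  proof (rule that[of "\<eta> / 2"])
    fix s assume s: "s \<in> {0..T}" "\<bar>s - t\<bar> < \<eta> / 2"
    then have "s - t < \<eta> / 2" "- (s - t) < \<eta> / 2"
      unfolding abs_less_iff by blast+
    then have "s \<in> {a..b}"
      using s(1) by (auto simp: a_def b_def)
    then show "\<bar>F s - F t - (s - t) * H t\<bar> \<le> \<epsilon> * \<bar>s - t\<bar>"
      by (rule increment)
  qed (use \<eta> in simp)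
qed

lemma F_has_derivative:
  assumes "0 < t" "t < T"
  shows "(F has_real_derivative H t) (at t)"
proof -
  have "((\<lambda>s. (F s - F t) / (s - t)) \<longlongrightarrow> H t) (at t)"
  proof (rule metric_LIM_I)
    fix \<epsilon> :: real assume "\<epsilon> > 0"
    then obtain \<eta> where \<eta>: "\<eta> > 0"
      "\<And>s. s \<in> {0..T} \<Longrightarrow> \<bar>s - t\<bar> < \<eta> \<Longrightarrow> \<bar>F s - F t - (s - t) * H t\<bar> \<le> \<epsilon> / 2 * \<bar>s - t\<bar>"
      using F_increment[of "\<epsilon> / 2" t] assms by auto
    \<comment> \<open>Besides \<open>\<eta>\<close>, the distances to 0 and \<open>T\<close> limit
      the step, since the increment estimate is available inside [0, T] only.\<close>
    have "dist ((F s - F t) / (s - t)) (H t) < \<epsilon>" if s: "s \<noteq> t" "dist s t < min \<eta> (min t (T - t))" for s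
    proof -
      have "\<bar>F s - F t - (s - t) * H t\<bar> \<le> \<epsilon> / 2 * \<bar>s - t\<bar>"
        using s by (intro \<eta>(2)) (auto simp: dist_real_def)
      moreover have "(F s - F t) / (s - t) - H t = (F s - F t - (s - t) * H t) / (s - t)"
        using s by (simp add: field_simps)
      ultimately have "dist ((F s - F t) / (s - t)) (H t) \<le> \<epsilon> / 2"
        using s by (simp add: dist_real_def divide_le_eq)
      then show ?thesis
        using \<open>\<epsilon> > 0\<close> by simp
    qed
    then show "\<exists>d>0. \<forall>s. s \<noteq> t \<and> dist s t < d \<longrightarrow> dist ((F s - F t) / (s - t)) (H t) < \<epsilon>"
      using \<eta>(1) assms by (intro exI[of _ "min \<eta> (min t (T - t))"]) auto
  qed
  then show ?thesis
    by (simp add: has_field_derivative_iff)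
qed

end

lemma solves: "is_solution V T \<mu>0 \<mu>"
  unfolding is_solution_def
proof (intro conjI ballI \<mu>_probs \<mu>_initial)
  fix f :: "'a \<Rightarrow> real" assume "f \<in> test_functions"
  then obtain B L where bg: "bounded_gradient f B L"
    by (rule test_function_bounded_gradient)
  interpret bounded_gradient f B L by fact
  show "AE t in lebesgue. t \<in> {0..T} \<longrightarrow> integrable (V (\<mu> t)) (\<lambda>(x, v). gradient f x \<bullet> v)"
    by (intro AE_I2 impI integrable_pairing[OF V_\<mu>])
  have "continuous_on {0..T} (\<lambda>t. weak_velocity f (V (\<mu> t)))"
    by (intro continuous_at_imp_continuous_on ballI H_continuous[OF bg])
  then show "(\<lambda>t. \<integral>(x, v). gradient f x \<bullet> v \<partial>V (\<mu> t)) absolutely_integrable_on {0..T}"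
    unfolding weak_velocity_def by (rule absolutely_integrable_continuous_real)
  show "absolutely_continuous_on {0..T} (\<lambda>t. \<integral>x. f x \<partial>\<mu> t)"
    using B K_nonneg by (intro lipschitz_imp_absolutely_continuous_on[OF F_lipschitz[OF bg]]) auto
  \<comment> \<open>At the end points the two-sided derivative would involve the curve outside
    [0, T]; these two times are put into the exceptional null set.\<close>
  have "{0, T} \<in> null_sets lebesgue"
    by (intro null_sets_completionI finite_imp_null_set_lborel) simp
  then have "AE t in lebesgue. t \<notin> {0, T}"
    by (rule AE_not_in)
  then show "AE t in lebesgue. t \<in> {0..T} \<longrightarrow>
      ((\<lambda>s. \<integral>x. f x \<partial>\<mu> s) has_real_derivative (\<integral>(x, v). gradient f x \<bullet> v \<partial>V (\<mu> t))) (at t)"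
  proof eventually_elim
    case (elim t)
    then show ?case
      using F_has_derivative[OF bg, of t] unfolding weak_velocity_def by auto
  qed
qed

end

lemma (in mean_velocity_dynamics) scheme_converges_to_solution:
  "\<exists>r \<mu>. strict_mono r \<and> (\<forall>k. r k \<ge> 1) \<and>
    uniformly_converges T (\<lambda>k. mean_velocity_scheme V T \<mu>0 (r k)) \<mu> \<and> is_solution V T \<mu>0 \<mu>"
proof -
  have ps: "prob_space \<mu>0" and [measurable_cong]: "sets \<mu>0 = sets borel"
    using \<mu>0 by (auto simp: probs_iff)
  \<comment> \<open>Indexing by \<open>Suc k\<close> leaves out \<open>N = 0\<close>, which has no
    time step.\<close>
  have meas: "path (Suc k) t \<in> borel_measurable \<mu>0" for k t
    by measurable
  obtain r \<Omega> Z Z' where rZ: "strict_mono (r :: nat \<Rightarrow> nat)" "prob_space (\<Omega> :: real measure)"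
    "\<And>k t. Z k t \<in> borel_measurable \<Omega>" "\<And>t. Z' t \<in> borel_measurable \<Omega>"
    "\<And>k t. distr \<Omega> borel (Z k t) = distr \<mu>0 borel (path (Suc (r k)) t)"
    "AE \<omega> in \<Omega>. (\<forall>t. norm (Z' t \<omega>) \<le> R) \<and> (\<forall>s t. dist (Z' s \<omega>) (Z' t \<omega>) \<le> K * \<bar>s - t\<bar>) \<and>
      (\<forall>k t. norm (Z k t \<omega>) \<le> R) \<and> (\<forall>k s t. dist (Z k s \<omega>) (Z k t \<omega>) \<le> K * \<bar>s - t\<bar>) \<and>
      (\<forall>t. (\<lambda>k. Z k t \<omega>) \<longlonglongrightarrow> Z' t \<omega>)"
    by (rule random_lipschitz_paths_compact[where X="\<lambda>k. path (Suc k)",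
          OF ps meas norm_path_le dist_path_le K_nonneg]) (rule that)
  have strict_mono: "strict_mono (\<lambda>k. Suc (r k))"
    using rZ(1) by (simp add: strict_mono_def)
  interpret scheme_limit V T C R0 \<mu>0 "\<lambda>k. Suc (r k)" \<Omega> Z Z'
    by (intro scheme_limit.intro scheme_limit_axioms.intro mean_velocity_dynamics_axioms strict_mono rZ) simp
  show ?thesis
    by (rule exI[of _ "\<lambda>k. Suc (r k)"], rule exI[of _ \<mu>])
      (intro conjI allI strict_mono scheme_converges solves, simp)
qed

theorem theorem5p1:
  fixes V :: "'a::euclidean_space measure \<Rightarrow> ('a \<times> 'a) measure"
    and T :: real and \<mu>0 :: "'a measure"
  assumes "T > 0"
    and "prob_vector_field V"
    and H1: "\<exists>C>0::real. \<forall>\<mu>\<in>probs_c.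
      (SUP (x, v)\<in>msupport (V \<mu>). ennreal (norm v)) \<le>
        ennreal C * (1 + (SUP x\<in>msupport \<mu>. ennreal (norm x)))"
    and H2: "wasserstein_continuous V"
    and "\<mu>0 \<in> probs_c"
  shows "\<exists>r \<mu>. strict_mono r \<and> (\<forall>k. r k \<ge> 1) \<and>
    uniformly_converges T (\<lambda>k. mean_velocity_scheme V T \<mu>0 (r k)) \<mu> \<and>
    is_solution V T \<mu>0 \<mu>"
proof -
  obtain C where C: "C > 0" "\<And>\<mu>. \<mu> \<in> probs_c \<Longrightarrow> (SUP (x, v)\<in>msupport (V \<mu>). ennreal (norm v)) \<le>
      ennreal C * (1 + (SUP x\<in>msupport \<mu>. ennreal (norm x)))"
    using H1 by blast
  obtain R0 where \<mu>0: "\<mu>0 \<in> probs" and R0: "AE x in \<mu>0. norm x \<le> R0"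
    using \<open>\<mu>0 \<in> probs_c\<close> by (auto simp: probs_c_iff)
  \<comment> \<open>The bound obtained from \<open>probs_c_iff\<close> comes without a sign, and the
    locale asks for a non-negative radius.\<close>
  have "AE x in \<mu>0. norm x \<le> \<bar>R0\<bar>"
    using R0 by (auto elim!: eventually_mono)
  then interpret mean_velocity_dynamics V T C "\<bar>R0\<bar>" \<mu>0
    using assms C \<mu>0 by unfold_locales auto
  show ?thesis
    by (rule scheme_converges_to_solution)
qed

end
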